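(* Let $(X,K)$ be the strong solution of $$\mathrm dX(t)+\mathsf A(X(t))\,\mathrm dt+\beta(t)\nabla\Psi(X(t))\,\mathrm dt\ni\sigma(t,X(t))\,\mathrm dW(t),\qquad X(0)=\xi\in L^2(\Omega;\mathrm{cl}(\mathrm{dom}\,\mathsf A)),$$ under the assumptions of the context, and define the Cesàro average $\bar X(t)=\frac1t\int_0^tX(s)\,\mathrm ds$. Let $a\in\mathrm{int}(\mathrm{dom}\,\mathsf A)\cap\mathrm{int}(C)$ and let $\delta>0$ be such that the closed ball $B_\delta=\{x:\|x-a\|\le\delta\}$ is contained in $\mathrm{int}(\mathrm{dom}\,\mathsf A)\cap\mathrm{int}(C)$. Let $$\Theta_\delta(x)=\sup\{\langle y^*,x-y\rangle: y\in B_\delta,\ y^*\in(\mathsf A+\mathrm N_C)(y)\}.$$ If $\Sigma(t):=\sup_{x\in\mathbb R^d}\|\sigma(t,x)\|_{\mathrm F}$ belongs to $L^2([0,\infty);\mathbb R_+)$, then $\mathbb E[\Theta_\delta(\bar X(t))]=O(1/t)$ for all $t>0$, in the sense that there is a constant $c_\delta<\infty$ with $\mathbb E[\Theta_\delta(\bar X(t))]\le c_\delta/t$ for all $t>0$.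
   Context: Let $(\Omega,\mathcal F,(\mathcal F_t)_{t\ge0},\mathbb P)$ be a filtered probability space carrying an $m$-dimensional Brownian motion $W$. $\|\cdot\|$ is the Euclidean norm and $\|\cdot\|_{\mathrm F}$ the Frobenius norm. Operator and set: $\mathsf A:\mathbb R^d\to2^{\mathbb R^d}$ is maximally monotone, $C\subset\mathbb R^d$ is nonempty, closed and convex, $\mathrm N_C$ is the normal cone mapping of $C$ (with $\mathrm N_C(x)=\emptyset$ for $x\notin C$), $\mathrm{int}(\mathrm{dom}\,\mathsf A)\cap\mathrm{int}(C)\neq\emptyset$, $\mathsf A+\mathrm N_C$ is maximally monotone, and $\mathcal S=\{x:0\in\mathsf A(x)+\mathrm N_C(x)\}\neq\emptyset$. Moreover $C\subseteq\mathrm{dom}\,\mathsf A$ and $\mathsf A$ is upper semicontinuous on $C$: for every $x\in C$ and open $O\subset\mathbb R^d$ with $\mathsf A(x)\subset O$ there is an open neighbourhood $U$ of $x$ with $\mathsf A(x')\subset O$ for all $x'\in U$. Penalty: $\Psi:\mathbb R^d\to\mathbb R$ is convex and continuously differentiable with Lipschitz continuous gradient, and $C=\Psi^{-1}(0)=\mathrm{argmin}\,\Psi\ne\emptyset$. The penalty parameter $\beta:[0,\infty)\to(0,\infty)$ is (locally) absolutely continuous and non-decreasing. Attouch--Czarnecki condition: for all $q\in\mathrm{Range}(\mathrm N_C)$, $\int_0^\infty\beta(r)\big[\Psi^*(q/\beta(r))-\mathsf s_C(q/\beta(r))\big]\mathrm dr<\infty$, where $\Psi^*$ is the Fenchel conjugate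 and $\mathsf s_C(x^* )=\sup_{u\in C}\langle x^*,u\rangle$. Noise: $\sigma:[0,\infty)\times\mathbb R^d\to\mathbb R^{d\times m}$ is measurable and $\|\sigma(t,x)-\sigma(t,y)\|_{\mathrm F}\le\ell(t)\|x-y\|$ for all $x,y$, with $\ell\in L^2(0,\infty;\mathbb R_{\ge0})$. Strong solution: a pair of continuous $\mathbb R^d$-valued $\mathcal F_t$-adapted processes $(X,K)$ on $[0,\infty)$ such that on every $[0,T]$: $X(t)\in\mathrm{cl}(\mathrm{dom}\,\mathsf A)$ a.s. for all $t$; $X(0)=\xi$ a.s.; $K$ has sample paths of bounded variation on $[0,T]$ and $\mathrm dX(t)=-\beta(t)\nabla\Psi(X(t))\mathrm dt+\sigma(t,X(t))\mathrm dW(t)-\mathrm dK(t)$ a.s.; and for all continuous adapted $\mathbb R^d$-valued processes $\zeta,\zeta^*$ with $(\zeta(t),\zeta^*(t))\in\mathrm{gr}(\mathsf A)$ for all $t\in[0,T]$, the measure $\langle X(t)-\zeta(t),\mathrm dK(t)-\zeta^*(t)\mathrm dt\rangle$ is a.s. non-negative on $[0,T]$. *)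

theory Defs
  imports "HOL-Probability.Probability"
begin

section \<open>Set-valued operators and convex analysis\<close>

definition op_dom :: "('a \<Rightarrow> 'b set) \<Rightarrow> 'a set" where
  "op_dom A = {x. A x \<noteq> {}}"

definition op_graph :: "('a \<Rightarrow> 'b set) \<Rightarrow> ('a \<times> 'b) set" where
  "op_graph A = {(x, u). u \<in> A x}"

definition op_plus :: "('a \<Rightarrow> 'b::plus set) \<Rightarrow> ('a \<Rightarrow> 'b set) \<Rightarrow> 'a \<Rightarrow> 'b set" where
  "op_plus A B = (\<lambda>x. {u + v | u v. u \<in> A x \<and> v \<in> B x})"

definition monotone_op :: "('a::real_inner \<Rightarrow> 'a set) \<Rightarrow> bool" where
  "monotone_op A \<longleftrightarrow> (\<forall>x y. \<forall>u\<in>A x. \<forall>v\<in>A y. 0 \<le> (x - y) \<bullet> (u - v))"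

definition maximally_monotone :: "('a::real_inner \<Rightarrow> 'a set) \<Rightarrow> bool" where
  "maximally_monotone A \<longleftrightarrow> monotone_op A \<and>
     (\<forall>B. monotone_op B \<longrightarrow> op_graph A \<subseteq> op_graph B \<longrightarrow> op_graph B = op_graph A)"

definition normal_cone :: "'a::real_inner set \<Rightarrow> 'a \<Rightarrow> 'a set" where
  "normal_cone C x = (if x \<in> C then {p. \<forall>u\<in>C. p \<bullet> (u - x) \<le> 0} else {})"

text \<open>The neighbourhood is a neighbourhood in the whole space, not only relative to \<open>C\<close>.\<close>

definition usc_on :: "'a::topological_space set \<Rightarrow> ('a \<Rightarrow> 'b::topological_space set) \<Rightarrow> bool" where
  "usc_on C A \<longleftrightarrow> (\<forall>x\<in>C. \<forall>O'. open O' \<and> A x \<subseteq> O' \<longrightarrow>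
     (\<exists>U. open U \<and> x \<in> U \<and> (\<forall>x'\<in>U. A x' \<subseteq> O')))"

definition fenchel_conj :: "('a::real_inner \<Rightarrow> real) \<Rightarrow> 'a \<Rightarrow> ereal" where
  "fenchel_conj f p = (SUP x. ereal (p \<bullet> x - f x))"

definition support_fun :: "'a::real_inner set \<Rightarrow> 'a \<Rightarrow> ereal" where
  "support_fun C p = (SUP u\<in>C. ereal (p \<bullet> u))"

text \<open>For \<open>q\<close> in the range of the normal cone the support function is finite, and if \<open>\<Psi>\<close> vanishes
  on \<open>C\<close> the bracket is non-negative, so that neither the subtraction nor \<^const>\<open>e2ennreal\<close>
  loses information.\<close>

definition attouch_czarnecki ::
  "(real \<Rightarrow> real) \<Rightarrow> ('a::real_inner \<Rightarrow> real) \<Rightarrow> 'a set \<Rightarrow> bool" where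
  "attouch_czarnecki \<beta> \<Psi> C \<longleftrightarrow>
     (\<forall>q \<in> (\<Union>x. normal_cone C x).
        (\<integral>\<^sup>+ r\<in>{0..}. e2ennreal (ereal (\<beta> r) *
            (fenchel_conj \<Psi> (q /\<^sub>R \<beta> r) - support_fun C (q /\<^sub>R \<beta> r))) \<partial>lborel) < \<infinity>)"

text \<open>\<open>gap_fun T B x = sup {\<langle>v, x - y\<rangle> : y \<in> B, v \<in> T y}\<close>, as an extended real.\<close>

definition gap_fun :: "('a::real_inner \<Rightarrow> 'a set) \<Rightarrow> 'a set \<Rightarrow> 'a \<Rightarrow> ereal" where
  "gap_fun T B x = Sup {ereal (v \<bullet> (x - y)) | y v. y \<in> B \<and> v \<in> T y}"


section \<open>Real functions: absolute continuity, bounded variation, Stieltjes measures\<close>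

definition abs_continuous_on :: "real \<Rightarrow> real \<Rightarrow> (real \<Rightarrow> real) \<Rightarrow> bool" where
  "abs_continuous_on a b f \<longleftrightarrow> (\<forall>\<epsilon>>0. \<exists>\<delta>>0. \<forall>(n::nat) l r.
     (\<forall>i<n. a \<le> l i \<and> l i \<le> r i \<and> r i \<le> b) \<and>
     disjoint_family_on (\<lambda>i. {l i<..<r i}) {..<n} \<and> (\<Sum>i<n. r i - l i) < \<delta> \<longrightarrow>
     (\<Sum>i<n. \<bar>f (r i) - f (l i)\<bar>) < \<epsilon>)"

definition variation_sums :: "real \<Rightarrow> real \<Rightarrow> (real \<Rightarrow> 'a::real_normed_vector) \<Rightarrow> real set" where
  "variation_sums a b k =
     {\<Sum>i<n. norm (k (\<tau> (Suc i)) - k (\<tau> i)) | n \<tau>. mono_on {..n::nat} \<tau> \<and> \<tau> ` {..n} \<subseteq> {a..b}}"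

definition bounded_variation_on :: "real \<Rightarrow> real \<Rightarrow> (real \<Rightarrow> 'a::real_normed_vector) \<Rightarrow> bool" where
  "bounded_variation_on a b k \<longleftrightarrow> bdd_above (variation_sums a b k)"

definition total_variation :: "real \<Rightarrow> real \<Rightarrow> (real \<Rightarrow> 'a::real_normed_vector) \<Rightarrow> real" where
  "total_variation a b k = Sup (variation_sums a b k)"

text \<open>The Lebesgue--Stieltjes integral \<open>\<integral>\<^sub>B f dk\<close> over a Borel set \<open>B \<subseteq> {0..T}\<close>, for \<open>k\<close> continuous and
  of bounded variation on \<open>{0..T}\<close>. Writing \<open>V t\<close> for the total variation of \<open>k\<close> on \<open>{0..t}\<close>, both
  \<open>V\<close> and \<open>V - k\<close> are continuous and non-decreasing on \<open>{0..T}\<close> and \<open>k = V - (V - k)\<close>. They are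
  extended by constants outside \<open>{0..T}\<close>, so the point \<open>0\<close> carries no mass.\<close>

definition stieltjes_integral ::
  "real \<Rightarrow> (real \<Rightarrow> real) \<Rightarrow> real set \<Rightarrow> (real \<Rightarrow> real) \<Rightarrow> real" where
  "stieltjes_integral T k B f =
     (let c = (\<lambda>t. max 0 (min T t)); V = (\<lambda>t. total_variation 0 t k) in
       (LINT t:B|interval_measure (\<lambda>t. V (c t)). f t) -
       (LINT t:B|interval_measure (\<lambda>t. V (c t) - k (c t)). f t))"

text \<open>The signed measure \<open>\<langle>u t, dk t - v t dt\<rangle>\<close> on \<open>{0..T}\<close>, evaluated at \<open>B\<close>.\<close>

definition pairing_measure ::
  "real \<Rightarrow> (real \<Rightarrow> real ^ 'd) \<Rightarrow> (real \<Rightarrow> real ^ 'd) \<Rightarrow> (real \<Rightarrow> real ^ 'd) \<Rightarrow> real set \<Rightarrow> real" where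
  "pairing_measure T u k v B =
     (\<Sum>i\<in>UNIV. stieltjes_integral T (\<lambda>t. k t $ i) B (\<lambda>t. u t $ i)) -
     (LINT t:B|lborel. u t \<bullet> v t)"


section \<open>Matrices\<close>

text \<open>A \<open>d \<times> m\<close> matrix is an element of \<open>real ^ 'm ^ 'd\<close>, whose norm is the Frobenius norm.\<close>

lemma norm_matrix_Frobenius:
  fixes S :: "real ^ 'm ^ 'd"
  shows "norm S = sqrt (\<Sum>i\<in>UNIV. \<Sum>j\<in>UNIV. (S $ i $ j)\<^sup>2)"
  by (simp add: norm_vec_def L2_set_def sum_nonneg)


section \<open>Stochastic processes\<close>

text \<open>Time is of type \<^typ>\<open>real\<close>, but every condition concerns non-negative times only; a filtration
  indexed by \<open>[0,\<infinity>)\<close> is regarded as constant on \<open>(-\<infinity>,0]\<close>. Completeness or right-continuity of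
  the filtration is not required.\<close>

definition filtered_prob_space :: "'w measure \<Rightarrow> (real \<Rightarrow> 'w measure) \<Rightarrow> bool" where
  "filtered_prob_space M F \<longleftrightarrow>
     prob_space M \<and> filtration (space M) F \<and> (\<forall>t\<ge>0. subalgebra M (F t))"

definition continuous_adapted ::
  "'w measure \<Rightarrow> (real \<Rightarrow> 'w measure) \<Rightarrow> (real \<Rightarrow> 'w \<Rightarrow> 'a::topological_space) \<Rightarrow> bool" where
  "continuous_adapted M F Y \<longleftrightarrow>
     (\<forall>t\<ge>0. Y t \<in> borel_measurable (F t)) \<and> (\<forall>\<omega>\<in>space M. continuous_on {0..} (\<lambda>t. Y t \<omega>))"

definition brownian_motion ::
  "'w measure \<Rightarrow> (real \<Rightarrow> 'w measure) \<Rightarrow> (real \<Rightarrow> 'w \<Rightarrow> real ^ 'm) \<Rightarrow> bool" where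
  "brownian_motion M F W \<longleftrightarrow>
     continuous_adapted M F W \<and> (AE \<omega> in M. W 0 \<omega> = 0) \<and>
     (\<forall>s t. 0 \<le> s \<and> s < t \<longrightarrow>
        distributed M lborel (\<lambda>\<omega>. W t \<omega> - W s \<omega>)
          (\<lambda>x. ennreal (\<Prod>j\<in>UNIV. normal_density 0 (sqrt (t - s)) (x $ j))) \<and>
        prob_space.indep_set M (sets (F s))
          (sets (vimage_algebra (space M) (\<lambda>\<omega>. W t \<omega> - W s \<omega>) borel)))"

definition progressively_measurable ::
  "(real \<Rightarrow> 'w measure) \<Rightarrow> (real \<Rightarrow> 'w \<Rightarrow> 'a::topological_space) \<Rightarrow> bool" where
  "progressively_measurable F H \<longleftrightarrow>
     (\<forall>T\<ge>0. (\<lambda>(t, \<omega>). H t \<omega>) \<in> borel_measurable (restrict_space borel {0..T} \<Otimes>\<^sub>M F T))"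

text \<open>Measurability is part of the definition, since \<^const>\<open>measure\<close> vanishes on non-measurable
  sets.\<close>

definition null_in_probability :: "'w measure \<Rightarrow> (nat \<Rightarrow> 'w \<Rightarrow> ennreal) \<Rightarrow> bool" where
  "null_in_probability M Z \<longleftrightarrow>
     (\<forall>k. Z k \<in> borel_measurable M) \<and>
     (\<forall>\<epsilon>>0. (\<lambda>k. measure M {\<omega> \<in> space M. \<epsilon> < Z k \<omega>}) \<longlonglongrightarrow> 0)"

text \<open>Simple integrands \<open>\<Sum>i<n. \<eta>\<^sub>i 1_{(\<tau>\<^sub>i, \<tau>\<^sub>i\<^sub>+\<^sub>1]}\<close> with bounded \<open>F \<tau>\<^sub>i\<close>-measurable matrices \<open>\<eta>\<^sub>i\<close>, and their
  integrals.\<close>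

type_synonym ('w, 'm, 'd) simple_data = "nat \<times> (nat \<Rightarrow> real) \<times> (nat \<Rightarrow> 'w \<Rightarrow> real ^ 'm ^ 'd)"

definition simple_integrand ::
  "'w measure \<Rightarrow> (real \<Rightarrow> 'w measure) \<Rightarrow> ('w, 'm::finite, 'd::finite) simple_data \<Rightarrow> bool" where
  "simple_integrand M F = (\<lambda>(n, \<tau>, \<eta>). 0 \<le> \<tau> 0 \<and>
     (\<forall>i<n. \<tau> i < \<tau> (Suc i) \<and> \<eta> i \<in> borel_measurable (F (\<tau> i)) \<and>
        (\<exists>b. \<forall>\<omega>\<in>space M. norm (\<eta> i \<omega>) \<le> b)))"

definition simple_process ::
  "('w, 'm::finite, 'd::finite) simple_data \<Rightarrow> real \<Rightarrow> 'w \<Rightarrow> real ^ 'm ^ 'd" where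
  "simple_process = (\<lambda>(n, \<tau>, \<eta>) t \<omega>. \<Sum>i<n. indicator {\<tau> i<..\<tau> (Suc i)} t *\<^sub>R \<eta> i \<omega>)"

definition simple_ito ::
  "(real \<Rightarrow> 'w \<Rightarrow> real ^ 'm) \<Rightarrow> ('w, 'm::finite, 'd::finite) simple_data \<Rightarrow> real \<Rightarrow> 'w \<Rightarrow> real ^ 'd" where
  "simple_ito W = (\<lambda>(n, \<tau>, \<eta>) t \<omega>.
     \<Sum>i<n. \<eta> i \<omega> *v (W (min t (\<tau> (Suc i))) \<omega> - W (min t (\<tau> i)) \<omega>))"

text \<open>\<open>I\<close> is (a version of) the Ito integral process \<open>\<integral>\<^sub>0\<^sup>t H dW\<close> of a progressively measurable integrand
  with almost surely locally square integrable paths: the limit, uniformly on compacts in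
  probability, of the integrals of simple integrands approximating \<open>H\<close> in \<open>L\<^sup>2(0,T)\<close> in
  probability. This determines \<open>I\<close> up to indistinguishability.\<close>

definition ito_integral ::
  "'w measure \<Rightarrow> (real \<Rightarrow> 'w measure) \<Rightarrow> (real \<Rightarrow> 'w \<Rightarrow> real ^ 'm) \<Rightarrow>
    (real \<Rightarrow> 'w \<Rightarrow> real ^ 'm ^ 'd) \<Rightarrow> (real \<Rightarrow> 'w \<Rightarrow> real ^ 'd) \<Rightarrow> bool" where
  "ito_integral M F W H I \<longleftrightarrow>
     progressively_measurable F H \<and>
     (\<forall>T>0. AE \<omega> in M. (\<integral>\<^sup>+ t\<in>{0..T}. ennreal ((norm (H t \<omega>))\<^sup>2) \<partial>lborel) < \<infinity>) \<and>
     continuous_adapted M F I \<and>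
     (\<forall>T>0. \<exists>S. (\<forall>k. simple_integrand M F (S k)) \<and>
        null_in_probability M (\<lambda>k \<omega>.
          \<integral>\<^sup>+ t\<in>{0..T}. ennreal ((norm (simple_process (S k) t \<omega> - H t \<omega>))\<^sup>2) \<partial>lborel) \<and>
        null_in_probability M (\<lambda>k \<omega>.
          SUP t\<in>{0..T}. ennreal (norm (simple_ito W (S k) t \<omega> - I t \<omega>))))"

text \<open>Strong solutions \<open>(X, K)\<close> of \<open>dX + A(X) dt + b(t,X) dt \<ni> \<sigma>(t,X) dW\<close>, \<open>X(0) = \<xi>\<close>. The equation
  \<open>dX = - b(t,X) dt + \<sigma>(t,X) dW - dK\<close> is written in integrated form; \<open>K\<close> enters only through its
  increments and is not normalised at \<open>0\<close>.\<close>

definition strong_solution ::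
  "'w measure \<Rightarrow> (real \<Rightarrow> 'w measure) \<Rightarrow> (real \<Rightarrow> 'w \<Rightarrow> real ^ 'm) \<Rightarrow>
    (real ^ 'd \<Rightarrow> (real ^ 'd) set) \<Rightarrow> (real \<Rightarrow> real ^ 'd \<Rightarrow> real ^ 'd) \<Rightarrow>
    (real \<Rightarrow> real ^ 'd \<Rightarrow> real ^ 'm ^ 'd) \<Rightarrow> ('w \<Rightarrow> real ^ 'd) \<Rightarrow>
    (real \<Rightarrow> 'w \<Rightarrow> real ^ 'd) \<Rightarrow> (real \<Rightarrow> 'w \<Rightarrow> real ^ 'd) \<Rightarrow> bool" where
  "strong_solution M F W A b \<sigma> \<xi> X K \<longleftrightarrow>
     continuous_adapted M F X \<and> continuous_adapted M F K \<and>
     (\<forall>t\<ge>0. AE \<omega> in M. X t \<omega> \<in> closure (op_dom A)) \<and>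
     (AE \<omega> in M. X 0 \<omega> = \<xi> \<omega>) \<and>
     (\<forall>T>0. AE \<omega> in M. bounded_variation_on 0 T (\<lambda>t. K t \<omega>)) \<and>
     (\<exists>I. ito_integral M F W (\<lambda>t \<omega>. \<sigma> t (X t \<omega>)) I \<and>
        (AE \<omega> in M. \<forall>t\<ge>0.
           X t \<omega> = X 0 \<omega> - (LINT s:{0..t}|lborel. b s (X s \<omega>)) + I t \<omega> - (K t \<omega> - K 0 \<omega>))) \<and>
     (\<forall>T>0. \<forall>\<zeta> \<zeta>'. continuous_adapted M F \<zeta> \<and> continuous_adapted M F \<zeta>' \<and>
        (\<forall>\<omega>\<in>space M. \<forall>t\<in>{0..T}. (\<zeta> t \<omega>, \<zeta>' t \<omega>) \<in> op_graph A) \<longrightarrow>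
        (AE \<omega> in M. \<forall>B\<in>sets borel. B \<subseteq> {0..T} \<longrightarrow>
           0 \<le> pairing_measure T (\<lambda>t. X t \<omega> - \<zeta> t \<omega>) (\<lambda>t. K t \<omega>) (\<lambda>t. \<zeta>' t \<omega>) B))"

definition time_average :: "(real \<Rightarrow> 'w \<Rightarrow> real ^ 'd) \<Rightarrow> real \<Rightarrow> 'w \<Rightarrow> real ^ 'd" where
  "time_average X t \<omega> = (1 / t) *\<^sub>R (LINT s:{0..t}|lborel. X s \<omega>)"

text \<open>Expectation of an extended-real random variable as the difference of the expectations of its
  positive and negative parts. Since \<open>\<infinity> - \<infinity> = \<infinity>\<close> in \<^typ>\<open>ereal\<close>, a finite upper bound on it
  includes the assertion that the expectation of the positive part is finite.\<close>

definition ereal_expectation :: "'w measure \<Rightarrow> ('w \<Rightarrow> ereal) \<Rightarrow> ereal" where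
  "ereal_expectation M f =
     enn2ereal (\<integral>\<^sup>+ \<omega>. e2ennreal (f \<omega>) \<partial>M) - enn2ereal (\<integral>\<^sup>+ \<omega>. e2ennreal (- f \<omega>) \<partial>M)"

end

theory Submission
  imports Defs
begin

text \<open>
  Let \<open>(y, y')\<close> be in the graph of \<open>A\<close> with \<open>y\<close> in the ball \<open>B\<close> around \<open>a\<close>. As \<open>y\<close> is interior to \<open>C\<close>, the
  normal cone there is \<open>{0}\<close>, so that only such pairs enter the gap function. The defining inequality
  of a solution gives \<open>\<langle>X - y, dK\<rangle> \<ge> \<langle>X - y, y'\<rangle> dt\<close>, and convexity gives
  \<open>\<langle>grad \<Psi> (X), X - y\<rangle> \<ge> \<Psi> X - \<Psi> y \<ge> 0\<close>. Expanding \<open>\<bar>X - y\<bar>\<^sup>2\<close> by Ito's formula therefore yields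
  \[ 2 t \langle y', \bar X(t) - y\rangle \le |X(0) - y|^2 + 2 \int_0^t \langle X - a, dI\rangle
      + 2 \langle a - y, I(t) - I(0)\rangle + [I](t), \]
  where \<open>I\<close> is the stochastic integral. On the right, \<open>y\<close> occurs only in two terms that are bounded
  uniformly over \<open>B\<close>. Hence the supremum over \<open>(y, y')\<close> may be taken before the expectation; the
  integral against \<open>dI\<close> has mean zero, and the rest is controlled by \<open>X(0)\<close> and the total energy
  \<open>\<integral> \<Sigma>\<^sup>2\<close>. Division by \<open>t\<close> is the claim.

  Ito's formula itself is replaced by its discrete origin, the telescoping sum of the increments of
  \<open>\<bar>X - y\<bar>\<^sup>2\<close> over a uniform grid. All terms of bounded variation converge along each path, with an error
  that is collected in \<open>grid_bounds_solution\<close>. The martingale sums and the sums of squared increments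
  of \<open>I\<close> are left discrete: the former have mean zero and bounded second moments, the latter bounded
  means, independently of the mesh, and \<open>limit_upper_bound\<close> turns this into a bound on the expectation
  of whatever they dominate in the limit.

  Two facts feed this argument. First, \<open>ito_integral_L2_martingale\<close>: the Ito integral, which is given
  as a limit in probability only, is a square-integrable martingale when its integrand has
  deterministically bounded energy. Second, \<open>second_moment_bound\<close>: the second moments of \<open>X\<close> are
  bounded on compact time intervals, so that the martingale sums against \<open>X - a\<close> are square
  integrable. The latter is the same computation with the Huber function in place of the square; its
  gradient is bounded, which does the work of a localising stopping time.
\<close>

section \<open>Total variation of continuous paths\<close>

lemma bounded_variation_on_subset:
  assumes "bounded_variation_on a b k" "c \<le> b"
  shows "bounded_variation_on a c k"
proof -
  have "variation_sums a c k \<subseteq> variation_sums a b k"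
  proof
    fix v assume "v \<in> variation_sums a c k"
    then obtain n \<tau> where "v = (\<Sum>i<n. norm (k (\<tau> (Suc i)) - k (\<tau> i)))"
        "mono_on {..n::nat} \<tau>" "\<tau> ` {..n} \<subseteq> {a..c}"
      unfolding variation_sums_def by blast
    moreover have "{a..c} \<subseteq> {a..b}" using assms(2) by auto
    ultimately show "v \<in> variation_sums a b k" unfolding variation_sums_def by blast
  qed
  then show ?thesis
    using assms(1) unfolding bounded_variation_on_def by (rule bdd_above_mono[rotated])
qed

lemma bounded_variation_component:
  fixes k :: "real \<Rightarrow> real ^ 'd"
  assumes "bounded_variation_on a b k"
  shows "bounded_variation_on a b (\<lambda>t. k t $ j)"
proof -
  obtain z where z: "\<And>v. v \<in> variation_sums a b k \<Longrightarrow> v \<le> z"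
    using assms unfolding bounded_variation_on_def bdd_above_def by blast
  have "v \<le> z" if "v \<in> variation_sums a b (\<lambda>t. k t $ j)" for v
  proof -
    obtain n \<tau> where v: "v = (\<Sum>i<n. norm (k (\<tau> (Suc i)) $ j - k (\<tau> i) $ j))"
        "mono_on {..n::nat} \<tau>" "\<tau> ` {..n} \<subseteq> {a..b}"
      using \<open>v \<in> _\<close> unfolding variation_sums_def by blast
    have "v \<le> (\<Sum>i<n. norm (k (\<tau> (Suc i)) - k (\<tau> i)))"
      unfolding v(1) using component_le_norm_cart[of "k (\<tau> (Suc _)) - k (\<tau> _)" j]
      by (intro sum_mono) simp
    also have "\<dots> \<le> z" using v(2,3) by (intro z) (auto simp: variation_sums_def)
    finally show ?thesis .
  qed
  then show ?thesis unfolding bounded_variation_on_def bdd_above_def by blast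
qed

lemma variation_sum_le_total_variation:
  assumes "bounded_variation_on a b k" "mono_on {..n} \<tau>" "\<tau> ` {..n} \<subseteq> {a..b}"
  shows "(\<Sum>i<n. norm (k (\<tau> (Suc i)) - k (\<tau> i))) \<le> total_variation a b k"
  unfolding total_variation_def
  by (rule cSup_upper) (use assms in \<open>auto simp: variation_sums_def bounded_variation_on_def\<close>)

lemma total_variation_le:
  assumes "a \<le> b"
    and "\<And>n \<tau>. mono_on {..n::nat} \<tau> \<Longrightarrow> \<tau> ` {..n} \<subseteq> {a..b} \<Longrightarrow>
        (\<Sum>i<n. norm (k (\<tau> (Suc i)) - k (\<tau> i))) \<le> z"
  shows "total_variation a b k \<le> z"
  unfolding total_variation_def
proof (rule cSup_least)
  have "(\<Sum>i<(0::nat). norm (k ((\<lambda>_. a) (Suc i)) - k ((\<lambda>_. a) i))) \<in> variation_sums a b k"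
    unfolding variation_sums_def using assms(1)
    by (intro CollectI exI[of _ 0] exI[of _ "\<lambda>_. a"]) (auto intro: mono_onI)
  then show "variation_sums a b k \<noteq> {}" by blast
qed (use assms(2) in \<open>auto simp: variation_sums_def\<close>)

text \<open>Every partition of \<open>{a..b}\<close> can be prolonged by the points \<open>b\<close> and \<open>c\<close>. Monotonicity in the
right endpoint and the estimate below follow from this inequality alone.\<close>

lemma total_variation_append:
  assumes bv: "bounded_variation_on a c k" and "a \<le> b" "b \<le> c"
  shows "total_variation a b k + norm (k c - k b) \<le> total_variation a c k"
proof -
  have "total_variation a b k \<le> total_variation a c k - norm (k c - k b)"
  proof (rule total_variation_le[OF \<open>a \<le> b\<close>])
    fix n :: nat and \<tau> assume \<tau>: "mono_on {..n} \<tau>" "\<tau> ` {..n} \<subseteq> {a..b}"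
    define \<tau>' where "\<tau>' i = (if i \<le> n then \<tau> i else if i = Suc n then b else c)" for i
    have le: "\<tau> i \<in> {a..b}" if "i \<le> n" for i using \<tau>(2) that by auto
    have "(\<Sum>i<Suc (Suc n). norm (k (\<tau>' (Suc i)) - k (\<tau>' i))) \<le> total_variation a c k"
    proof (rule variation_sum_le_total_variation[OF bv])
      show "mono_on {..Suc (Suc n)} \<tau>'"
        using \<tau>(1) le assms(2,3) by (auto simp: \<tau>'_def mono_on_def not_le le_Suc_eq; fastforce)
      show "\<tau>' ` {..Suc (Suc n)} \<subseteq> {a..c}"
        using le assms(2,3) by (auto simp: \<tau>'_def; fastforce)
    qed
    moreover have "(\<Sum>i<n. norm (k (\<tau>' (Suc i)) - k (\<tau>' i))) = (\<Sum>i<n. norm (k (\<tau> (Suc i)) - k (\<tau> i)))"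
      by (rule sum.cong) (auto simp: \<tau>'_def)
    moreover have "norm (k (\<tau>' (Suc (Suc n))) - k (\<tau>' (Suc n))) = norm (k c - k b)"
      by (simp add: \<tau>'_def)
    moreover have "0 \<le> norm (k (\<tau>' (Suc n)) - k (\<tau>' n))" by simp
    ultimately show "(\<Sum>i<n. norm (k (\<tau> (Suc i)) - k (\<tau> i))) \<le> total_variation a c k - norm (k c - k b)"
      unfolding sum.lessThan_Suc by linarith
  qed
  then show ?thesis by simp
qed

text \<open>If no point of the partition lies in \<open>{s<..t}\<close>, then at most one of its steps crosses that gap, and
this step costs no more than a detour through \<open>s\<close> and \<open>t\<close>. All other steps are accounted for by the
variation before \<open>s\<close> or after \<open>t\<close>.\<close>

lemma total_variation_jump:
  assumes bv: "bounded_variation_on a b k" and "a \<le> s" "s \<le> t" "t \<le> b"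
    and \<tau>: "mono_on {..n::nat} \<tau>" "\<tau> ` {..n} \<subseteq> {a..b}"
    and gap: "\<And>i. i \<le> n \<Longrightarrow> \<tau> i \<le> s \<or> t < \<tau> i"
  shows "(\<Sum>i<n. norm (k (\<tau> (Suc i)) - k (\<tau> i))) + total_variation a t k
           \<le> total_variation a s k + norm (k t - k s) + total_variation a b k"
proof -
  have le: "a \<le> \<tau> i \<and> \<tau> i \<le> b" if "i \<le> n" for i using \<tau>(2) that by auto
  have app: "total_variation a x k + norm (k y - k x) \<le> total_variation a y k"
    if "a \<le> x" "x \<le> y" "y \<le> b" for x y
    using that by (intro total_variation_append bounded_variation_on_subset[OF bv])
  have mono: "total_variation a x k \<le> total_variation a y k" if "a \<le> x" "x \<le> y" "y \<le> b" for x y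
    using app[OF that] by (smt (verit) norm_ge_zero)
  have "(\<Sum>i<m. norm (k (\<tau> (Suc i)) - k (\<tau> i))) \<le> (if \<tau> m \<le> s then total_variation a (\<tau> m) k
      else total_variation a s k + norm (k t - k s) + (total_variation a (\<tau> m) k - total_variation a t k))"
    if "m \<le> n" for m using that
  proof (induction m)
    case 0
    have "0 \<le> total_variation a (\<tau> 0) k" "0 \<le> total_variation a s k"
      using variation_sum_le_total_variation[OF bounded_variation_on_subset[OF bv], of _ 0 "\<lambda>_. a"] le[of 0] assms
      by (auto simp: mono_on_def)
    moreover have "t \<le> \<tau> 0 \<Longrightarrow> total_variation a t k \<le> total_variation a (\<tau> 0) k"
      using mono[of t "\<tau> 0"] le[of 0] assms by auto
    ultimately show ?case using gap[of 0] by auto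
  next
    case (Suc m)
    let ?p = "\<tau> m" and ?q = "\<tau> (Suc m)"
    have pq: "?p \<le> ?q" using \<tau>(1) Suc.prems by (auto simp: mono_on_def)
    have IH: "(\<Sum>i<m. norm (k (\<tau> (Suc i)) - k (\<tau> i))) \<le> (if ?p \<le> s then total_variation a ?p k
      else total_variation a s k + norm (k t - k s) + (total_variation a ?p k - total_variation a t k))"
      using Suc by simp
    have in_ab: "a \<le> ?p" "?p \<le> b" "a \<le> ?q" "?q \<le> b" using le Suc.prems by auto
    have step: "total_variation a ?p k + norm (k ?q - k ?p) \<le> total_variation a ?q k"
      using app pq in_ab by auto
    consider "?q \<le> s" | "?p \<le> s" "t < ?q" | "s < ?p" "t < ?q"
      using gap[of m] gap[of "Suc m"] pq Suc.prems by linarith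
    then show ?case
    proof cases
      case 2
      have "norm (k ?q - k ?p) \<le> norm (k s - k ?p) + norm (k t - k s) + norm (k ?q - k t)"
        by (smt (verit) norm_triangle_ineq diff_add_cancel add_diff_eq)
      moreover have "total_variation a ?p k + norm (k s - k ?p) \<le> total_variation a s k"
        using app[of ?p s] 2 in_ab assms by auto
      moreover have "total_variation a t k + norm (k ?q - k t) \<le> total_variation a ?q k"
        using app[of t ?q] 2 in_ab assms by auto
      ultimately show ?thesis using IH 2 assms by auto
    qed (use IH step pq in auto)
  qed
  from this[of n] mono[of "\<tau> n" b] mono[of s t] mono[of t b] le[of n] assms(2-4)
  show ?thesis by (smt (verit) norm_ge_zero mono order_refl)
qed

text \<open>A partition whose sum is almost the total variation has no points in \<open>{s<..t}\<close> once \<open>t\<close> is close to \<open>s\<close>.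
Right continuity is what makes \<^const>\<open>interval_measure\<close> assign to \<open>{l<..r}\<close> the increment of its
distribution function.\<close>

lemma total_variation_right_continuous:
  assumes bv: "bounded_variation_on a b k" and k: "continuous_on {a..b} k" and "a \<le> s" "s < b"
  shows "((\<lambda>t. total_variation a t k) \<longlongrightarrow> total_variation a s k) (at_right s)"
proof (rule tendstoI)
  fix e :: real assume "0 < e"
  have mono: "total_variation a x k \<le> total_variation a y k" if "a \<le> x" "x \<le> y" "y \<le> b" for x y
    using total_variation_append[OF bounded_variation_on_subset[OF bv that(3)] that(1,2)]
    by (smt (verit) norm_ge_zero)
  have "\<exists>n \<tau>. mono_on {..n::nat} \<tau> \<and> \<tau> ` {..n} \<subseteq> {a..b} \<and>
      total_variation a b k - e / 2 < (\<Sum>i<n. norm (k (\<tau> (Suc i)) - k (\<tau> i)))"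
  proof (rule ccontr)
    assume "\<not> ?thesis"
    then have "total_variation a b k \<le> total_variation a b k - e / 2"
      using assms by (intro total_variation_le) (auto simp: not_less)
    with \<open>0 < e\<close> show False by simp
  qed
  then obtain n \<tau> where \<tau>: "mono_on {..n::nat} \<tau>" "\<tau> ` {..n} \<subseteq> {a..b}"
    "total_variation a b k - e / 2 < (\<Sum>i<n. norm (k (\<tau> (Suc i)) - k (\<tau> i)))" by blast
  have "\<forall>\<^sub>F t in at_right s. \<forall>x\<in>\<tau> ` {..n}. x \<le> s \<or> t < x"
    by (rule eventually_ball_finite)
       (auto simp: not_le intro: eventually_mono[OF eventually_at_right_less] 
          order_tendstoD(2)[OF tendsto_ident_at])
  moreover have "((\<lambda>t. k t) \<longlongrightarrow> k s) (at_right s)"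
  proof -
    have "(k \<longlongrightarrow> k s) (at s within {s..b})"
      using continuous_on_subset[OF k, of "{s..b}"] assms by (auto simp: continuous_on_def)
    then show ?thesis using \<open>s < b\<close>
      by (metis at_within_Icc_at_right)
  qed
  then have "\<forall>\<^sub>F t in at_right s. dist (k t) (k s) < e / 2"
    using \<open>0 < e\<close> by (intro tendstoD) auto
  moreover have "\<forall>\<^sub>F t in at_right s. t \<in> {s<..<b}"
    using \<open>s < b\<close> by (rule eventually_at_right_real)
  ultimately show "\<forall>\<^sub>F t in at_right s. dist (total_variation a t k) (total_variation a s k) < e"
  proof eventually_elim
    case (elim t)
    have "(\<Sum>i<n. norm (k (\<tau> (Suc i)) - k (\<tau> i))) + total_variation a t k
           \<le> total_variation a s k + norm (k t - k s) + total_variation a b k"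
      using elim assms by (intro total_variation_jump[OF bv _ _ _ \<tau>(1,2)]) auto
    moreover have "total_variation a s k \<le> total_variation a t k" using mono elim assms by auto
    ultimately show ?case using elim \<tau>(3) by (auto simp: dist_norm)
  qed
qed

section \<open>Stieltjes integrals over short intervals\<close>

lemma interval_measure_integral_approx:
  fixes f F :: "real \<Rightarrow> real"
  assumes F: "\<And>x y. x \<le> y \<Longrightarrow> F x \<le> F y" "\<And>a. continuous (at_right a) F"
    and "l \<le> r" and f: "continuous_on {l..r} f" and osc: "\<And>s. s \<in> {l..r} \<Longrightarrow> \<bar>f s - f l\<bar> \<le> \<omega>"
  shows "\<bar>(LINT t:{l<..r}|interval_measure F. f t) - f l * (F r - F l)\<bar> \<le> \<omega> * (F r - F l)"
proof -
  let ?M = "interval_measure F"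
  have em: "emeasure ?M {l<..r} = ennreal (F r - F l)"
    using emeasure_interval_measure_Ioc[OF \<open>l \<le> r\<close> F] .
  then have meas: "measure ?M {l<..r} = F r - F l"
    using F(1)[OF \<open>l \<le> r\<close>] by (simp add: measure_def)
  have const: "set_integrable ?M {l<..r} (\<lambda>_. c)" for c :: real
    using em unfolding set_integrable_def by (intro integrable_scaleR_left integrable_real_indicator) auto
  have fm: "set_borel_measurable ?M {l<..r} f"
    unfolding set_borel_measurable_def measurable_cong_sets[OF sets_interval_measure refl]
    by (rule borel_measurable_continuous_on_indicator[OF _ continuous_on_subset[OF f]]) auto
  have diff: "set_integrable ?M {l<..r} (\<lambda>t. f t - f l)"
  proof (rule set_integrable_bound[OF const[of \<omega>]])
    show "set_borel_measurable ?M {l<..r} (\<lambda>t. f t - f l)"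
    proof -
      have "(\<lambda>x. indicator {l<..r} x *\<^sub>R f x - indicator {l<..r} x *\<^sub>R f l) \<in> borel_measurable ?M"
        using fm unfolding set_borel_measurable_def by (intro borel_measurable_diff) auto
      then show ?thesis
        unfolding set_borel_measurable_def by (simp add: right_diff_distrib)
    qed
    show "AE t\<in>{l<..r} in ?M. norm (f t - f l) \<le> norm \<omega>"
    proof (intro AE_I2 impI)
      fix t assume "t \<in> {l<..r}"
      then show "norm (f t - f l) \<le> norm \<omega>" using osc[of t] by simp
    qed
  qed
  have fi: "set_integrable ?M {l<..r} f"
    using set_integral_add(1)[OF diff const[of "f l"]] by simp
  have "(LINT t:{l<..r}|?M. f t) - f l * (F r - F l) = (LINT t:{l<..r}|?M. f t - f l)"
    using fi const[of "f l"] meas by (simp add: set_integral_diff(2)) (simp add: set_lebesgue_integral_def)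
  also have "\<bar>\<dots>\<bar> \<le> (LINT t:{l<..r}|?M. \<bar>f t - f l\<bar>)"
    using set_integral_norm_bound[OF diff] by simp
  also have "\<dots> \<le> (LINT t:{l<..r}|?M. \<omega>)"
    using diff osc by (intro set_integral_mono const) (auto intro: set_integrable_abs)
  also have "\<dots> = \<omega> * (F r - F l)"
    using meas by (simp add: set_lebesgue_integral_def)
  finally show ?thesis .
qed

text \<open>The two monotone parts of \<open>k\<close> have the increments \<open>V r - V l\<close> and \<open>(V r - V l) - (k r - k l)\<close>; the second
is at most twice the first, whence the factor 3.\<close>

lemma stieltjes_integral_approx:
  fixes f k :: "real \<Rightarrow> real"
  assumes k: "continuous_on {0..T} k" "bounded_variation_on 0 T k"
    and "0 \<le> l" "l \<le> r" "r \<le> T"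
    and f: "continuous_on {0..T} f" and osc: "\<And>s. s \<in> {l..r} \<Longrightarrow> \<bar>f s - f l\<bar> \<le> \<omega>"
  shows "\<bar>stieltjes_integral T k {l<..r} f - f l * (k r - k l)\<bar>
           \<le> 3 * \<omega> * (total_variation 0 r k - total_variation 0 l k)"
proof -
  define c where "c t = max 0 (min T t)" for t
  define V where "V t = total_variation 0 t k" for t
  have c: "0 \<le> c t" "c t \<le> T" for t using assms by (auto simp: c_def)
  have cmono: "c s \<le> c t" if "s \<le> t" for s t using that by (auto simp: c_def)
  have crl: "c r = r" "c l = l" using assms by (auto simp: c_def)
  have V: "V s + \<bar>k t - k s\<bar> \<le> V t" if "0 \<le> s" "s \<le> t" "t \<le> T" for s t
    unfolding V_def using total_variation_append[OF bounded_variation_on_subset[OF k(2) that(3)] that(1,2)] by simp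
  have Vr: "((\<lambda>t. V (c t)) \<longlongrightarrow> V (c s)) (at_right s) \<and> ((\<lambda>t. k (c t)) \<longlongrightarrow> k (c s)) (at_right s)" for s
  proof -
    consider "s < 0" | "0 \<le> s" "s < T" | "T \<le> s" by linarith
    then show ?thesis
    proof cases
      case 1
      then have "\<forall>\<^sub>F t in at_right s. c t = c s"
        using eventually_at_right_real[of s 0] by (auto elim!: eventually_mono simp: c_def)
      then show ?thesis by (intro conjI tendsto_eventually) (auto elim!: eventually_mono)
    next
      case 3
      then have "\<forall>\<^sub>F t in at_right s. c t = c s"
        using eventually_at_right_less[of s] by (auto elim!: eventually_mono simp: c_def)
      then show ?thesis by (intro conjI tendsto_eventually) (auto elim!: eventually_mono)
    next
      case 2
      have cs: "c s = s" using 2 by (simp add: c_def)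
      have ev: "\<forall>\<^sub>F t in at_right s. c t = t"
        using eventually_at_right_real[OF 2(2)] 2 by (auto elim!: eventually_mono simp: c_def)
      have "(V \<longlongrightarrow> V s) (at_right s)"
        unfolding V_def by (rule total_variation_right_continuous[OF k(2,1) 2])
      moreover have "(k \<longlongrightarrow> k s) (at_right s)"
      proof -
        have "(k \<longlongrightarrow> k s) (at s within {s..T})"
          using continuous_on_subset[OF k(1), of "{s..T}"] 2 by (auto simp: continuous_on_def)
        then show ?thesis using 2 by (metis at_within_Icc_at_right)
      qed
      ultimately show ?thesis
        unfolding cs using ev
        by (intro conjI; elim Lim_transform_eventually) (auto elim!: eventually_mono)
    qed
  qed
  have "\<bar>(LINT t:{l<..r}|interval_measure (\<lambda>t. V (c t)). f t) - f l * (V (c r) - V (c l))\<bar>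
      \<le> \<omega> * (V (c r) - V (c l))"
  proof (rule interval_measure_integral_approx[where l = l and r = r and f = f and \<omega> = \<omega>, OF _ _ \<open>l \<le> r\<close> _ osc])
    show "V (c s) \<le> V (c t)" if "s \<le> t" for s t using V[of "c s" "c t"] c cmono[OF that] by force
    show "continuous_on {l..r} f" using assms by (auto intro: continuous_on_subset)
  qed (use Vr in \<open>auto simp: continuous_within\<close>)
  moreover have "\<bar>(LINT t:{l<..r}|interval_measure (\<lambda>t. V (c t) - k (c t)). f t)
      - f l * ((V (c r) - k (c r)) - (V (c l) - k (c l)))\<bar>
      \<le> \<omega> * ((V (c r) - k (c r)) - (V (c l) - k (c l)))"
  proof (rule interval_measure_integral_approx[where l = l and r = r and f = f and \<omega> = \<omega>, OF _ _ \<open>l \<le> r\<close> _ osc])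
    show "V (c s) - k (c s) \<le> V (c t) - k (c t)" if "s \<le> t" for s t
      using V[of "c s" "c t"] c cmono[OF that] by force
    show "continuous_on {l..r} f" using assms by (auto intro: continuous_on_subset)
  qed (use Vr in \<open>auto simp: continuous_within intro: tendsto_diff\<close>)
  moreover have "stieltjes_integral T k {l<..r} f = (LINT t:{l<..r}|interval_measure (\<lambda>t. V (c t)). f t) -
      (LINT t:{l<..r}|interval_measure (\<lambda>t. V (c t) - k (c t)). f t)"
    by (simp add: stieltjes_integral_def Let_def V_def c_def)
  moreover have "\<omega> * \<bar>k r - k l\<bar> \<le> \<omega> * (V r - V l)"
    using V[of l r] osc[of l] assms by (intro mult_left_mono) auto
  moreover have "- (\<omega> * (k r - k l)) \<le> \<omega> * \<bar>k r - k l\<bar>"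
  proof -
    have "0 \<le> \<omega>" using osc[of l] \<open>l \<le> r\<close> by simp
    then have "\<omega> * (- (k r - k l)) \<le> \<omega> * \<bar>k r - k l\<bar>" by (intro mult_left_mono) auto
    then show ?thesis by (simp only: mult_minus_right)
  qed
  ultimately show ?thesis
    unfolding crl V_def[symmetric] by (auto simp: algebra_simps abs_le_iff)
qed

text \<open>This is the form in which the monotonicity condition on \<open>K\<close> enters the sums over a grid: the
oscillation of \<open>u\<close> is paid for by the variation of \<open>K\<close>, which adds up to a finite total over the
intervals of a grid.\<close>

lemma pairing_measure_lower_bound:
  fixes K u :: "real \<Rightarrow> real ^ 'd"
  assumes K: "continuous_on {0..T} K" "bounded_variation_on 0 T K"
    and "0 \<le> l" "l \<le> r" "r \<le> T"
    and u: "continuous_on {0..T} u" and osc: "\<And>s. s \<in> {l..r} \<Longrightarrow> norm (u s - u l) \<le> \<omega>"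
    and pos: "0 \<le> pairing_measure T u K v {l<..r}"
  shows "(LINT t:{l<..r}|lborel. u t \<bullet> v t) - 3 * \<omega> *
      (\<Sum>j\<in>UNIV. total_variation 0 r (\<lambda>t. K t $ j) - total_variation 0 l (\<lambda>t. K t $ j))
      \<le> u l \<bullet> (K r - K l)"
proof -
  have "stieltjes_integral T (\<lambda>t. K t $ j) {l<..r} (\<lambda>t. u t $ j) - u l $ j * (K r $ j - K l $ j)
      \<le> 3 * \<omega> * (total_variation 0 r (\<lambda>t. K t $ j) - total_variation 0 l (\<lambda>t. K t $ j))" for j
  proof -
    have "\<bar>u s $ j - u l $ j\<bar> \<le> \<omega>" if "s \<in> {l..r}" for s
      using component_le_norm_cart[of "u s - u l" j] osc[OF that] by simp
    moreover have "bounded_variation_on 0 T (\<lambda>t. K t $ j)"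
      by (rule bounded_variation_component[OF K(2)])
    moreover have "continuous_on {0..T} (\<lambda>t. K t $ j)" "continuous_on {0..T} (\<lambda>t. u t $ j)"
      using K(1) u by (auto intro!: continuous_intros)
    ultimately have "\<bar>stieltjes_integral T (\<lambda>t. K t $ j) {l<..r} (\<lambda>t. u t $ j) - u l $ j * (K r $ j - K l $ j)\<bar>
        \<le> 3 * \<omega> * (total_variation 0 r (\<lambda>t. K t $ j) - total_variation 0 l (\<lambda>t. K t $ j))"
      using assms(3-5) by (intro stieltjes_integral_approx) auto
    then show ?thesis by linarith
  qed
  then have "(\<Sum>j\<in>UNIV. stieltjes_integral T (\<lambda>t. K t $ j) {l<..r} (\<lambda>t. u t $ j) - u l $ j * (K r $ j - K l $ j))
      \<le> (\<Sum>j\<in>UNIV. 3 * \<omega> * (total_variation 0 r (\<lambda>t. K t $ j) - total_variation 0 l (\<lambda>t. K t $ j)))"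
    by (rule sum_mono)
  then show ?thesis
    using pos unfolding pairing_measure_def
    by (simp add: sum_subtractf inner_vec_def sum_distrib_left right_diff_distrib)
qed

section \<open>Discretised solution paths\<close>

text \<open>The grid has \<open>Suc n\<close> intervals, so that it ends at \<open>T\<close> for every \<open>n\<close>, 0 included.\<close>

definition grid :: "real \<Rightarrow> nat \<Rightarrow> nat \<Rightarrow> real" where
  "grid T n i = T * real i / real (Suc n)"

lemma grid_0 [simp]: "grid T n 0 = 0"
  by (simp add: grid_def)

lemma grid_last [simp]: "grid T n (Suc n) = T"
  by (simp add: grid_def del: of_nat_Suc)

lemma grid_mono: "0 \<le> T \<Longrightarrow> i \<le> j \<Longrightarrow> grid T n i \<le> grid T n j"
  by (auto simp: grid_def intro!: divide_right_mono mult_left_mono)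

lemma grid_step: "grid T n (Suc i) - grid T n i = T / real (Suc n)"
  unfolding grid_def diff_divide_distrib[symmetric] by (simp add: algebra_simps)

lemma grid_nonneg: "0 \<le> T \<Longrightarrow> 0 \<le> grid T n i"
  using grid_mono[of T 0 i n] by simp

lemma grid_le: "0 \<le> T \<Longrightarrow> i \<le> Suc n \<Longrightarrow> grid T n i \<le> T"
  using grid_mono[of T i "Suc n" n] by simp

lemma modulus_of_continuity:
  fixes f :: "real \<Rightarrow> 'a::metric_space"
  assumes "0 \<le> T" and f: "continuous_on {0..T} f"
  obtains \<omega> where "\<omega> \<longlonglongrightarrow> (0::real)" "\<And>n. 0 \<le> \<omega> n"
    "\<And>n i s. i \<le> n \<Longrightarrow> s \<in> {grid T n i..grid T n (Suc i)} \<Longrightarrow> dist (f s) (f (grid T n i)) \<le> \<omega> n"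
proof -
  define P where "P n = {p \<in> {0..T} \<times> {0..T}. \<bar>fst p - snd p\<bar> \<le> T / real (Suc n)}" for n
  define \<omega> where "\<omega> n = (SUP p\<in>P n. dist (f (fst p)) (f (snd p)))" for n
  have "bounded (f ` {0..T})"
    using f by (intro compact_imp_bounded compact_continuous_image) auto
  then obtain B where "\<forall>x\<in>f ` {0..T}. \<forall>y\<in>f ` {0..T}. dist x y \<le> B"
    unfolding bounded_two_points by blast
  then have B: "dist (f s) (f t) \<le> B" if "s \<in> {0..T}" "t \<in> {0..T}" for s t
    using that by blast
  have bdd: "bdd_above ((\<lambda>p. dist (f (fst p)) (f (snd p))) ` P n)" for n
    using B by (auto intro!: bdd_aboveI[of _ B] simp: P_def)
  have in_P: "(0, 0) \<in> P n" for n using \<open>0 \<le> T\<close> by (simp add: P_def)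
  have le: "dist (f s) (f t) \<le> \<omega> n" if "(s, t) \<in> P n" for s t n
    unfolding \<omega>_def using cSUP_upper[OF that bdd] by simp
  have nonneg: "0 \<le> \<omega> n" for n using le[OF in_P, of n] by simp
  show ?thesis
  proof (rule that[OF _ nonneg])
    show "\<omega> \<longlonglongrightarrow> 0"
    proof (rule LIMSEQ_I)
      fix e :: real assume "0 < e"
      have "uniformly_continuous_on {0..T} f"
        using f by (intro compact_uniformly_continuous) auto
      then obtain d where d: "d > 0"
        "\<And>s t. s \<in> {0..T} \<Longrightarrow> t \<in> {0..T} \<Longrightarrow> dist s t < d \<Longrightarrow> dist (f s) (f t) < e / 2"
        using \<open>0 < e\<close> unfolding uniformly_continuous_on_def by (meson half_gt_zero)
      obtain N where N: "T / d < real N" using reals_Archimedean2 by blast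
      show "\<exists>no. \<forall>n\<ge>no. norm (\<omega> n - 0) < e"
      proof (intro exI allI impI)
        fix n assume "N \<le> n"
        then have "T / real (Suc n) < d" using N \<open>d > 0\<close> by (simp add: field_simps)
            (smt (verit) mult_left_mono of_nat_le_iff)
        then have "dist (f (fst p)) (f (snd p)) \<le> e / 2" if "p \<in> P n" for p
          using that d(2)[of "fst p" "snd p"] by (auto simp: P_def dist_real_def)
        moreover have "P n \<noteq> {}" using in_P by blast
        ultimately have "\<omega> n \<le> e / 2"
          unfolding \<omega>_def by (intro cSUP_least) auto
        then show "norm (\<omega> n - 0) < e" using nonneg[of n] \<open>0 < e\<close> by simp
      qed
    qed
  next
    fix n i s assume "i \<le> n" "s \<in> {grid T n i..grid T n (Suc i)}"
    then show "dist (f s) (f (grid T n i)) \<le> \<omega> n"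
      using grid_step[of T n i] grid_nonneg[OF \<open>0 \<le> T\<close>, of n i] grid_le[OF \<open>0 \<le> T\<close>, of i n]
        grid_le[OF \<open>0 \<le> T\<close>, of "Suc i" n]
      by (intro le) (auto simp: P_def simp del: of_nat_Suc)
  qed
qed

lemma set_integral_Ioc_eq_diff:
  fixes f :: "real \<Rightarrow> 'a::euclidean_space"
  assumes f: "set_integrable lborel {0..T} f" and "0 \<le> l" "l \<le> r" "r \<le> T"
  shows "(LINT s:{l<..r}|lborel. f s) = (LINT s:{0..r}|lborel. f s) - (LINT s:{0..l}|lborel. f s)"
proof -
  have "{0..r} = {0..l} \<union> {l<..r}" using assms by auto
  moreover have "(LINT s:{0..l} \<union> {l<..r}|lborel. f s) = (LINT s:{0..l}|lborel. f s) + (LINT s:{l<..r}|lborel. f s)"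
    by (intro set_integral_Un set_integrable_subset[OF f]) (use assms in auto)
  ultimately show ?thesis by simp
qed

text \<open>The error \<open>e\<close> does not depend on the weights \<open>w\<close>. They are 1 when the square of the distance to \<open>y\<close>
is expanded, and the factors that project \<open>x - y\<close> onto a ball when a Huber function is expanded.\<close>

definition grid_bounds ::
  "real \<Rightarrow> (real \<Rightarrow> real ^ 'd) \<Rightarrow> (real \<Rightarrow> real ^ 'd) \<Rightarrow> real ^ 'd \<Rightarrow> real ^ 'd \<Rightarrow> (nat \<Rightarrow> real) \<Rightarrow> bool" where
  "grid_bounds T x I y y' e \<longleftrightarrow> e \<longlonglongrightarrow> 0 \<and> (\<forall>n.
    (\<Sum>i<Suc n. (norm (x (grid T n (Suc i)) - x (grid T n i)))\<^sup>2)
      \<le> (\<Sum>i<Suc n. (norm (I (grid T n (Suc i)) - I (grid T n i)))\<^sup>2) + e n \<and>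
    (\<forall>w. (\<forall>i. 0 \<le> w i \<and> w i \<le> 1) \<longrightarrow>
      (\<Sum>i<Suc n. w i * ((x (grid T n i) - y) \<bullet> (x (grid T n (Suc i)) - x (grid T n i))))
        \<le> (\<Sum>i<Suc n. w i * ((x (grid T n i) - y) \<bullet> (I (grid T n (Suc i)) - I (grid T n i))))
          - (\<Sum>i<Suc n. w i * (LINT s:{grid T n i<..grid T n (Suc i)}|lborel. (x s - y) \<bullet> y'))
          + e n))"

lemma grid_boundsD:
  assumes "grid_bounds T x I y y' e"
  shows "e \<longlonglongrightarrow> 0"
    and "\<And>n. (\<Sum>i<Suc n. (norm (x (grid T n (Suc i)) - x (grid T n i)))\<^sup>2)
      \<le> (\<Sum>i<Suc n. (norm (I (grid T n (Suc i)) - I (grid T n i)))\<^sup>2) + e n"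
    and "\<And>n w. (\<And>i. 0 \<le> w i \<and> w i \<le> 1) \<Longrightarrow>
      (\<Sum>i<Suc n. w i * ((x (grid T n i) - y) \<bullet> (x (grid T n (Suc i)) - x (grid T n i))))
        \<le> (\<Sum>i<Suc n. w i * ((x (grid T n i) - y) \<bullet> (I (grid T n (Suc i)) - I (grid T n i))))
          - (\<Sum>i<Suc n. w i * (LINT s:{grid T n i<..grid T n (Suc i)}|lborel. (x s - y) \<bullet> y'))
          + e n"
  using assms unfolding grid_bounds_def by auto

text \<open>The difference of \<open>x\<close> and \<open>I\<close> is continuous and of bounded variation. On each interval of the grid,
replacing the values of \<open>x\<close> by the value at the left endpoint, and the squared increment of \<open>x\<close> by that
of \<open>I\<close>, costs the oscillation of \<open>x\<close> and \<open>I\<close> times the increment of one fixed non-decreasing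
function \<open>Z\<close>. The sum of these errors is the oscillation times the increment of \<open>Z\<close> over \<open>{0..T}\<close>.\<close>

lemma grid_bounds_solution:
  fixes x I K b :: "real \<Rightarrow> real ^ 'd"
  assumes "0 < T" and x: "continuous_on {0..T} x" and I: "continuous_on {0..T} I"
    and K: "continuous_on {0..T} K" "bounded_variation_on 0 T K"
    and b: "set_integrable lborel {0..T} b"
    and eq: "\<And>t. t \<in> {0..T} \<Longrightarrow> x t = x 0 - (LINT s:{0..t}|lborel. b s) + I t - (K t - K 0)"
    and drift: "\<And>s. s \<in> {0..T} \<Longrightarrow> 0 \<le> b s \<bullet> (x s - y)"
    and pos: "\<And>B. B \<in> sets borel \<Longrightarrow> B \<subseteq> {0..T} \<Longrightarrow>
        0 \<le> pairing_measure T (\<lambda>t. x t - y) K (\<lambda>t. y') B"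
  shows "\<exists>e. grid_bounds T x I y y' e"
proof -
  have "0 \<le> T" using \<open>0 < T\<close> by simp
  obtain \<omega>1 where \<omega>1: "\<omega>1 \<longlonglongrightarrow> 0" "\<And>n. 0 \<le> \<omega>1 n"
    "\<And>n i s. i \<le> n \<Longrightarrow> s \<in> {grid T n i..grid T n (Suc i)} \<Longrightarrow> dist (x s) (x (grid T n i)) \<le> \<omega>1 n"
    using modulus_of_continuity[OF \<open>0 \<le> T\<close> x] by blast
  obtain \<omega>2 where \<omega>2: "\<omega>2 \<longlonglongrightarrow> 0" "\<And>n. 0 \<le> \<omega>2 n"
    "\<And>n i s. i \<le> n \<Longrightarrow> s \<in> {grid T n i..grid T n (Suc i)} \<Longrightarrow> dist (I s) (I (grid T n i)) \<le> \<omega>2 n"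
    using modulus_of_continuity[OF \<open>0 \<le> T\<close> I] by blast
  define \<omega> where "\<omega> n = \<omega>1 n + \<omega>2 n" for n
  define V where "V t = (\<Sum>j\<in>UNIV. total_variation 0 t (\<lambda>t. K t $ j))" for t
  define \<beta> where "\<beta> t = (LINT s:{0..t}|lborel. norm (b s))" for t
  define Z where "Z t = \<beta> t + 3 * V t" for t
  define e where "e n = \<omega> n * (Z T - Z 0)" for n
  have e: "e \<longlonglongrightarrow> 0"
    unfolding e_def \<omega>_def using tendsto_mult_left_zero[OF tendsto_add_zero[OF \<omega>1(1) \<omega>2(1)]] by simp
  have bn: "set_integrable lborel {0..T} (\<lambda>s. norm (b s))" using set_integrable_norm[OF b] .
  have step: "(norm (x r - x l))\<^sup>2 - (norm (I r - I l))\<^sup>2 \<le> \<omega> n * (Z r - Z l) \<and>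
      (x l - y) \<bullet> (x r - x l) \<le> (x l - y) \<bullet> (I r - I l)
        - (LINT s:{l<..r}|lborel. (x s - y) \<bullet> y') + \<omega> n * (Z r - Z l) \<and> Z l \<le> Z r"
    if "i \<le> n" and l: "l = grid T n i" and r: "r = grid T n (Suc i)" for n i l r
  proof -
    have lr: "0 \<le> l" "l \<le> r" "r \<le> T"
      unfolding l r using \<open>0 \<le> T\<close> \<open>i \<le> n\<close> by (auto intro: grid_nonneg grid_mono grid_le)
    have osc: "norm (x s - x l) \<le> \<omega>1 n" "norm (I s - I l) \<le> \<omega>2 n" if "s \<in> {l..r}" for s
      using \<omega>1(3)[OF \<open>i \<le> n\<close>, of s] \<omega>2(3)[OF \<open>i \<le> n\<close>, of s] that by (auto simp: l r dist_norm)
    have Vstep: "norm (K r - K l) \<le> V r - V l"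
    proof -
      have "norm (K r - K l) \<le> (\<Sum>j\<in>UNIV. \<bar>(K r - K l) $ j\<bar>)" by (rule norm_le_l1_cart)
      also have "\<dots> \<le> (\<Sum>j\<in>UNIV. total_variation 0 r (\<lambda>t. K t $ j) - total_variation 0 l (\<lambda>t. K t $ j))"
      proof (rule sum_mono)
        fix j
        show "\<bar>(K r - K l) $ j\<bar> \<le> total_variation 0 r (\<lambda>t. K t $ j) - total_variation 0 l (\<lambda>t. K t $ j)"
          using total_variation_append[OF bounded_variation_on_subset[OF bounded_variation_component[OF K(2), of j] lr(3)] lr(1,2)]
          by simp
      qed
      finally show ?thesis by (simp add: V_def sum_subtractf)
    qed
    have b': "set_integrable lborel {l<..r} b"
      by (rule set_integrable_subset[OF b]) (use lr in auto)
    have bn': "set_integrable lborel {l<..r} (\<lambda>s. norm (b s))"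
      by (rule set_integrable_subset[OF bn]) (use lr in auto)
    define J where "J = (LINT s:{l<..r}|lborel. b s)"
    have J: "(LINT s:{0..r}|lborel. b s) - (LINT s:{0..l}|lborel. b s) = J"
      using set_integral_Ioc_eq_diff[OF b lr] by (simp add: J_def)
    have \<beta>: "(LINT s:{l<..r}|lborel. norm (b s)) = \<beta> r - \<beta> l"
      unfolding \<beta>_def by (rule set_integral_Ioc_eq_diff[OF bn lr])
    have Jn: "norm J \<le> \<beta> r - \<beta> l"
      unfolding J_def \<beta>[symmetric] by (rule set_integral_norm_bound[OF b'])
    have dx: "x r - x l = (I r - I l) - J - (K r - K l)"
    proof -
      have "x r = x 0 - (LINT s:{0..r}|lborel. b s) + I r - (K r - K 0)"
        "x l = x 0 - (LINT s:{0..l}|lborel. b s) + I l - (K l - K 0)"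
        using lr by (auto intro!: eq)
      then show ?thesis unfolding J[symmetric] by (simp only:) simp
    qed
    have Vl: "0 \<le> V r - V l" using Vstep norm_ge_zero order_trans by blast
    have \<beta>l: "0 \<le> \<beta> r - \<beta> l" using Jn norm_ge_zero order_trans by blast
    have "norm ((x r - x l) - (I r - I l)) \<le> Z r - Z l"
    proof -
      have "(x r - x l) - (I r - I l) = - J - (K r - K l)" unfolding dx by simp
      moreover have "norm (- J - (K r - K l)) \<le> norm J + norm (K r - K l)"
        by (metis norm_minus_cancel norm_triangle_ineq4)
      ultimately have "norm ((x r - x l) - (I r - I l)) \<le> norm J + norm (K r - K l)" by simp
      also have "\<dots> \<le> Z r - Z l" unfolding Z_def using Vstep Jn Vl by linarith
      finally show ?thesis .
    qed
    moreover have "norm ((x r - x l) + (I r - I l)) \<le> \<omega> n"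
      using osc[of r] lr norm_triangle_ineq[of "x r - x l" "I r - I l"] by (simp add: \<omega>_def)
    moreover have "(norm (x r - x l))\<^sup>2 - (norm (I r - I l))\<^sup>2
        = ((x r - x l) + (I r - I l)) \<bullet> ((x r - x l) - (I r - I l))"
      by (simp add: power2_norm_eq_inner inner_diff_left inner_diff_right inner_add_left inner_add_right inner_commute)
    ultimately have sq: "(norm (x r - x l))\<^sup>2 - (norm (I r - I l))\<^sup>2 \<le> \<omega> n * (Z r - Z l)"
      by (smt (verit) norm_cauchy_schwarz mult_mono norm_ge_zero)
    have low: "(LINT t:{l<..r}|lborel. (x t - y) \<bullet> y') - 3 * \<omega>1 n * (V r - V l) \<le> (x l - y) \<bullet> (K r - K l)"
    proof -
      have "(LINT t:{l<..r}|lborel. (x t - y) \<bullet> y') - 3 * \<omega>1 n *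
          (\<Sum>j\<in>UNIV. total_variation 0 r (\<lambda>t. K t $ j) - total_variation 0 l (\<lambda>t. K t $ j))
          \<le> (x l - y) \<bullet> (K r - K l)"
        using osc lr
        by (intro pairing_measure_lower_bound[OF K lr, where v = "\<lambda>_. y'"] pos continuous_intros x) auto
      then show ?thesis by (simp add: V_def sum_subtractf)
    qed
    have "- \<omega>1 n * (\<beta> r - \<beta> l) \<le> (x l - y) \<bullet> J"
    proof -
      have "- \<omega>1 n * (\<beta> r - \<beta> l) = (LINT s:{l<..r}|lborel. - \<omega>1 n * norm (b s))"
        unfolding \<beta>[symmetric] by (rule set_integral_mult_right[symmetric])
      also have "\<dots> \<le> (LINT s:{l<..r}|lborel. (x l - y) \<bullet> b s)"
      proof (rule set_integral_mono)
        show "set_integrable lborel {l<..r} (\<lambda>s. - \<omega>1 n * norm (b s))"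
          using bn' by (intro set_integrable_mult_right)
        show "set_integrable lborel {l<..r} (\<lambda>s. (x l - y) \<bullet> b s)"
          using integrable_inner_right[of "x l - y" lborel "\<lambda>s. indicator {l<..r} s *\<^sub>R b s"] b'
          by (simp add: set_integrable_def)
        fix s assume s: "s \<in> {l<..r}"
        have "(x s - x l) \<bullet> b s \<le> \<omega>1 n * norm (b s)"
          using osc(1)[of s] s norm_cauchy_schwarz[of "x s - x l" "b s"]
          by (smt (verit) mult_right_mono norm_ge_zero greaterThanAtMost_iff atLeastAtMost_iff)
        moreover have "0 \<le> b s \<bullet> (x s - y)" using drift s lr by auto
        moreover have "(x l - y) \<bullet> b s = b s \<bullet> (x s - y) - (x s - x l) \<bullet> b s"
          by (simp add: inner_diff_left inner_diff_right inner_commute)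
        ultimately show "- \<omega>1 n * norm (b s) \<le> (x l - y) \<bullet> b s" by simp
      qed
      also have "\<dots> = (x l - y) \<bullet> J"
        using integral_inner_right[of "x l - y" lborel "\<lambda>s. indicator {l<..r} s *\<^sub>R b s"] b'
        by (simp add: set_integrable_def J_def set_lebesgue_integral_def)
      finally show ?thesis .
    qed
    moreover have "\<omega>1 n * (\<beta> r - \<beta> l) + 3 * \<omega>1 n * (V r - V l) \<le> \<omega> n * (Z r - Z l)"
    proof -
      have "\<omega>1 n * (Z r - Z l) \<le> \<omega> n * (Z r - Z l)"
        using \<omega>2(2)[of n] Vl \<beta>l by (intro mult_right_mono) (auto simp: \<omega>_def Z_def)
      then show ?thesis by (simp add: Z_def algebra_simps)
    qed
    moreover have "Z l \<le> Z r" using Vl \<beta>l by (simp add: Z_def)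
    ultimately show ?thesis
      using sq low unfolding dx by (simp add: inner_diff_right)
  qed
  have tele: "(\<Sum>i<Suc n. \<omega> n * (Z (grid T n (Suc i)) - Z (grid T n i))) = e n" for n
    unfolding e_def sum_distrib_left[symmetric]
    by (subst sum_lessThan_telescope) simp
  show ?thesis
    unfolding grid_bounds_def
  proof (intro exI[of _ e] conjI e allI impI)
    fix n
    have "(\<Sum>i<Suc n. (norm (x (grid T n (Suc i)) - x (grid T n i)))\<^sup>2)
      \<le> (\<Sum>i<Suc n. (norm (I (grid T n (Suc i)) - I (grid T n i)))\<^sup>2 + \<omega> n * (Z (grid T n (Suc i)) - Z (grid T n i)))"
      using step[of _ n] by (intro sum_mono) (force simp: less_Suc_eq_le)
    then show "(\<Sum>i<Suc n. (norm (x (grid T n (Suc i)) - x (grid T n i)))\<^sup>2)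
      \<le> (\<Sum>i<Suc n. (norm (I (grid T n (Suc i)) - I (grid T n i)))\<^sup>2) + e n"
      by (simp only: sum.distrib tele)
  next
    fix n and w :: "nat \<Rightarrow> real" assume w: "\<forall>i. 0 \<le> w i \<and> w i \<le> 1"
    have "w i * ((x (grid T n i) - y) \<bullet> (x (grid T n (Suc i)) - x (grid T n i)))
      \<le> w i * ((x (grid T n i) - y) \<bullet> (I (grid T n (Suc i)) - I (grid T n i)))
        - w i * (LINT s:{grid T n i<..grid T n (Suc i)}|lborel. (x s - y) \<bullet> y')
        + \<omega> n * (Z (grid T n (Suc i)) - Z (grid T n i))" if "i < Suc n" for i
    proof -
      let ?l = "grid T n i" and ?r = "grid T n (Suc i)"
      have st: "(x ?l - y) \<bullet> (x ?r - x ?l) \<le> (x ?l - y) \<bullet> (I ?r - I ?l)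
        - (LINT s:{?l<..?r}|lborel. (x s - y) \<bullet> y') + \<omega> n * (Z ?r - Z ?l)" "Z ?l \<le> Z ?r"
        using step[OF _ refl refl, of i n] that by (auto simp: less_Suc_eq_le)
      have "w i * ((x ?l - y) \<bullet> (x ?r - x ?l)) \<le> w i * ((x ?l - y) \<bullet> (I ?r - I ?l)
        - (LINT s:{?l<..?r}|lborel. (x s - y) \<bullet> y') + \<omega> n * (Z ?r - Z ?l))"
        using st w by (intro mult_left_mono) auto
      moreover have "w i * (\<omega> n * (Z ?r - Z ?l)) \<le> 1 * (\<omega> n * (Z ?r - Z ?l))"
        using st w \<omega>1(2)[of n] \<omega>2(2)[of n] by (intro mult_right_mono mult_nonneg_nonneg) (auto simp: \<omega>_def)
      ultimately show ?thesis by (simp add: algebra_simps)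
    qed
    then have "(\<Sum>i<Suc n. w i * ((x (grid T n i) - y) \<bullet> (x (grid T n (Suc i)) - x (grid T n i))))
      \<le> (\<Sum>i<Suc n. w i * ((x (grid T n i) - y) \<bullet> (I (grid T n (Suc i)) - I (grid T n i)))
        - w i * (LINT s:{grid T n i<..grid T n (Suc i)}|lborel. (x s - y) \<bullet> y')
        + \<omega> n * (Z (grid T n (Suc i)) - Z (grid T n i)))"
      by (intro sum_mono) auto
    then show "(\<Sum>i<Suc n. w i * ((x (grid T n i) - y) \<bullet> (x (grid T n (Suc i)) - x (grid T n i))))
        \<le> (\<Sum>i<Suc n. w i * ((x (grid T n i) - y) \<bullet> (I (grid T n (Suc i)) - I (grid T n i))))
          - (\<Sum>i<Suc n. w i * (LINT s:{grid T n i<..grid T n (Suc i)}|lborel. (x s - y) \<bullet> y'))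
          + e n"
      by (simp only: sum.distrib sum_subtractf tele)
  qed
qed

section \<open>Square-integrable martingales with a deterministic energy bound\<close>

lemma integrable_mult_of_squares:
  fixes f g :: "'a \<Rightarrow> real"
  assumes [measurable]: "f \<in> borel_measurable M" "g \<in> borel_measurable M"
    and "integrable M (\<lambda>x. (f x)\<^sup>2)" "integrable M (\<lambda>x. (g x)\<^sup>2)"
  shows "integrable M (\<lambda>x. f x * g x)"
proof (rule Bochner_Integration.integrable_bound)
  show "integrable M (\<lambda>x. (f x)\<^sup>2 + (g x)\<^sup>2)" using assms by simp
  show "AE x in M. norm (f x * g x) \<le> norm ((f x)\<^sup>2 + (g x)\<^sup>2)"
  proof (rule AE_I2)
    fix x
    have "2 * \<bar>f x\<bar> * \<bar>g x\<bar> \<le> (f x)\<^sup>2 + (g x)\<^sup>2"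
      using sum_squares_bound[of "\<bar>f x\<bar>" "\<bar>g x\<bar>"] by simp
    moreover have "0 \<le> \<bar>f x\<bar> * \<bar>g x\<bar>" by simp
    ultimately have "\<bar>f x\<bar> * \<bar>g x\<bar> \<le> (f x)\<^sup>2 + (g x)\<^sup>2" by linarith
    then show "norm (f x * g x) \<le> norm ((f x)\<^sup>2 + (g x)\<^sup>2)" by (simp add: abs_mult)
  qed
qed simp

lemma integral_le_of_nn_integral_le:
  fixes f :: "'a \<Rightarrow> real"
  assumes "f \<in> borel_measurable M" "\<And>x. 0 \<le> f x" "(\<integral>\<^sup>+x. ennreal (f x) \<partial>M) \<le> ennreal c" "0 \<le> c"
  shows "integrable M f \<and> (\<integral>x. f x \<partial>M) \<le> c"
proof -
  have int: "integrable M f"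
    using assms le_less_trans[OF assms(3) ennreal_less_top] by (intro integrableI_nonneg) auto
  have "ennreal (\<integral>x. f x \<partial>M) \<le> ennreal c"
    using assms(3) unfolding nn_integral_eq_integral[OF int AE_I2[OF assms(2)]] .
  then show ?thesis using int \<open>0 \<le> c\<close> by (subst (asm) ennreal_le_iff) auto
qed

lemma prod_UNIV_eq_prod_Basis:
  fixes x :: "real ^ 'n"
  shows "(\<Prod>j\<in>UNIV. f j (x $ j)) = (\<Prod>b\<in>Basis. f (inv (\<lambda>j. axis j (1::real)) b) (x \<bullet> b))"
proof -
  let ?e = "\<lambda>j::'n. axis j (1::real)"
  have inj: "inj ?e" by (simp add: inj_on_def axis_eq_axis)
  have B: "(Basis :: (real ^ 'n) set) = range ?e" by (auto simp: Basis_vec_def)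
  show ?thesis
    unfolding B by (subst prod.reindex[OF inj]) (simp add: o_def inner_axis inv_f_f[OF inj])
qed

text \<open>The other coordinates of the product density are integrated out.\<close>

lemma distributed_normal_component:
  fixes X :: "'w \<Rightarrow> real ^ 'n"
  assumes X: "distributed M lborel X (\<lambda>x. ennreal (\<Prod>j\<in>UNIV. normal_density 0 \<sigma> (x $ j)))"
    and "0 < \<sigma>"
  shows "distributed M lborel (\<lambda>\<omega>. X \<omega> $ j) (normal_density 0 \<sigma>)"
  unfolding distributed_def
proof (intro conjI)
  have [measurable]: "X \<in> borel_measurable M" using distributed_measurable[OF X] by simp
  have Xj[measurable]: "(\<lambda>\<omega>. X \<omega> $ j) \<in> borel_measurable M"
    using borel_measurable_inner[OF \<open>X \<in> borel_measurable M\<close> borel_measurable_const[of "axis j 1"]]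
    by (simp add: inner_axis)
  then show "(\<lambda>\<omega>. X \<omega> $ j) \<in> M \<rightarrow>\<^sub>M lborel" by simp
  show "(\<lambda>x. ennreal (normal_density 0 \<sigma> x)) \<in> borel_measurable lborel" by simp
  show "distr M lborel (\<lambda>\<omega>. X \<omega> $ j) = density lborel (\<lambda>x. ennreal (normal_density 0 \<sigma> x))"
  proof (rule measure_eqI)
    fix A assume "A \<in> sets (distr M lborel (\<lambda>\<omega>. X \<omega> $ j))"
    then have A[measurable]: "A \<in> sets borel" by simp
    define h where "h i y = ennreal (normal_density 0 \<sigma> y) * (if i = j then indicator A y else 1)" for i y
    have hm[measurable]: "h i \<in> borel_measurable borel" for i unfolding h_def by (cases "i = j") auto
    have one: "(\<integral>\<^sup>+y. ennreal (normal_density 0 \<sigma> y) \<partial>lborel) = 1"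
      using integral_normal_density[OF \<open>0 < \<sigma>\<close>, of 0] integrable_normal_density[OF \<open>0 < \<sigma>\<close>, of 0]
      by (subst nn_integral_eq_integral) auto
    have "emeasure (distr M lborel (\<lambda>\<omega>. X \<omega> $ j)) A = emeasure M ((\<lambda>\<omega>. X \<omega> $ j) -` A \<inter> space M)"
      by (subst emeasure_distr) auto
    also have "\<dots> = (\<integral>\<^sup>+\<omega>. indicator A (X \<omega> $ j) \<partial>M)"
      by (subst nn_integral_indicator[symmetric, OF measurable_sets[OF Xj A]])
         (intro nn_integral_cong, auto split: split_indicator)
    also have "\<dots> = (\<integral>\<^sup>+x. ennreal (\<Prod>i\<in>UNIV. normal_density 0 \<sigma> (x $ i)) * indicator A (x $ j) \<partial>lborel)"
      by (rule distributed_nn_integral[OF X, symmetric]) simp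
    also have "\<dots> = (\<integral>\<^sup>+x. (\<Prod>i\<in>UNIV. h i (x $ i)) \<partial>lborel)"
    proof (rule nn_integral_cong)
      fix x :: "real ^ 'n"
      have "(\<Prod>i\<in>UNIV. h i (x $ i)) = (\<Prod>i\<in>UNIV. ennreal (normal_density 0 \<sigma> (x $ i))) *
          (\<Prod>i\<in>UNIV. if i = j then indicator A (x $ i) else 1)"
        unfolding h_def by (rule prod.distrib)
      also have "(\<Prod>i\<in>UNIV. ennreal (normal_density 0 \<sigma> (x $ i))) = ennreal (\<Prod>i\<in>UNIV. normal_density 0 \<sigma> (x $ i))"
        by (rule prod_ennreal) simp
      also have "(\<Prod>i\<in>UNIV. if i = j then indicator A (x $ i) else 1) = (indicator A (x $ j) :: ennreal)"
        by (rule prod.delta[THEN trans]) auto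
      finally show "ennreal (\<Prod>i\<in>UNIV. normal_density 0 \<sigma> (x $ i)) * indicator A (x $ j) = (\<Prod>i\<in>UNIV. h i (x $ i))" ..
    qed
    also have "\<dots> = (\<integral>\<^sup>+x. (\<Prod>b\<in>(Basis::(real^'n) set). h (inv (\<lambda>j. axis j (1::real)) b) (x \<bullet> b)) \<partial>lborel)"
      unfolding prod_UNIV_eq_prod_Basis ..
    also have "\<dots> = (\<Prod>b\<in>(Basis::(real^'n) set). \<integral>\<^sup>+y. h (inv (\<lambda>j. axis j (1::real)) b) y \<partial>lborel)"
      by (rule nn_integral_lborel_prod) auto
    also have "\<dots> = (\<Prod>i\<in>(UNIV::'n set). \<integral>\<^sup>+y. h i y \<partial>lborel)"
      using prod_UNIV_eq_prod_Basis[of "\<lambda>i _. \<integral>\<^sup>+y. h i y \<partial>lborel" "0 :: real^'n"] by simp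
    also have "\<dots> = (\<Prod>i\<in>(UNIV::'n set). if i = j then \<integral>\<^sup>+y. h j y \<partial>lborel else 1)"
    proof -
      have "(\<integral>\<^sup>+y. h i y \<partial>lborel) = 1" if "i \<noteq> j" for i using that by (simp add: h_def one)
      then show ?thesis by (intro prod.cong) auto
    qed
    also have "\<dots> = emeasure (density lborel (\<lambda>x. ennreal (normal_density 0 \<sigma> x))) A"
    proof -
      have "h j = (\<lambda>y. ennreal (normal_density 0 \<sigma> y) * indicator A y)"
        by (simp add: h_def fun_eq_iff)
      then show ?thesis by (simp add: emeasure_density)
    qed
    finally show "emeasure (distr M lborel (\<lambda>\<omega>. X \<omega> $ j)) A
        = emeasure (density lborel (\<lambda>x. ennreal (normal_density 0 \<sigma> x))) A" .
  qed simp
qed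

locale stochastic_basis =
  fixes M :: "'w measure" and F :: "real \<Rightarrow> 'w measure"
  assumes filtered: "filtered_prob_space M F"
begin

sublocale prob_space M
  using filtered by (simp add: filtered_prob_space_def)

lemma measurable_F_M: "0 \<le> t \<Longrightarrow> f \<in> F t \<rightarrow>\<^sub>M N \<Longrightarrow> f \<in> M \<rightarrow>\<^sub>M N"
  using filtered measurable_from_subalg unfolding filtered_prob_space_def by blast

lemma space_F: "space (F t) = space M"
  using filtered filtration.space_F unfolding filtered_prob_space_def by blast

lemma measurable_F_mono: "s \<le> t \<Longrightarrow> f \<in> F s \<rightarrow>\<^sub>M N \<Longrightarrow> f \<in> F t \<rightarrow>\<^sub>M N"
proof -
  assume "s \<le> t" and f: "f \<in> F s \<rightarrow>\<^sub>M N"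
  then have "sets (F s) \<subseteq> sets (F t)"
    using filtered filtration.sets_F_mono unfolding filtered_prob_space_def by blast
  then have "subalgebra (F t) (F s)" by (simp add: subalgebra_def space_F)
  then show ?thesis using f by (rule measurable_from_subalg)
qed

text \<open>The conditional expectation of \<open>D\<close> given \<open>F s\<close> is zero, and that of its squared norm is at most \<open>B\<close>;
both are expressed by testing against random variables known at time \<open>s\<close>.\<close>

definition centred_given :: "real \<Rightarrow> real \<Rightarrow> ('w \<Rightarrow> real ^ 'n) \<Rightarrow> bool" where
  "centred_given s B D \<longleftrightarrow> D \<in> borel_measurable M \<and>
     (\<forall>v\<in>borel_measurable (F s). (\<exists>b. \<forall>\<omega>. norm (v \<omega>) \<le> b) \<longrightarrow> (\<integral>\<omega>. v \<omega> \<bullet> D \<omega> \<partial>M) = 0) \<and>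
     (\<forall>g\<in>borel_measurable (F s). (\<forall>\<omega>. 0 \<le> g \<omega>) \<longrightarrow> integrable M g \<longrightarrow>
        integrable M (\<lambda>\<omega>. g \<omega> * (norm (D \<omega>))\<^sup>2) \<and>
        (\<integral>\<omega>. g \<omega> * (norm (D \<omega>))\<^sup>2 \<partial>M) \<le> B * (\<integral>\<omega>. g \<omega> \<partial>M))"

text \<open>These are the square-integrable martingales whose predictable quadratic variation is dominated by
the deterministic measure \<open>dL\<close>.\<close>

definition L2_martingale :: "(real \<Rightarrow> real) \<Rightarrow> (real \<Rightarrow> 'w \<Rightarrow> real ^ 'n) \<Rightarrow> bool" where
  "L2_martingale L J \<longleftrightarrow> (\<forall>t\<ge>0. J t \<in> borel_measurable (F t)) \<and>
     (\<forall>s t. 0 \<le> s \<longrightarrow> s \<le> t \<longrightarrow> L s \<le> L t \<and> centred_given s (L t - L s) (\<lambda>\<omega>. J t \<omega> - J s \<omega>))"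

lemma L2_martingale_measurable: "L2_martingale L J \<Longrightarrow> 0 \<le> t \<Longrightarrow> J t \<in> borel_measurable (F t)"
  by (simp add: L2_martingale_def)

lemma L2_martingale_measurable_M: "L2_martingale L J \<Longrightarrow> 0 \<le> t \<Longrightarrow> J t \<in> borel_measurable M"
  by (blast intro: L2_martingale_measurable measurable_F_M)

lemma L2_martingale_mono: "L2_martingale L J \<Longrightarrow> 0 \<le> s \<Longrightarrow> s \<le> t \<Longrightarrow> L s \<le> L t"
  by (simp add: L2_martingale_def)

lemma L2_martingale_centred:
  "L2_martingale L J \<Longrightarrow> 0 \<le> s \<Longrightarrow> s \<le> t \<Longrightarrow> centred_given s (L t - L s) (\<lambda>\<omega>. J t \<omega> - J s \<omega>)"
  by (simp add: L2_martingale_def)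

lemma L2_martingale_square:
  assumes J: "L2_martingale L J" and st: "0 \<le> s" "s \<le> t"
    and g: "g \<in> borel_measurable (F s)" "\<And>\<omega>. 0 \<le> g \<omega>" "integrable M g"
  shows "integrable M (\<lambda>\<omega>. g \<omega> * (norm (J t \<omega> - J s \<omega>))\<^sup>2)"
    and "(\<integral>\<omega>. g \<omega> * (norm (J t \<omega> - J s \<omega>))\<^sup>2 \<partial>M) \<le> (L t - L s) * (\<integral>\<omega>. g \<omega> \<partial>M)"
  using L2_martingale_centred[OF J st] g unfolding centred_given_def by blast+

text \<open>Truncation and dominated convergence extend the martingale property from bounded test vectors to
all those for which the expectation exists.\<close>

lemma L2_martingale_orthogonal:
  assumes J: "L2_martingale L J" and st: "0 \<le> s" "s \<le> t" and v: "v \<in> borel_measurable (F s)"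
    and int: "integrable M (\<lambda>\<omega>. norm (v \<omega>) * norm (J t \<omega> - J s \<omega>))"
  shows "(\<integral>\<omega>. v \<omega> \<bullet> (J t \<omega> - J s \<omega>) \<partial>M) = 0"
proof -
  define w where "w m \<omega> = (if norm (v \<omega>) \<le> real m then v \<omega> else 0)" for m \<omega>
  have [measurable]: "J t \<in> borel_measurable M" "J s \<in> borel_measurable M" "v \<in> borel_measurable M"
    using L2_martingale_measurable_M[OF J] measurable_F_M[OF st(1) v] st by auto
  have wF: "w m \<in> borel_measurable (F s)" for m using v unfolding w_def by measurable
  have [measurable]: "w m \<in> borel_measurable M" for m using measurable_F_M[OF st(1) wF] .
  have "norm (w m \<omega>) \<le> real m" for m \<omega> by (auto simp: w_def)
  then have 0: "(\<integral>\<omega>. w m \<omega> \<bullet> (J t \<omega> - J s \<omega>) \<partial>M) = 0" for m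
    using L2_martingale_centred[OF J st] wF[of m] unfolding centred_given_def by blast
  have "(\<lambda>m. \<integral>\<omega>. w m \<omega> \<bullet> (J t \<omega> - J s \<omega>) \<partial>M) \<longlonglongrightarrow> (\<integral>\<omega>. v \<omega> \<bullet> (J t \<omega> - J s \<omega>) \<partial>M)"
  proof (rule integral_dominated_convergence[OF _ _ int])
    show "AE \<omega> in M. (\<lambda>m. w m \<omega> \<bullet> (J t \<omega> - J s \<omega>)) \<longlonglongrightarrow> v \<omega> \<bullet> (J t \<omega> - J s \<omega>)"
    proof (rule AE_I2, rule tendsto_eventually)
      fix \<omega>
      show "\<forall>\<^sub>F m in sequentially. w m \<omega> \<bullet> (J t \<omega> - J s \<omega>) = v \<omega> \<bullet> (J t \<omega> - J s \<omega>)"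
        using eventually_ge_at_top[of "nat \<lceil>norm (v \<omega>)\<rceil>"]
        by eventually_elim (auto simp: w_def nat_le_iff ceiling_le_iff)
    qed
    show "AE \<omega> in M. norm (w m \<omega> \<bullet> (J t \<omega> - J s \<omega>)) \<le> norm (v \<omega>) * norm (J t \<omega> - J s \<omega>)" for m
      using Cauchy_Schwarz_ineq2 by (intro AE_I2) (auto simp: w_def)
  qed auto
  then show ?thesis unfolding 0 by (simp add: LIMSEQ_const_iff)
qed

text \<open>Each new summand is orthogonal to the sum of the earlier ones, because that sum times the integrand is
known at the left endpoint of the new interval. The second moments therefore add up.\<close>

lemma martingale_transform:
  assumes J: "L2_martingale L J"
    and u: "\<And>i. i \<le> n \<Longrightarrow> 0 \<le> u i" "\<And>i. i < n \<Longrightarrow> u i \<le> u (Suc i)"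
    and v: "\<And>i. i < n \<Longrightarrow> v i \<in> borel_measurable (F (u i))"
      "\<And>i. i < n \<Longrightarrow> integrable M (\<lambda>\<omega>. (norm (v i \<omega>))\<^sup>2)"
  defines "D \<equiv> \<lambda>n \<omega>. \<Sum>i<n. v i \<omega> \<bullet> (J (u (Suc i)) \<omega> - J (u i) \<omega>)"
  shows "D n \<in> borel_measurable (F (u n))" and "integrable M (\<lambda>\<omega>. (D n \<omega>)\<^sup>2)"
    and "(\<integral>\<omega>. D n \<omega> \<partial>M) = 0"
    and "(\<integral>\<omega>. (D n \<omega>)\<^sup>2 \<partial>M) \<le> (\<Sum>i<n. (\<integral>\<omega>. (norm (v i \<omega>))\<^sup>2 \<partial>M) * (L (u (Suc i)) - L (u i)))"
proof -
  have "D m \<in> borel_measurable (F (u m)) \<and> integrable M (\<lambda>\<omega>. (D m \<omega>)\<^sup>2) \<and> (\<integral>\<omega>. D m \<omega> \<partial>M) = 0 \<and>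
    (\<integral>\<omega>. (D m \<omega>)\<^sup>2 \<partial>M) \<le> (\<Sum>i<m. (\<integral>\<omega>. (norm (v i \<omega>))\<^sup>2 \<partial>M) * (L (u (Suc i)) - L (u i)))"
    if "m \<le> n" for m using that
  proof (induction m)
    case 0
    then show ?case by (simp add: D_def)
  next
    case (Suc m)
    let ?s = "u m" and ?t = "u (Suc m)"
    let ?\<Delta> = "\<lambda>\<omega>. J ?t \<omega> - J ?s \<omega>"
    have st: "0 \<le> ?s" "?s \<le> ?t" using u Suc.prems by auto
    have vF: "v m \<in> borel_measurable (F ?s)" and vi: "integrable M (\<lambda>\<omega>. (norm (v m \<omega>))\<^sup>2)"
      using v[of m] Suc.prems by auto
    have IH: "D m \<in> borel_measurable (F ?s)" "integrable M (\<lambda>\<omega>. (D m \<omega>)\<^sup>2)" "(\<integral>\<omega>. D m \<omega> \<partial>M) = 0"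
      "(\<integral>\<omega>. (D m \<omega>)\<^sup>2 \<partial>M) \<le> (\<Sum>i<m. (\<integral>\<omega>. (norm (v i \<omega>))\<^sup>2 \<partial>M) * (L (u (Suc i)) - L (u i)))"
      using Suc by auto
    have [measurable]: "J ?t \<in> borel_measurable M" "J ?s \<in> borel_measurable M" "v m \<in> borel_measurable M"
      "D m \<in> borel_measurable M"
      using L2_martingale_measurable_M[OF J] st measurable_F_M[OF st(1)] vF IH(1) by auto
    have g: "(\<lambda>\<omega>. (norm (v m \<omega>))\<^sup>2) \<in> borel_measurable (F ?s)" using vF by measurable
    note sq = L2_martingale_square[OF J st g _ vi, simplified]
    define E where "E \<omega> = v m \<omega> \<bullet> ?\<Delta> \<omega>" for \<omega>
    have [measurable]: "E \<in> borel_measurable M" unfolding E_def by measurable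
    have Esq: "(E \<omega>)\<^sup>2 \<le> (norm (v m \<omega>))\<^sup>2 * (norm (?\<Delta> \<omega>))\<^sup>2" for \<omega>
      unfolding E_def using Cauchy_Schwarz_ineq[of "v m \<omega>" "?\<Delta> \<omega>"] by (simp add: power2_norm_eq_inner)
    have E2: "integrable M (\<lambda>\<omega>. (E \<omega>)\<^sup>2)"
      by (rule Bochner_Integration.integrable_bound[OF sq(1)]) (use Esq in auto)
    have "(\<integral>\<omega>. (E \<omega>)\<^sup>2 \<partial>M) \<le> (\<integral>\<omega>. (norm (v m \<omega>))\<^sup>2 * (norm (?\<Delta> \<omega>))\<^sup>2 \<partial>M)"
      using Esq by (intro integral_mono E2 sq(1))
    then have E2le: "(\<integral>\<omega>. (E \<omega>)\<^sup>2 \<partial>M) \<le> (\<integral>\<omega>. (norm (v m \<omega>))\<^sup>2 \<partial>M) * (L ?t - L ?s)"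
      using sq(2) by (simp only: mult.commute order_trans)
    have prod_sq: "integrable M (\<lambda>\<omega>. (norm (v m \<omega>) * norm (?\<Delta> \<omega>))\<^sup>2)"
      using sq(1) by (simp add: power_mult_distrib)
    have "integrable M (\<lambda>\<omega>. 1 * (norm (v m \<omega>) * norm (?\<Delta> \<omega>)))"
      using prod_sq by (intro integrable_mult_of_squares) auto
    then have E0: "(\<integral>\<omega>. E \<omega> \<partial>M) = 0"
      unfolding E_def by (intro L2_martingale_orthogonal[OF J st vF]) simp
    have "integrable M (\<lambda>\<omega>. \<bar>D m \<omega>\<bar> * (norm (v m \<omega>) * norm (?\<Delta> \<omega>)))"
      using prod_sq IH(2) by (intro integrable_mult_of_squares) auto
    then have "(\<integral>\<omega>. (D m \<omega> *\<^sub>R v m \<omega>) \<bullet> ?\<Delta> \<omega> \<partial>M) = 0"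
      using IH(1) vF by (intro L2_martingale_orthogonal[OF J st]) (auto simp: mult.assoc)
    then have cross: "(\<integral>\<omega>. D m \<omega> * E \<omega> \<partial>M) = 0" by (simp add: E_def)
    have DE: "integrable M (\<lambda>\<omega>. D m \<omega> * E \<omega>)"
      using IH(2) E2 by (intro integrable_mult_of_squares) auto
    have D_Suc: "D (Suc m) = (\<lambda>\<omega>. D m \<omega> + E \<omega>)" by (simp add: D_def E_def fun_eq_iff)
    have sq_expand: "(D (Suc m) \<omega>)\<^sup>2 = (D m \<omega>)\<^sup>2 + 2 * (D m \<omega> * E \<omega>) + (E \<omega>)\<^sup>2" for \<omega>
      by (simp add: D_Suc power2_sum)
    have "integrable M (D m)" "integrable M E"
      using IH(2) E2 by (auto intro: square_integrable_imp_integrable)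
    then have mean: "(\<integral>\<omega>. D (Suc m) \<omega> \<partial>M) = 0" unfolding D_Suc using IH(3) E0 by simp
    have "(\<integral>\<omega>. (D (Suc m) \<omega>)\<^sup>2 \<partial>M) = (\<integral>\<omega>. (D m \<omega>)\<^sup>2 \<partial>M) + (\<integral>\<omega>. (E \<omega>)\<^sup>2 \<partial>M)"
      unfolding sq_expand using IH(2) DE E2 cross by simp
    moreover have "integrable M (\<lambda>\<omega>. (D (Suc m) \<omega>)\<^sup>2)"
      unfolding sq_expand using IH(2) DE E2 by simp
    moreover have "D (Suc m) \<in> borel_measurable (F ?t)"
    proof -
      have [measurable]: "D m \<in> borel_measurable (F ?t)" "v m \<in> borel_measurable (F ?t)"
          "J ?s \<in> borel_measurable (F ?t)" "J ?t \<in> borel_measurable (F ?t)"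
        using IH(1) vF L2_martingale_measurable[OF J] st
        by (blast intro: measurable_F_mono[OF st(2)] order_trans)+
      show ?thesis unfolding D_Suc E_def by measurable
    qed
    ultimately show ?case using mean IH(4) E2le by simp
  qed
  from this[of n] show "D n \<in> borel_measurable (F (u n))" "integrable M (\<lambda>\<omega>. (D n \<omega>)\<^sup>2)"
    "(\<integral>\<omega>. D n \<omega> \<partial>M) = 0"
    "(\<integral>\<omega>. (D n \<omega>)\<^sup>2 \<partial>M) \<le> (\<Sum>i<n. (\<integral>\<omega>. (norm (v i \<omega>))\<^sup>2 \<partial>M) * (L (u (Suc i)) - L (u i)))"
    by auto
qed

text \<open>Both generated sigma-algebras lie in the ones whose independence is part of the definition of Brownian
motion.\<close>

lemma indep_increment_integral:
  fixes W :: "real \<Rightarrow> 'w \<Rightarrow> real ^ 'm" and f :: "'w \<Rightarrow> real" and h :: "real ^ 'm \<Rightarrow> real"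
  assumes W: "brownian_motion M F W" and st: "0 \<le> s" "s < t"
    and f: "f \<in> borel_measurable (F s)" "integrable M f"
    and h[measurable]: "h \<in> borel_measurable borel" and hi: "integrable M (\<lambda>\<omega>. h (W t \<omega> - W s \<omega>))"
  shows "integrable M (\<lambda>\<omega>. f \<omega> * h (W t \<omega> - W s \<omega>))"
    and "(\<integral>\<omega>. f \<omega> * h (W t \<omega> - W s \<omega>) \<partial>M) = (\<integral>\<omega>. f \<omega> \<partial>M) * (\<integral>\<omega>. h (W t \<omega> - W s \<omega>) \<partial>M)"
proof -
  let ?X = "\<lambda>\<omega>. W t \<omega> - W s \<omega>"
  have Wm: "W r \<in> borel_measurable M" if "0 \<le> r" for r
    using W that measurable_F_M unfolding brownian_motion_def continuous_adapted_def by blast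
  have [measurable]: "f \<in> borel_measurable M" "?X \<in> borel_measurable M"
    using Wm st measurable_F_M[OF st(1) f(1)] by auto
  have ind: "indep_set (sets (F s)) (sets (vimage_algebra (space M) ?X borel))"
    using W st unfolding brownian_motion_def by blast
  have "indep_var borel f borel (\<lambda>\<omega>. h (?X \<omega>))"
    unfolding indep_var_eq
  proof (intro conjI)
    have 1: "sigma_sets (space M) {f -` A \<inter> space M |A. A \<in> sets borel} \<subseteq> sets (F s)"
    proof -
      have "{f -` A \<inter> space M |A. A \<in> sets borel} \<subseteq> sets (F s)"
        using measurable_sets[OF f(1)] by (auto simp: space_F)
      then show ?thesis using sets.sigma_sets_subset[of _ "F s"] by (simp add: space_F)
    qed
    have 2: "sigma_sets (space M) {(\<lambda>\<omega>. h (?X \<omega>)) -` A \<inter> space M |A. A \<in> sets borel}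
        \<subseteq> sets (vimage_algebra (space M) ?X borel)"
    proof -
      have "(\<lambda>\<omega>. h (?X \<omega>)) -` A \<inter> space M \<in> sets (vimage_algebra (space M) ?X borel)"
        if "A \<in> sets borel" for A
      proof -
        have "?X -` (h -` A) \<inter> space M \<in> sets (vimage_algebra (space M) ?X borel)"
          using measurable_sets[OF h that] by (intro in_vimage_algebra) auto
        then show ?thesis by (simp add: vimage_def)
      qed
      then have "{(\<lambda>\<omega>. h (?X \<omega>)) -` A \<inter> space M |A. A \<in> sets borel}
          \<subseteq> sets (vimage_algebra (space M) ?X borel)" by blast
      then show ?thesis
        using sets.sigma_sets_subset[of _ "vimage_algebra (space M) ?X borel"] by simp
    qed
    show "indep_set (sigma_sets (space M) {f -` A \<inter> space M |A. A \<in> sets borel})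
        (sigma_sets (space M) {(\<lambda>\<omega>. h (?X \<omega>)) -` A \<inter> space M |A. A \<in> sets borel})"
      using ind unfolding indep_set_def
      by (rule indep_sets_mono_sets) (use 1 2 in \<open>auto split: bool.split\<close>)
  qed auto
  then show "integrable M (\<lambda>\<omega>. f \<omega> * h (?X \<omega>))"
    "(\<integral>\<omega>. f \<omega> * h (?X \<omega>) \<partial>M) = (\<integral>\<omega>. f \<omega> \<partial>M) * (\<integral>\<omega>. h (?X \<omega>) \<partial>M)"
    using f(2) hi by (auto intro: indep_var_integrable indep_var_lebesgue_integral)
qed

text \<open>The constant is the trace of the covariance matrix of an increment over a unit of time.\<close>

lemma brownian_motion_L2_martingale:
  fixes W :: "real \<Rightarrow> 'w \<Rightarrow> real ^ 'm"
  assumes W: "brownian_motion M F W"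
  shows "L2_martingale (\<lambda>t. real CARD('m) * t) W"
  unfolding L2_martingale_def centred_given_def
proof (intro conjI allI impI ballI)
  show WF: "W t \<in> borel_measurable (F t)" if "0 \<le> t" for t
    using W that unfolding brownian_motion_def continuous_adapted_def by blast
  fix s t :: real assume s: "0 \<le> s" and st: "s \<le> t"
  show "real CARD('m) * s \<le> real CARD('m) * t" using st by (intro mult_left_mono) auto
  let ?X = "\<lambda>\<omega>. W t \<omega> - W s \<omega>"
  show "?X \<in> borel_measurable M"
    using measurable_F_M[OF s WF[OF s]] measurable_F_M[OF _ WF] order_trans[OF s st]
    by (intro borel_measurable_diff) auto
  have moments: "integrable M (\<lambda>\<omega>. ?X \<omega> $ j) \<and> (\<integral>\<omega>. ?X \<omega> $ j \<partial>M) = 0 \<and>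
      integrable M (\<lambda>\<omega>. (?X \<omega> $ j)\<^sup>2) \<and> (\<integral>\<omega>. (?X \<omega> $ j)\<^sup>2 \<partial>M) = t - s" if "s < t" for j
  proof -
    have \<sigma>: "0 < sqrt (t - s)" using that by simp
    have D: "distributed M lborel (\<lambda>\<omega>. ?X \<omega> $ j) (normal_density 0 (sqrt (t - s)))"
      using W s that unfolding brownian_motion_def
      by (intro distributed_normal_component[OF _ \<sigma>]) auto
    have E: "(\<integral>\<omega>. ?X \<omega> $ j \<partial>M) = 0" using normal_distributed_expectation[OF \<sigma> D] .
    moreover have "integrable M (\<lambda>\<omega>. ?X \<omega> $ j)"
      using distributed_integrable[OF D, of "\<lambda>x. x"] integrable_normal_moment_nz_1[OF \<sigma>, of 0] by simp
    moreover have "integrable M (\<lambda>\<omega>. (?X \<omega> $ j)\<^sup>2)"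
      using distributed_integrable[OF D, of "\<lambda>x. x\<^sup>2"] integrable_normal_moment[OF \<sigma>, of 0 2] by simp
    moreover have "(\<integral>\<omega>. (?X \<omega> $ j)\<^sup>2 \<partial>M) = t - s"
      using normal_distributed_variance[OF \<sigma> D] E that by simp
    ultimately show ?thesis by blast
  qed
  show "(\<integral>\<omega>. v \<omega> \<bullet> ?X \<omega> \<partial>M) = 0"
    if v: "v \<in> borel_measurable (F s)" and b: "\<exists>b. \<forall>\<omega>. norm (v \<omega>) \<le> b" for v
  proof (cases "s < t")
    case True
    obtain b where b: "\<And>\<omega>. norm (v \<omega>) \<le> b" using b by blast
    have vj: "(\<lambda>\<omega>. v \<omega> $ j) \<in> borel_measurable (F s)" for j
      using borel_measurable_inner[OF v borel_measurable_const[of "axis j 1"]] by (simp add: inner_axis)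
    have "integrable M (\<lambda>\<omega>. v \<omega> $ j)" for j
      using measurable_F_M[OF s vj] b order_trans[OF component_le_norm_cart b]
      by (intro integrable_const_bound[of _ b]) auto
    note * = indep_increment_integral[OF W s True vj this, where h = "\<lambda>x. x $ _"]
    have "(\<integral>\<omega>. v \<omega> \<bullet> ?X \<omega> \<partial>M) = (\<integral>\<omega>. (\<Sum>j\<in>UNIV. v \<omega> $ j * ?X \<omega> $ j) \<partial>M)"
      by (simp add: inner_vec_def)
    also have "\<dots> = (\<Sum>j\<in>UNIV. \<integral>\<omega>. v \<omega> $ j * ?X \<omega> $ j \<partial>M)"
      using moments[OF True] by (intro Bochner_Integration.integral_sum *(1)) auto
    also have "\<dots> = (\<Sum>j\<in>UNIV. (\<integral>\<omega>. v \<omega> $ j \<partial>M) * (\<integral>\<omega>. ?X \<omega> $ j \<partial>M))"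
      using moments[OF True] by (intro sum.cong refl *(2)) auto
    also have "\<dots> = 0" using moments[OF True] by simp
    finally show ?thesis .
  qed (use st in simp)
  fix g :: "'w \<Rightarrow> real"
  assume g: "g \<in> borel_measurable (F s)" "\<forall>\<omega>. 0 \<le> g \<omega>" "integrable M g"
  have "integrable M (\<lambda>\<omega>. g \<omega> * (norm (?X \<omega>))\<^sup>2) \<and>
      (\<integral>\<omega>. g \<omega> * (norm (?X \<omega>))\<^sup>2 \<partial>M) = real CARD('m) * (t - s) * (\<integral>\<omega>. g \<omega> \<partial>M)"
  proof (cases "s < t")
    case True
    have n2: "(norm x)\<^sup>2 = (\<Sum>j\<in>UNIV. (x $ j)\<^sup>2)" for x :: "real ^ 'm"
      unfolding power2_norm_eq_inner by (simp add: inner_vec_def power2_eq_square)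
    have Xi: "integrable M (\<lambda>\<omega>. (norm (?X \<omega>))\<^sup>2)"
      unfolding n2 using moments[OF True] by auto
    have "(\<integral>\<omega>. (norm (?X \<omega>))\<^sup>2 \<partial>M) = real CARD('m) * (t - s)"
      unfolding n2 using moments[OF True] by (subst Bochner_Integration.integral_sum) auto
    then show ?thesis
      using indep_increment_integral[OF W s True g(1,3), where h = "\<lambda>x. (norm x)\<^sup>2"] Xi by auto
  qed (use st in simp)
  then show "integrable M (\<lambda>\<omega>. g \<omega> * (norm (?X \<omega>))\<^sup>2)"
    "(\<integral>\<omega>. g \<omega> * (norm (?X \<omega>))\<^sup>2 \<partial>M) \<le> (real CARD('m) * t - real CARD('m) * s) * (\<integral>\<omega>. g \<omega> \<partial>M)"
    by (simp_all add: right_diff_distrib)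
qed

end

section \<open>Truncated simple stochastic integrals\<close>

context prob_space begin

text \<open>The pointwise inequality \<open>Z \<le> \<epsilon> + \<rho> Z\<^sup>2 + (1 / \<rho>) 1_{\<epsilon> < Z}\<close> separates small values, large values
controlled by the second moment, and an event of small probability.\<close>

lemma null_in_probability_imp_L1:
  fixes Z :: "nat \<Rightarrow> 'a \<Rightarrow> real"
  assumes [measurable]: "\<And>k. Z k \<in> borel_measurable M"
    and nonneg: "\<And>k \<omega>. 0 \<le> Z k \<omega>"
    and sq: "\<And>k. integrable M (\<lambda>\<omega>. (Z k \<omega>)\<^sup>2)" "\<And>k. (\<integral>\<omega>. (Z k \<omega>)\<^sup>2 \<partial>M) \<le> B"
    and conv: "\<And>\<epsilon>. 0 < \<epsilon> \<Longrightarrow> (\<lambda>k. prob {\<omega> \<in> space M. \<epsilon> < Z k \<omega>}) \<longlonglongrightarrow> 0"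
  shows "(\<lambda>k. \<integral>\<omega>. Z k \<omega> \<partial>M) \<longlonglongrightarrow> 0"
proof (rule LIMSEQ_I)
  fix e :: real assume "0 < e"
  have "0 \<le> (\<integral>\<omega>. (Z 0 \<omega>)\<^sup>2 \<partial>M)" by simp
  then have "0 \<le> B" using sq(2)[of 0] by linarith
  define \<rho> where "\<rho> = e / (3 * (B + 1))"
  have \<rho>: "0 < \<rho>" "\<rho> * B \<le> e / 3"
    using \<open>0 < e\<close> \<open>0 \<le> B\<close> by (auto simp: \<rho>_def field_simps)
  have le: "(\<integral>\<omega>. Z k \<omega> \<partial>M) \<le> e / 3 + e / 3 + (1 / \<rho>) * prob {\<omega> \<in> space M. e / 3 < Z k \<omega>}" for k
  proof -
    let ?E = "{\<omega> \<in> space M. e / 3 < Z k \<omega>}"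
    have Zi: "integrable M (Z k)" using sq(1)[of k] by (auto intro: square_integrable_imp_integrable)
    have Ei: "integrable M (indicat_real ?E)" by (intro integrable_real_indicator) (auto simp: emeasure_eq_measure)
    have "(\<integral>\<omega>. Z k \<omega> \<partial>M) \<le> (\<integral>\<omega>. e / 3 + \<rho> * (Z k \<omega>)\<^sup>2 + (1 / \<rho>) * indicat_real ?E \<omega> \<partial>M)"
    proof (rule integral_mono[OF Zi])
      show "integrable M (\<lambda>\<omega>. e / 3 + \<rho> * (Z k \<omega>)\<^sup>2 + (1 / \<rho>) * indicat_real ?E \<omega>)"
        using sq(1) Ei by (intro Bochner_Integration.integrable_add integrable_mult_right) auto
      fix \<omega> assume \<omega>: "\<omega> \<in> space M"
      show "Z k \<omega> \<le> e / 3 + \<rho> * (Z k \<omega>)\<^sup>2 + (1 / \<rho>) * indicat_real ?E \<omega>"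
      proof (cases "\<omega> \<in> ?E")
        case True
        have "2 * Z k \<omega> \<le> \<rho> * (Z k \<omega>)\<^sup>2 + 1 / \<rho>"
        proof -
          have "0 \<le> (\<rho> * Z k \<omega> - 1)\<^sup>2 / \<rho>" using \<rho> by simp
          also have "\<dots> = \<rho> * (Z k \<omega>)\<^sup>2 + 1 / \<rho> - 2 * Z k \<omega>"
            using \<rho> by (simp add: power2_eq_square field_simps)
          finally show ?thesis by simp
        qed
        then show ?thesis using True \<open>0 < e\<close> nonneg[of k \<omega>] by simp
      next
        case False
        moreover have "0 \<le> \<rho> * (Z k \<omega>)\<^sup>2" using \<rho> by simp
        ultimately show ?thesis using \<omega> by auto
      qed
    qed
    also have "\<dots> = e / 3 + \<rho> * (\<integral>\<omega>. (Z k \<omega>)\<^sup>2 \<partial>M) + (1 / \<rho>) * prob ?E"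
      using sq(1) Ei by (simp add: prob_space)
    also have "\<rho> * (\<integral>\<omega>. (Z k \<omega>)\<^sup>2 \<partial>M) \<le> \<rho> * B" using sq(2) \<rho> by (intro mult_left_mono) auto
    finally show ?thesis using \<rho> by simp
  qed
  have "(\<lambda>k. (1 / \<rho>) * prob {\<omega> \<in> space M. e / 3 < Z k \<omega>}) \<longlonglongrightarrow> (1 / \<rho>) * 0"
    using \<open>0 < e\<close> by (intro tendsto_mult_left conv) simp
  then obtain N where N: "\<And>k. N \<le> k \<Longrightarrow> (1 / \<rho>) * prob {\<omega> \<in> space M. e / 3 < Z k \<omega>} < e / 3"
    using order_tendstoD(2)[of _ _ sequentially "e / 3"] \<open>0 < e\<close> unfolding eventually_sequentially by fastforce
  show "\<exists>no. \<forall>k\<ge>no. norm ((\<integral>\<omega>. Z k \<omega> \<partial>M) - 0) < e"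
  proof (intro exI allI impI)
    fix k assume "N \<le> k"
    moreover have "0 \<le> (\<integral>\<omega>. Z k \<omega> \<partial>M)" using nonneg by simp
    moreover have "(\<integral>\<omega>. Z k \<omega> \<partial>M) < e" using le[of k] N[OF \<open>N \<le> k\<close>] by linarith
    ultimately show "norm ((\<integral>\<omega>. Z k \<omega> \<partial>M) - 0) < e" by simp
  qed
qed

text \<open>The minimum of \<open>Z\<close> and 1 converges to zero in \<open>L\<^sup>1\<close>, and it has the same null limits along a path
as \<open>Z\<close>.\<close>

lemma null_in_probability_AE_subseq:
  fixes Z :: "nat \<Rightarrow> 'a \<Rightarrow> real"
  assumes [measurable]: "\<And>k. Z k \<in> borel_measurable M"
    and nonneg: "\<And>k \<omega>. 0 \<le> Z k \<omega>"
    and conv: "\<And>\<epsilon>. 0 < \<epsilon> \<Longrightarrow> (\<lambda>k. prob {\<omega> \<in> space M. \<epsilon> < Z k \<omega>}) \<longlonglongrightarrow> 0"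
  obtains r :: "nat \<Rightarrow> nat" where "strict_mono r" "AE \<omega> in M. (\<lambda>k. Z (r k) \<omega>) \<longlonglongrightarrow> 0"
proof -
  define U where "U k \<omega> = min (Z k \<omega>) 1" for k \<omega>
  have [measurable]: "U k \<in> borel_measurable M" for k unfolding U_def by measurable
  have U: "0 \<le> U k \<omega>" "U k \<omega> \<le> 1" for k \<omega> using nonneg by (auto simp: U_def)
  have U2: "integrable M (\<lambda>\<omega>. (U k \<omega>)\<^sup>2)" for k
    using U by (intro integrable_const_bound[of _ 1]) (auto simp: power_le_one)
  have "(\<lambda>k. \<integral>\<omega>. U k \<omega> \<partial>M) \<longlonglongrightarrow> 0"
  proof (rule null_in_probability_imp_L1[where B = 1])
    show "(\<integral>\<omega>. (U k \<omega>)\<^sup>2 \<partial>M) \<le> 1" for k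
      using U integral_mono[OF U2, of "\<lambda>_. 1"] by (simp add: power_le_one prob_space)
    show "(\<lambda>k. prob {\<omega> \<in> space M. \<epsilon> < U k \<omega>}) \<longlonglongrightarrow> 0" if "0 < \<epsilon>" for \<epsilon>
      by (rule tendsto_sandwich[OF _ _ tendsto_const conv[OF that]])
         (auto intro!: finite_measure_mono always_eventually simp: U_def)
  qed (use U U2 in auto)
  moreover have "integrable M (U k)" for k
    using U by (intro integrable_const_bound[of _ 1]) auto
  ultimately obtain r where r: "strict_mono (r :: nat \<Rightarrow> nat)" "AE \<omega> in M. (\<lambda>k. U (r k) \<omega>) \<longlonglongrightarrow> 0"
    using tendsto_L1_AE_subseq[of M U] U by auto
  have "AE \<omega> in M. (\<lambda>k. Z (r k) \<omega>) \<longlonglongrightarrow> 0"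
    using r(2)
  proof eventually_elim
    case (elim \<omega>)
    then have "\<forall>\<^sub>F k in sequentially. U (r k) \<omega> < 1" by (rule order_tendstoD(2)) simp
    then have "\<forall>\<^sub>F k in sequentially. U (r k) \<omega> = Z (r k) \<omega>"
      by (rule eventually_mono) (auto simp: U_def min_def split: if_splits)
    with elim show ?case by (rule Lim_transform_eventually)
  qed
  with r(1) show ?thesis by (rule that)
qed

end

lemma simple_integrand_partition:
  assumes "simple_integrand M F (n, \<tau>, \<eta>)"
  shows "i \<le> j \<Longrightarrow> j \<le> n \<Longrightarrow> \<tau> i \<le> \<tau> j" and "i < j \<Longrightarrow> j \<le> n \<Longrightarrow> \<tau> i < \<tau> j" and "i \<le> n \<Longrightarrow> 0 \<le> \<tau> i"
proof -
  have step: "\<tau> i < \<tau> (Suc i)" if "i < n" for i using assms that by (simp add: simple_integrand_def)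
  show less: "\<tau> i < \<tau> j" if "i < j" "j \<le> n" for i j
    using that
  proof (induction j)
    case (Suc j)
    then show ?case using step[of j] by (cases "i = j") (auto intro: less_trans)
  qed simp
  show "i \<le> j \<Longrightarrow> j \<le> n \<Longrightarrow> \<tau> i \<le> \<tau> j" using less[of i j] by (cases "i = j") auto
  show "0 \<le> \<tau> i" if "i \<le> n"
    using less[of 0 i] that assms by (cases "i = 0") (auto simp: simple_integrand_def)
qed

text \<open>The clamped points \<open>u\<close> cut the partition down to \<open>{s..t}\<close>. At each time at most one step of the simple
process is active, so that the square of the sum is the sum of the squares.\<close>

lemma simple_process_energy:
  fixes s t :: real
  assumes S: "simple_integrand M F (n, \<tau>, \<eta>)"
  defines "u \<equiv> \<lambda>i. max s (min t (\<tau> i))"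
  shows "ennreal (\<Sum>i<n. (norm (\<eta> i \<omega>))\<^sup>2 * (u (Suc i) - u i))
    \<le> (\<integral>\<^sup>+ r\<in>{s<..t}. ennreal ((norm (simple_process (n, \<tau>, \<eta>) r \<omega>))\<^sup>2) \<partial>lborel)"
proof -
  have mono: "u i \<le> u (Suc i)" if "i < n" for i
    using simple_integrand_partition(1)[OF S, of i "Suc i"] that unfolding u_def by (auto simp: max_def min_def)
  have sub: "r \<in> {\<tau> i<..\<tau> (Suc i)} \<and> r \<in> {s<..t}" if "r \<in> {u i<..u (Suc i)}" for r i
    using that unfolding u_def by (auto simp: max_def min_def split: if_splits)
  have "ennreal (\<Sum>i<n. (norm (\<eta> i \<omega>))\<^sup>2 * (u (Suc i) - u i))
      = (\<Sum>i<n. ennreal ((norm (\<eta> i \<omega>))\<^sup>2) * ennreal (u (Suc i) - u i))"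
    using mono by (subst sum_ennreal[symmetric]) (auto simp: ennreal_mult intro!: sum.cong)
  also have "\<dots> = (\<Sum>i<n. \<integral>\<^sup>+ r. ennreal ((norm (\<eta> i \<omega>))\<^sup>2) * indicator {u i<..u (Suc i)} r \<partial>lborel)"
    using mono by (intro sum.cong refl) (simp add: nn_integral_cmult_indicator)
  also have "\<dots> = (\<integral>\<^sup>+ r. (\<Sum>i<n. ennreal ((norm (\<eta> i \<omega>))\<^sup>2) * indicator {u i<..u (Suc i)} r) \<partial>lborel)"
    by (rule nn_integral_sum[symmetric]) auto
  also have "\<dots> \<le> (\<integral>\<^sup>+ r\<in>{s<..t}. ennreal ((norm (simple_process (n, \<tau>, \<eta>) r \<omega>))\<^sup>2) \<partial>lborel)"
  proof (rule nn_integral_mono)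
    fix r
    show "(\<Sum>i<n. ennreal ((norm (\<eta> i \<omega>))\<^sup>2) * indicator {u i<..u (Suc i)} r)
        \<le> ennreal ((norm (simple_process (n, \<tau>, \<eta>) r \<omega>))\<^sup>2) * indicator {s<..t} r"
    proof (cases "\<exists>i<n. r \<in> {u i<..u (Suc i)}")
      case False
      then have "(\<Sum>i<n. ennreal ((norm (\<eta> i \<omega>))\<^sup>2) * indicator {u i<..u (Suc i)} r) = 0"
        by (intro sum.neutral) auto
      then show ?thesis by simp
    next
      case True
      then obtain k where k: "k < n" "r \<in> {u k<..u (Suc k)}" by blast
      have other: "r \<notin> {\<tau> i<..\<tau> (Suc i)}" if "i < n" "i \<noteq> k" for i
      proof -
        consider "Suc i \<le> k" | "Suc k \<le> i" using \<open>i \<noteq> k\<close> by linarith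
        then show ?thesis
          using simple_integrand_partition(1)[OF S, of "Suc i" k] simple_integrand_partition(1)[OF S, of "Suc k" i]
            sub[OF k(2)] k(1) that by cases auto
      qed
      have "(\<Sum>i<n. ennreal ((norm (\<eta> i \<omega>))\<^sup>2) * indicator {u i<..u (Suc i)} r)
          = (\<Sum>i<n. if i = k then ennreal ((norm (\<eta> k \<omega>))\<^sup>2) else 0)"
        using other sub k by (intro sum.cong refl) (force split: split_indicator)
      moreover have "simple_process (n, \<tau>, \<eta>) r \<omega> = (\<Sum>i<n. if i = k then \<eta> k \<omega> else 0)"
        unfolding simple_process_def prod.case
        using other sub[OF k(2)] by (intro sum.cong refl) (auto split: split_indicator)
      ultimately show ?thesis using k sub[OF k(2)] by simp
    qed
  qed
  finally show ?thesis .
qed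

lemma simple_ito_increment:
  fixes W :: "real \<Rightarrow> 'w \<Rightarrow> real ^ 'm::finite" and \<eta> :: "nat \<Rightarrow> 'w \<Rightarrow> real ^ 'm ^ 'd::finite"
  assumes "s < t"
  shows "simple_ito W (n, \<tau>, \<eta>) t \<omega> - simple_ito W (n, \<tau>, \<eta>) s \<omega>
    = (\<Sum>i<n. \<eta> i \<omega> *v (W (max s (min t (\<tau> (Suc i)))) \<omega> - W (max s (min t (\<tau> i))) \<omega>))"
proof -
  have "W (max s (min t a)) \<omega> = W (min t a) \<omega> + W s \<omega> - W (min s a) \<omega>" for a
    using assms by (cases "a \<le> s") (auto simp: min_def max_def)
  then have "W (max s (min t b)) \<omega> - W (max s (min t a)) \<omega>
      = (W (min t b) \<omega> - W (min t a) \<omega>) - (W (min s b) \<omega> - W (min s a) \<omega>)" for a b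
    by simp
  then show ?thesis
    unfolding simple_ito_def prod.case sum_subtractf[symmetric]
    by (simp only: matrix_vector_mult_diff_distrib[symmetric])
qed

context stochastic_basis begin

text \<open>The simple integrands that approximate an integrand in probability need not be bounded in \<open>L\<^sup>2\<close>. They
are therefore switched off as soon as their energy on \<open>{s..t}\<close>, the present interval included,
exceeds \<open>C\<close>. That energy is known at the left endpoint of the interval, so that the truncated
integrand is again simple. Its energy is at most \<open>C\<close> on every path, which bounds second moments,
while paths of total energy at most \<open>C\<close> are left unchanged.\<close>

lemma truncated_simple_ito:
  fixes W :: "real \<Rightarrow> 'w \<Rightarrow> real ^ 'm" and \<eta> :: "nat \<Rightarrow> 'w \<Rightarrow> real ^ 'm ^ 'd"
  assumes W: "brownian_motion M F W" and S: "simple_integrand M F (n, \<tau>, \<eta>)"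
    and st: "0 \<le> s" "s < t" and "0 \<le> C"
  defines "u \<equiv> \<lambda>i. max s (min t (\<tau> i))"
  obtains D where "centred_given s (real CARD('m) * C) D"
    and "\<And>\<omega>. (\<Sum>i<n. (norm (\<eta> i \<omega>))\<^sup>2 * (u (Suc i) - u i)) \<le> C \<Longrightarrow>
        D \<omega> = simple_ito W (n, \<tau>, \<eta>) t \<omega> - simple_ito W (n, \<tau>, \<eta>) s \<omega>"
proof -
  define q where "q k \<omega> = (\<Sum>i<k. (norm (\<eta> i \<omega>))\<^sup>2 * (u (Suc i) - u i))" for k \<omega>
  \<comment> \<open>the condition \<open>\<tau> i < t\<close> makes \<open>\<theta> i\<close> known at the clamped time \<open>u i\<close>; the increments it removes vanish\<close>
  define \<theta> where "\<theta> i \<omega> = (if \<tau> i < t \<and> q (Suc i) \<omega> \<le> C then \<eta> i \<omega> else 0)" for i \<omega>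
  define D where "D \<omega> = (\<Sum>i<n. \<theta> i \<omega> *v (W (u (Suc i)) \<omega> - W (u i) \<omega>))" for \<omega>
  have J: "L2_martingale (\<lambda>t. real CARD('m) * t) W" by (rule brownian_motion_L2_martingale[OF W])
  have u0: "0 \<le> u i" and us: "s \<le> u i" for i using st by (auto simp: u_def)
  have umono: "u i \<le> u (Suc i)" if "i < n" for i
    using simple_integrand_partition(1)[OF S, of i "Suc i"] that unfolding u_def by (auto simp: max_def min_def)
  have Wm[measurable]: "W (u i) \<in> borel_measurable M" for i by (rule L2_martingale_measurable_M[OF J u0])
  have \<theta>F: "\<theta> i \<in> borel_measurable (F (u i))" if "i < n" for i
  proof (cases "\<tau> i < t")
    case True
    then have "\<tau> i \<le> u i" by (simp add: u_def)
    have *: "\<eta> j \<in> borel_measurable (F (u i))" if "j \<le> i" for j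
    proof -
      have "\<eta> j \<in> borel_measurable (F (\<tau> j))" using S \<open>i < n\<close> that by (simp add: simple_integrand_def)
      moreover have "\<tau> j \<le> u i"
        using simple_integrand_partition(1)[OF S that] \<open>i < n\<close> \<open>\<tau> i \<le> u i\<close> by simp
      ultimately show ?thesis by (rule measurable_F_mono[rotated])
    qed
    have [measurable]: "\<eta> i \<in> borel_measurable (F (u i))" by (rule *) simp
    have [measurable]: "q (Suc i) \<in> borel_measurable (F (u i))"
      unfolding q_def using * by (intro borel_measurable_sum borel_measurable_times borel_measurable_power borel_measurable_norm) auto
    show ?thesis unfolding \<theta>_def by measurable
  qed (simp add: \<theta>_def[abs_def])
  have \<theta>M[measurable]: "\<theta> i \<in> borel_measurable M" if "i < n" for i
    using measurable_F_M[OF u0 \<theta>F[OF that]] .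
  have \<theta>b: "\<exists>b. \<forall>\<omega>\<in>space M. norm (\<theta> i \<omega>) \<le> b" if "i < n" for i
  proof -
    obtain b where b: "\<forall>\<omega>\<in>space M. norm (\<eta> i \<omega>) \<le> b" using S \<open>i < n\<close> unfolding simple_integrand_def prod.case by blast
    have "norm (\<theta> i \<omega>) \<le> \<bar>b\<bar>" if "\<omega> \<in> space M" for \<omega>
      using b that by (auto simp: \<theta>_def intro: order_trans[OF _ abs_ge_self])
    then show ?thesis by blast
  qed
  have energy: "(\<Sum>i<n. (norm (\<theta> i \<omega>))\<^sup>2 * (u (Suc i) - u i)) \<le> C" for \<omega>
  proof -
    have "(\<Sum>i<k. (norm (\<theta> i \<omega>))\<^sup>2 * (u (Suc i) - u i)) \<le> min C (q k \<omega>)" if "k \<le> n" for k using that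
    proof (induction k)
      case (Suc k)
      have "0 \<le> (norm (\<eta> k \<omega>))\<^sup>2 * (u (Suc k) - u k)" using umono[of k] Suc.prems by simp
      moreover have "q (Suc k) \<omega> = q k \<omega> + (norm (\<eta> k \<omega>))\<^sup>2 * (u (Suc k) - u k)" by (simp add: q_def)
      ultimately show ?case using Suc by (auto simp: \<theta>_def)
    qed (simp add: q_def \<open>0 \<le> C\<close>)
    from this[of n] show ?thesis by simp
  qed
  have Dl: "D \<omega> $ l = (\<Sum>i<n. (\<theta> i \<omega> $ l) \<bullet> (W (u (Suc i)) \<omega> - W (u i) \<omega>))" for \<omega> l
    by (simp add: D_def matrix_vector_mul_component)
  have rowF: "(\<lambda>\<omega>. \<theta> i \<omega> $ l) \<in> borel_measurable (F (u i))" if "i < n" for i l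
    by (rule measurable_compose[OF \<theta>F[OF that]]) (intro borel_measurable_continuous_onI continuous_intros)
  have rowM[measurable]: "(\<lambda>\<omega>. \<theta> i \<omega> $ l) \<in> borel_measurable M" if "i < n" for i l
    using measurable_F_M[OF u0 rowF[OF that]] .
  have row_le: "norm (\<theta> i \<omega> $ l) \<le> norm (\<theta> i \<omega>)" for i \<omega> l by (rule Finite_Cartesian_Product.norm_nth_le)
  have DlM[measurable]: "(\<lambda>\<omega>. D \<omega> $ l) \<in> borel_measurable M" for l
    unfolding Dl by (intro borel_measurable_sum borel_measurable_inner borel_measurable_diff rowM Wm) auto
  have DM: "D \<in> borel_measurable M"
    by (rule iffD2[OF borel_measurable_euclidean_space]) (auto simp: Basis_vec_def inner_axis)
  \<comment> \<open>weights that are square integrable and known at time \<open>s\<close> may be absorbed into the integrand\<close>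
  have transform: "integrable M (\<lambda>\<omega>. (c \<omega> * D \<omega> $ l)\<^sup>2) \<and> (\<integral>\<omega>. c \<omega> * D \<omega> $ l \<partial>M) = 0 \<and>
      (\<integral>\<omega>. (c \<omega> * D \<omega> $ l)\<^sup>2 \<partial>M)
        \<le> (\<Sum>i<n. (\<integral>\<omega>. (c \<omega>)\<^sup>2 * (norm (\<theta> i \<omega> $ l))\<^sup>2 \<partial>M) * (real CARD('m) * (u (Suc i) - u i))) \<and>
      (\<forall>i<n. integrable M (\<lambda>\<omega>. (c \<omega>)\<^sup>2 * (norm (\<theta> i \<omega> $ l))\<^sup>2))"
    if c: "c \<in> borel_measurable (F s)" "integrable M (\<lambda>\<omega>. (c \<omega>)\<^sup>2)" for c :: "'w \<Rightarrow> real" and l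
  proof -
    have [measurable]: "c \<in> borel_measurable M" by (rule measurable_F_M[OF st(1) c(1)])
    define v where "v i \<omega> = c \<omega> *\<^sub>R (\<theta> i \<omega> $ l)" for i \<omega>
    have vF: "v i \<in> borel_measurable (F (u i))" if "i < n" for i
      unfolding v_def using measurable_F_mono[OF us c(1)] rowF[OF that] by (intro borel_measurable_scaleR)
    have v2: "(norm (v i \<omega>))\<^sup>2 = (c \<omega>)\<^sup>2 * (norm (\<theta> i \<omega> $ l))\<^sup>2" for i \<omega>
      by (simp add: v_def power_mult_distrib)
    have vint: "integrable M (\<lambda>\<omega>. (norm (v i \<omega>))\<^sup>2)" if "i < n" for i
    proof -
      obtain b where b: "\<And>\<omega>. \<omega> \<in> space M \<Longrightarrow> norm (\<theta> i \<omega>) \<le> b" using \<theta>b[OF \<open>i < n\<close>] by blast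
      show ?thesis
        unfolding v2
      proof (rule Bochner_Integration.integrable_bound)
        show "integrable M (\<lambda>\<omega>. (c \<omega>)\<^sup>2 * b\<^sup>2)" using c(2) by simp
        show "AE \<omega> in M. norm ((c \<omega>)\<^sup>2 * (norm (\<theta> i \<omega> $ l))\<^sup>2) \<le> norm ((c \<omega>)\<^sup>2 * b\<^sup>2)"
        proof (rule AE_I2)
          fix \<omega> assume "\<omega> \<in> space M"
          then have "norm (\<theta> i \<omega> $ l) \<le> b" using row_le b order_trans by blast
          then have "(norm (\<theta> i \<omega> $ l))\<^sup>2 \<le> b\<^sup>2" by (intro power_mono) auto
          then have "(c \<omega>)\<^sup>2 * (norm (\<theta> i \<omega> $ l))\<^sup>2 \<le> (c \<omega>)\<^sup>2 * b\<^sup>2" by (intro mult_left_mono) auto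
          then show "norm ((c \<omega>)\<^sup>2 * (norm (\<theta> i \<omega> $ l))\<^sup>2) \<le> norm ((c \<omega>)\<^sup>2 * b\<^sup>2)" by simp
        qed
      qed (use rowM[OF that] in measurable)
    qed
    have cD: "c \<omega> * D \<omega> $ l = (\<Sum>i<n. v i \<omega> \<bullet> (W (u (Suc i)) \<omega> - W (u i) \<omega>))" for \<omega>
      by (simp add: Dl v_def sum_distrib_left)
    note T = martingale_transform[OF J, of n u v, OF u0 umono vF vint]
    show ?thesis using T(2-4) vint unfolding cD[symmetric] v2 by (simp add: right_diff_distrib)
  qed
  have "centred_given s (real CARD('m) * C) D"
    unfolding centred_given_def
  proof (intro conjI ballI allI impI DM)
    fix v :: "'w \<Rightarrow> real ^ 'd" assume v: "v \<in> borel_measurable (F s)" "\<exists>b. \<forall>\<omega>. norm (v \<omega>) \<le> b"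
    then obtain b where b: "\<And>\<omega>. norm (v \<omega>) \<le> b" by blast
    have vl: "(\<lambda>\<omega>. v \<omega> $ l) \<in> borel_measurable (F s)" for l
      by (rule measurable_compose[OF v(1)]) simp
    have "\<bar>v \<omega> $ l\<bar> \<le> b" for \<omega> l using component_le_norm_cart b order_trans by blast
    then have "(v \<omega> $ l)\<^sup>2 \<le> b\<^sup>2" for \<omega> l by (metis abs_ge_zero power2_abs power_mono)
    then have "integrable M (\<lambda>\<omega>. (v \<omega> $ l)\<^sup>2)" for l
      using measurable_F_M[OF st(1) vl] by (intro integrable_const_bound[of _ "b\<^sup>2"]) auto
    note tr = transform[OF vl this]
    have int: "integrable M (\<lambda>\<omega>. v \<omega> $ l * D \<omega> $ l)" for l
      using tr[of l l] measurable_F_M[OF st(1) vl, of l] by (auto intro!: square_integrable_imp_integrable)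
    have "(\<integral>\<omega>. v \<omega> \<bullet> D \<omega> \<partial>M) = (\<Sum>l\<in>UNIV. \<integral>\<omega>. v \<omega> $ l * D \<omega> $ l \<partial>M)"
      unfolding inner_vec_def using int by simp
    also have "\<dots> = 0" using tr by simp
    finally show "(\<integral>\<omega>. v \<omega> \<bullet> D \<omega> \<partial>M) = 0" .
  next
    fix g :: "'w \<Rightarrow> real" assume g: "g \<in> borel_measurable (F s)" "\<forall>\<omega>. 0 \<le> g \<omega>" "integrable M g"
    have sg: "(\<lambda>\<omega>. sqrt (g \<omega>)) \<in> borel_measurable (F s)" using g(1) by measurable
    have sg2: "(sqrt (g \<omega>))\<^sup>2 = g \<omega>" for \<omega> using g(2) by simp
    note tr = transform[OF sg, unfolded sg2 power_mult_distrib, OF g(3)]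
    have n2: "(norm x)\<^sup>2 = (\<Sum>l\<in>UNIV. (x $ l)\<^sup>2)" for x :: "real ^ 'd"
      unfolding power2_norm_eq_inner by (simp add: inner_vec_def power2_eq_square)
    have N2: "(norm x)\<^sup>2 = (\<Sum>l\<in>UNIV. (norm (x $ l))\<^sup>2)" for x :: "real ^ 'm ^ 'd"
      by (simp add: norm_vec_def L2_set_def sum_nonneg)
    have gD: "g \<omega> * (norm (D \<omega>))\<^sup>2 = (\<Sum>l\<in>UNIV. g \<omega> * (D \<omega> $ l)\<^sup>2)" for \<omega>
      by (simp add: n2 sum_distrib_left)
    show "integrable M (\<lambda>\<omega>. g \<omega> * (norm (D \<omega>))\<^sup>2)" unfolding gD using tr by auto
    have \<theta>int: "integrable M (\<lambda>\<omega>. g \<omega> * (norm (\<theta> i \<omega>))\<^sup>2)" if "i < n" for i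
      unfolding N2 sum_distrib_left using tr that by auto
    have "(\<integral>\<omega>. g \<omega> * (norm (D \<omega>))\<^sup>2 \<partial>M) = (\<Sum>l\<in>UNIV. \<integral>\<omega>. g \<omega> * (D \<omega> $ l)\<^sup>2 \<partial>M)"
      unfolding gD using tr by simp
    also have "\<dots> \<le> (\<Sum>l\<in>UNIV. \<Sum>i<n. (\<integral>\<omega>. g \<omega> * (norm (\<theta> i \<omega> $ l))\<^sup>2 \<partial>M) * (real CARD('m) * (u (Suc i) - u i)))"
      using tr by (intro sum_mono) auto
    also have "\<dots> = (\<Sum>i<n. (\<Sum>l\<in>UNIV. \<integral>\<omega>. g \<omega> * (norm (\<theta> i \<omega> $ l))\<^sup>2 \<partial>M) * (real CARD('m) * (u (Suc i) - u i)))"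
      by (subst sum.swap) (simp add: sum_distrib_right)
    also have "\<dots> = (\<Sum>i<n. (\<integral>\<omega>. g \<omega> * (norm (\<theta> i \<omega>))\<^sup>2 \<partial>M) * (real CARD('m) * (u (Suc i) - u i)))"
      using tr unfolding N2 sum_distrib_left
      by (intro sum.cong refl arg_cong2[where f = "(*)"] Bochner_Integration.integral_sum[symmetric]) auto
    also have "\<dots> = (\<integral>\<omega>. (\<Sum>i<n. g \<omega> * (norm (\<theta> i \<omega>))\<^sup>2 * (real CARD('m) * (u (Suc i) - u i))) \<partial>M)"
      using \<theta>int by (subst Bochner_Integration.integral_sum) auto
    also have "\<dots> \<le> (\<integral>\<omega>. g \<omega> * (real CARD('m) * C) \<partial>M)"
    proof (rule integral_mono)
      show "integrable M (\<lambda>\<omega>. \<Sum>i<n. g \<omega> * (norm (\<theta> i \<omega>))\<^sup>2 * (real CARD('m) * (u (Suc i) - u i)))"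
        using \<theta>int by auto
      show "integrable M (\<lambda>\<omega>. g \<omega> * (real CARD('m) * C))" using g(3) by simp
      fix \<omega>
      have "(\<Sum>i<n. g \<omega> * (norm (\<theta> i \<omega>))\<^sup>2 * (real CARD('m) * (u (Suc i) - u i)))
          = g \<omega> * (real CARD('m) * (\<Sum>i<n. (norm (\<theta> i \<omega>))\<^sup>2 * (u (Suc i) - u i)))"
        by (simp add: sum_distrib_left mult_ac)
      also have "\<dots> \<le> g \<omega> * (real CARD('m) * C)" using energy g(2) by (intro mult_left_mono) auto
      finally show "(\<Sum>i<n. g \<omega> * (norm (\<theta> i \<omega>))\<^sup>2 * (real CARD('m) * (u (Suc i) - u i)))
          \<le> g \<omega> * (real CARD('m) * C)" .
    qed
    also have "\<dots> = real CARD('m) * C * (\<integral>\<omega>. g \<omega> \<partial>M)" by simp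
    finally show "(\<integral>\<omega>. g \<omega> * (norm (D \<omega>))\<^sup>2 \<partial>M) \<le> real CARD('m) * C * (\<integral>\<omega>. g \<omega> \<partial>M)" .
  qed
  then show ?thesis
  proof (rule that)
    fix \<omega> assume "(\<Sum>i<n. (norm (\<eta> i \<omega>))\<^sup>2 * (u (Suc i) - u i)) \<le> C"
    then have qn: "q n \<omega> \<le> C" by (simp add: q_def)
    have q_le: "q (Suc i) \<omega> \<le> q n \<omega>" if "i < n" for i
      unfolding q_def using that umono by (intro sum_mono2) (auto intro!: mult_nonneg_nonneg)
    have "\<theta> i \<omega> *v (W (u (Suc i)) \<omega> - W (u i) \<omega>) = \<eta> i \<omega> *v (W (u (Suc i)) \<omega> - W (u i) \<omega>)"
      if "i < n" for i
    proof (cases "\<tau> i < t")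
      case True
      then show ?thesis using qn q_le[OF \<open>i < n\<close>] by (auto simp: \<theta>_def)
    next
      case False
      then have "u i = t" "u (Suc i) = t"
        using simple_integrand_partition(1)[OF S, of i "Suc i"] that st by (auto simp: u_def)
      then show ?thesis by simp
    qed
    then show "D \<omega> = simple_ito W (n, \<tau>, \<eta>) t \<omega> - simple_ito W (n, \<tau>, \<eta>) s \<omega>"
      unfolding simple_ito_increment[OF st(2)] D_def u_def by (intro sum.cong) auto
  qed
qed

end

section \<open>Ito integrals of integrands with bounded energy\<close>

lemma section_borel_measurable:
  fixes H :: "real \<Rightarrow> 'w \<Rightarrow> 'b::real_normed_vector"
  assumes "progressively_measurable F H" "0 \<le> T" "\<omega> \<in> space (F T)"
  shows "(\<lambda>r. H r \<omega>) \<in> borel_measurable (restrict_space borel {0..T})"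
proof -
  have "(\<lambda>(r, \<omega>). H r \<omega>) \<in> borel_measurable (restrict_space borel {0..T} \<Otimes>\<^sub>M F T)"
    using assms(1,2) unfolding progressively_measurable_def by blast
  from measurable_compose[OF measurable_Pair2'[OF assms(3)] this] show ?thesis by simp
qed

text \<open>This is the triangle inequality in \<open>L\<^sup>2\<close>, written with squares by means of
\<open>(p + q)\<^sup>2 \<le> (1 + \<theta>) p\<^sup>2 + (1 + 1 / \<theta>) q\<^sup>2\<close>.\<close>

lemma energy_perturbation:
  fixes H G :: "real \<Rightarrow> 'b::{real_normed_vector, second_countable_topology}"
  assumes st: "0 \<le> s" "s < t"
    and H: "H \<in> borel_measurable (restrict_space borel {0..t})"
    and G: "G \<in> borel_measurable (restrict_space borel {0..t})"
    and a: "(\<integral>\<^sup>+ r\<in>{s<..t}. ennreal ((norm (H r))\<^sup>2) \<partial>lborel) \<le> ennreal a" "0 \<le> a"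
    and e: "(\<integral>\<^sup>+ r\<in>{0..t}. ennreal ((norm (G r - H r))\<^sup>2) \<partial>lborel) \<le> ennreal e" "0 \<le> e"
    and "0 < \<theta>"
  shows "(\<integral>\<^sup>+ r\<in>{s<..t}. ennreal ((norm (G r))\<^sup>2) \<partial>lborel) \<le> ennreal ((1 + \<theta>) * a + (1 + 1 / \<theta>) * e)"
proof -
  have sub: "{s<..t} \<subseteq> {0..t}" using st by auto
  have res: "(\<lambda>r. f r * indicator {s<..t} r) \<in> borel_measurable lborel"
    if "f \<in> borel_measurable (restrict_space borel {0..t})" for f :: "real \<Rightarrow> ennreal"
  proof -
    have "f \<in> borel_measurable (restrict_space borel {s<..t})"
      using measurable_restrict_mono[OF that sub] by simp
    then show ?thesis by (subst (asm) borel_measurable_restrict_space_iff_ennreal) auto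
  qed
  have Hm: "(\<lambda>r. ennreal ((norm (H r))\<^sup>2) * indicator {s<..t} r) \<in> borel_measurable lborel"
    using H by (intro res) measurable
  have Dm: "(\<lambda>r. ennreal ((norm (G r - H r))\<^sup>2) * indicator {s<..t} r) \<in> borel_measurable lborel"
    using H G by (intro res) measurable
  have pt: "(norm x)\<^sup>2 \<le> (1 + \<theta>) * (norm y)\<^sup>2 + (1 + 1 / \<theta>) * (norm (x - y))\<^sup>2" for x y :: 'b
  proof -
    let ?p = "norm y" and ?q = "norm (x - y)"
    have "norm x \<le> ?p + ?q" by (metis norm_triangle_sub)
    then have "(norm x)\<^sup>2 \<le> (?p + ?q)\<^sup>2" by (intro power_mono) auto
    also have "\<dots> = (1 + \<theta>) * ?p\<^sup>2 + (1 + 1 / \<theta>) * ?q\<^sup>2 - (\<theta> * ?p - ?q)\<^sup>2 / \<theta>"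
      using \<open>0 < \<theta>\<close> by (simp add: power2_eq_square field_simps)
    also have "\<dots> \<le> (1 + \<theta>) * ?p\<^sup>2 + (1 + 1 / \<theta>) * ?q\<^sup>2" using \<open>0 < \<theta>\<close> by simp
    finally show ?thesis .
  qed
  have "(\<integral>\<^sup>+ r\<in>{s<..t}. ennreal ((norm (G r))\<^sup>2) \<partial>lborel)
      \<le> (\<integral>\<^sup>+ r. ennreal (1 + \<theta>) * (ennreal ((norm (H r))\<^sup>2) * indicator {s<..t} r)
        + ennreal (1 + 1 / \<theta>) * (ennreal ((norm (G r - H r))\<^sup>2) * indicator {s<..t} r) \<partial>lborel)"
  proof (rule nn_integral_mono)
    fix r
    show "ennreal ((norm (G r))\<^sup>2) * indicator {s<..t} r
      \<le> ennreal (1 + \<theta>) * (ennreal ((norm (H r))\<^sup>2) * indicator {s<..t} r)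
        + ennreal (1 + 1 / \<theta>) * (ennreal ((norm (G r - H r))\<^sup>2) * indicator {s<..t} r)"
      using pt[of "G r" "H r"] \<open>0 < \<theta>\<close>
      by (auto simp: ennreal_mult[symmetric] ennreal_plus[symmetric] split: split_indicator simp del: ennreal_plus)
  qed
  also have "\<dots> = ennreal (1 + \<theta>) * (\<integral>\<^sup>+ r\<in>{s<..t}. ennreal ((norm (H r))\<^sup>2) \<partial>lborel)
      + ennreal (1 + 1 / \<theta>) * (\<integral>\<^sup>+ r\<in>{s<..t}. ennreal ((norm (G r - H r))\<^sup>2) \<partial>lborel)"
    using Hm Dm by (subst nn_integral_add) (auto simp: nn_integral_cmult)
  also have "\<dots> \<le> ennreal (1 + \<theta>) * ennreal a + ennreal (1 + 1 / \<theta>) * ennreal e"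
  proof (intro add_mono mult_left_mono a(1))
    have "(\<integral>\<^sup>+ r\<in>{s<..t}. ennreal ((norm (G r - H r))\<^sup>2) \<partial>lborel)
        \<le> (\<integral>\<^sup>+ r\<in>{0..t}. ennreal ((norm (G r - H r))\<^sup>2) \<partial>lborel)"
      using sub by (intro nn_integral_mono) (auto split: split_indicator)
    with e(1) show "(\<integral>\<^sup>+ r\<in>{s<..t}. ennreal ((norm (G r - H r))\<^sup>2) \<partial>lborel) \<le> ennreal e" by simp
  qed auto
  also have "\<dots> = ennreal ((1 + \<theta>) * a + (1 + 1 / \<theta>) * e)"
    using \<open>0 < \<theta>\<close> a(2) e(2) by (simp add: ennreal_mult ennreal_plus)
  finally show ?thesis .
qed

context stochastic_basis begin

text \<open>The simple integrands of the definition are truncated at the energy \<open>a + \<eta>\<close>. Wherever such an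
integrand is close to \<open>H\<close> in \<open>L\<^sup>2(0,t)\<close>, its energy on \<open>{s..t}\<close> stays below this level, and the truncation
does nothing. As this happens with probability tending to 1, convergence in probability survives.\<close>

lemma ito_increment_approximation:
  fixes W :: "real \<Rightarrow> 'w \<Rightarrow> real ^ 'm" and H :: "real \<Rightarrow> 'w \<Rightarrow> real ^ 'm ^ 'd" and I :: "real \<Rightarrow> 'w \<Rightarrow> real ^ 'd"
  assumes W: "brownian_motion M F W" and I: "ito_integral M F W H I"
    and st: "0 \<le> s" "s < t" and "0 \<le> a" "0 < \<eta>"
    and H: "\<And>\<omega>. \<omega> \<in> space M \<Longrightarrow> (\<integral>\<^sup>+ r\<in>{s<..t}. ennreal ((norm (H r \<omega>))\<^sup>2) \<partial>lborel) \<le> ennreal a"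
  obtains D where "\<And>k::nat. centred_given s (real CARD('m) * (a + \<eta>)) (D k)"
    and "\<And>\<epsilon>. 0 < \<epsilon> \<Longrightarrow> (\<lambda>k. prob {\<omega> \<in> space M. \<epsilon> < norm (D k \<omega> - (I t \<omega> - I s \<omega>))}) \<longlonglongrightarrow> 0"
proof -
  have "0 < t" using st by simp
  define Z where "Z S \<omega> = (\<integral>\<^sup>+ r\<in>{0..t}. ennreal ((norm (simple_process S r \<omega> - H r \<omega>))\<^sup>2) \<partial>lborel)"
    for S :: "('w, 'm, 'd) simple_data" and \<omega>
  define R where "R S \<omega> = (SUP r\<in>{0..t}. ennreal (norm (simple_ito W S r \<omega> - I r \<omega>)))"
    for S :: "('w, 'm, 'd) simple_data" and \<omega>
  obtain S where S: "\<And>k. simple_integrand M F (S k)"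
    "null_in_probability M (\<lambda>k. Z (S k))" "null_in_probability M (\<lambda>k. R (S k))"
    using I \<open>0 < t\<close> unfolding ito_integral_def Z_def R_def by blast
  have prog: "progressively_measurable F H" using I by (simp add: ito_integral_def)
  \<comment> \<open>\<open>\<theta>\<close> and \<open>e\<close> split the surplus energy \<open>\<eta>\<close> of \<open>energy_perturbation\<close> into two halves\<close>
  define \<theta> where "\<theta> = \<eta> / (2 * (a + 1))"
  have \<theta>: "0 < \<theta>" "\<theta> * a \<le> \<eta> / 2"
    using \<open>0 \<le> a\<close> \<open>0 < \<eta>\<close> by (auto simp: \<theta>_def field_simps)
  define e where "e = \<eta> / (2 * (1 + 1 / \<theta>))"
  have e: "0 < e" "(1 + 1 / \<theta>) * e = \<eta> / 2"
  proof -
    have "0 < 1 + 1 / \<theta>" using \<theta>(1) by (simp add: add_pos_pos)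
    then show "0 < e" "(1 + 1 / \<theta>) * e = \<eta> / 2" using \<open>0 < \<eta>\<close> by (simp_all only: e_def) (auto simp: field_simps)
  qed
  have bound: "(1 + \<theta>) * a + (1 + 1 / \<theta>) * e \<le> a + \<eta>" using \<theta> e(2) by (simp add: distrib_right)
  have "\<exists>D. centred_given s (real CARD('m) * (a + \<eta>)) D \<and>
      (\<forall>\<omega>\<in>space M. Z (S k) \<omega> \<le> ennreal e \<longrightarrow> D \<omega> = simple_ito W (S k) t \<omega> - simple_ito W (S k) s \<omega>)" for k
  proof -
    obtain n \<tau> \<eta>' where Sk: "S k = (n, \<tau>, \<eta>')" by (cases "S k") auto
    have si: "simple_integrand M F (n, \<tau>, \<eta>')" using S(1)[of k] Sk by simp
    have a\<eta>: "0 \<le> a + \<eta>" using \<open>0 \<le> a\<close> \<open>0 < \<eta>\<close> by simp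
    obtain D where D: "centred_given s (real CARD('m) * (a + \<eta>)) D"
      "\<And>\<omega>. (\<Sum>i<n. (norm (\<eta>' i \<omega>))\<^sup>2 * (max s (min t (\<tau> (Suc i))) - max s (min t (\<tau> i)))) \<le> a + \<eta> \<Longrightarrow>
        D \<omega> = simple_ito W (n, \<tau>, \<eta>') t \<omega> - simple_ito W (n, \<tau>, \<eta>') s \<omega>"
      by (rule truncated_simple_ito[OF W si st a\<eta>]) blast
    have "D \<omega> = simple_ito W (S k) t \<omega> - simple_ito W (S k) s \<omega>"
      if \<omega>: "\<omega> \<in> space M" and Z: "Z (S k) \<omega> \<le> ennreal e" for \<omega>
    proof -
      have "ennreal (\<Sum>i<n. (norm (\<eta>' i \<omega>))\<^sup>2 * (max s (min t (\<tau> (Suc i))) - max s (min t (\<tau> i))))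
        \<le> (\<integral>\<^sup>+ r\<in>{s<..t}. ennreal ((norm (simple_process (S k) r \<omega>))\<^sup>2) \<partial>lborel)"
        unfolding Sk by (rule simple_process_energy[OF si])
      also have "\<dots> \<le> ennreal ((1 + \<theta>) * a + (1 + 1 / \<theta>) * e)"
      proof (rule energy_perturbation[where H = "\<lambda>r. H r \<omega>" and G = "\<lambda>r. simple_process (S k) r \<omega>",
            OF st _ _ H[OF \<omega>] \<open>0 \<le> a\<close> _ _ \<theta>(1)])
        show "(\<lambda>r. H r \<omega>) \<in> borel_measurable (restrict_space borel {0..t})"
          using section_borel_measurable[OF prog, of t \<omega>] \<open>0 < t\<close> \<omega> by (simp add: space_F)
        have "(\<lambda>r. simple_process (S k) r \<omega>) \<in> borel_measurable borel"
          unfolding Sk simple_process_def prod.case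
          by (intro borel_measurable_sum borel_measurable_scaleR borel_measurable_indicator borel_measurable_const) auto
        then show "(\<lambda>r. simple_process (S k) r \<omega>) \<in> borel_measurable (restrict_space borel {0..t})"
          by (rule measurable_restrict_space1)
      qed (use Z e in \<open>auto simp: Z_def\<close>)
      also have "\<dots> \<le> ennreal (a + \<eta>)" using bound by (rule ennreal_leI)
      finally show ?thesis
        unfolding Sk using a\<eta> by (intro D(2)) (simp add: ennreal_le_iff)
    qed
    with D(1) show ?thesis by blast
  qed
  then obtain D where D: "\<And>k. centred_given s (real CARD('m) * (a + \<eta>)) (D k)"
      "\<And>k \<omega>. \<omega> \<in> space M \<Longrightarrow> Z (S k) \<omega> \<le> ennreal e \<Longrightarrow>
        D k \<omega> = simple_ito W (S k) t \<omega> - simple_ito W (S k) s \<omega>"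
    by metis
  show ?thesis
  proof (rule that[OF D(1)])
    fix \<epsilon> :: real assume "0 < \<epsilon>"
    let ?P = "\<lambda>k. prob {\<omega> \<in> space M. ennreal e < Z (S k) \<omega>}"
    let ?Q = "\<lambda>k. prob {\<omega> \<in> space M. ennreal (\<epsilon> / 2) < R (S k) \<omega>}"
    have [measurable]: "Z (S k) \<in> borel_measurable M" "R (S k) \<in> borel_measurable M" for k
      using S(2,3) by (auto simp: null_in_probability_def)
    have le: "prob {\<omega> \<in> space M. \<epsilon> < norm (D k \<omega> - (I t \<omega> - I s \<omega>))} \<le> ?P k + ?Q k" for k
    proof -
      have "{\<omega> \<in> space M. \<epsilon> < norm (D k \<omega> - (I t \<omega> - I s \<omega>))}
        \<subseteq> {\<omega> \<in> space M. ennreal e < Z (S k) \<omega>} \<union> {\<omega> \<in> space M. ennreal (\<epsilon> / 2) < R (S k) \<omega>}"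
      proof (intro subsetI, rule ccontr)
        fix \<omega> assume 1: "\<omega> \<in> {\<omega> \<in> space M. \<epsilon> < norm (D k \<omega> - (I t \<omega> - I s \<omega>))}"
          and 2: "\<omega> \<notin> {\<omega> \<in> space M. ennreal e < Z (S k) \<omega>} \<union> {\<omega> \<in> space M. ennreal (\<epsilon> / 2) < R (S k) \<omega>}"
        have Dk: "D k \<omega> = simple_ito W (S k) t \<omega> - simple_ito W (S k) s \<omega>"
          using 1 2 by (intro D(2)) (auto simp: not_less)
        have "norm (simple_ito W (S k) r \<omega> - I r \<omega>) \<le> \<epsilon> / 2" if "r \<in> {0..t}" for r
        proof -
          have "ennreal (norm (simple_ito W (S k) r \<omega> - I r \<omega>)) \<le> R (S k) \<omega>"
            unfolding R_def using that by (rule SUP_upper)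
          also have "\<dots> \<le> ennreal (\<epsilon> / 2)" using 1 2 by (auto simp: not_less)
          finally show ?thesis using \<open>0 < \<epsilon>\<close> by (simp add: ennreal_le_iff)
        qed
        from this[of t] this[of s] have close: "norm (simple_ito W (S k) t \<omega> - I t \<omega>) \<le> \<epsilon> / 2"
          "norm (simple_ito W (S k) s \<omega> - I s \<omega>) \<le> \<epsilon> / 2" using st by auto
        have split: "D k \<omega> - (I t \<omega> - I s \<omega>)
            = (simple_ito W (S k) t \<omega> - I t \<omega>) - (simple_ito W (S k) s \<omega> - I s \<omega>)"
          unfolding Dk by simp
        have "norm (D k \<omega> - (I t \<omega> - I s \<omega>)) \<le> \<epsilon>"
          unfolding split using close
            norm_triangle_ineq4[of "simple_ito W (S k) t \<omega> - I t \<omega>" "simple_ito W (S k) s \<omega> - I s \<omega>"]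
          by linarith
        then show False using 1 by simp
      qed
      then have "prob {\<omega> \<in> space M. \<epsilon> < norm (D k \<omega> - (I t \<omega> - I s \<omega>))}
        \<le> prob ({\<omega> \<in> space M. ennreal e < Z (S k) \<omega>} \<union> {\<omega> \<in> space M. ennreal (\<epsilon> / 2) < R (S k) \<omega>})"
        by (intro finite_measure_mono) auto
      also have "\<dots> \<le> ?P k + ?Q k" by (intro measure_Un_le) auto
      finally show ?thesis .
    qed
    have "(\<lambda>k. ?P k + ?Q k) \<longlonglongrightarrow> 0 + 0"
      using S(2,3) e \<open>0 < \<epsilon>\<close> unfolding null_in_probability_def by (intro tendsto_add) auto
    then have lim: "(\<lambda>k. ?P k + ?Q k) \<longlonglongrightarrow> 0" by simp
    show "(\<lambda>k. prob {\<omega> \<in> space M. \<epsilon> < norm (D k \<omega> - (I t \<omega> - I s \<omega>))}) \<longlonglongrightarrow> 0"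
      by (rule tendsto_sandwich[OF always_eventually always_eventually tendsto_const lim])
         (intro allI measure_nonneg, intro allI le)
  qed
qed

text \<open>For the second moments, Fatou's lemma is applied along an almost surely convergent subsequence of the
truncated approximations, and then \<open>\<eta>\<close> tends to 0. For the mean, convergence in probability with
bounded second moments implies convergence in \<open>L\<^sup>1\<close>.\<close>

lemma ito_integral_L2_martingale:
  fixes W :: "real \<Rightarrow> 'w \<Rightarrow> real ^ 'm" and H :: "real \<Rightarrow> 'w \<Rightarrow> real ^ 'm ^ 'd" and I :: "real \<Rightarrow> 'w \<Rightarrow> real ^ 'd"
  assumes W: "brownian_motion M F W" and I: "ito_integral M F W H I"
    and L: "\<And>s t. 0 \<le> s \<Longrightarrow> s \<le> t \<Longrightarrow> L s \<le> L t"
    and H: "\<And>s t \<omega>. 0 \<le> s \<Longrightarrow> s \<le> t \<Longrightarrow> \<omega> \<in> space M \<Longrightarrow>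
        (\<integral>\<^sup>+ r\<in>{s<..t}. ennreal ((norm (H r \<omega>))\<^sup>2) \<partial>lborel) \<le> ennreal (L t - L s)"
  shows "L2_martingale (\<lambda>t. real CARD('m) * L t) I"
  unfolding L2_martingale_def centred_given_def
proof (intro conjI allI impI ballI)
  show IF: "I t \<in> borel_measurable (F t)" if "0 \<le> t" for t
    using I that unfolding ito_integral_def continuous_adapted_def by blast
  fix s t :: real assume s: "0 \<le> s" and st: "s \<le> t"
  show "real CARD('m) * L s \<le> real CARD('m) * L t" using L[OF s st] by (intro mult_left_mono) auto
  have [measurable]: "I s \<in> borel_measurable M" "I t \<in> borel_measurable M"
    using IF measurable_F_M s order_trans[OF s st] by blast+
  let ?Y = "\<lambda>\<omega>. I t \<omega> - I s \<omega>"
  show "?Y \<in> borel_measurable M" by measurable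
  have sq: "integrable M (\<lambda>\<omega>. g \<omega> * (norm (?Y \<omega>))\<^sup>2) \<and>
      (\<integral>\<omega>. g \<omega> * (norm (?Y \<omega>))\<^sup>2 \<partial>M) \<le> (real CARD('m) * L t - real CARD('m) * L s) * (\<integral>\<omega>. g \<omega> \<partial>M)"
    if g: "g \<in> borel_measurable (F s)" "\<forall>\<omega>. 0 \<le> g \<omega>" "integrable M g" for g
  proof (cases "s < t")
    case True
    have [measurable]: "g \<in> borel_measurable M" using g(3) by auto
    have "(\<integral>\<^sup>+\<omega>. ennreal (g \<omega> * (norm (?Y \<omega>))\<^sup>2) \<partial>M)
        \<le> ennreal (real CARD('m) * (L t - L s + \<eta>) * (\<integral>\<omega>. g \<omega> \<partial>M))" if "0 < \<eta>" for \<eta>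
    proof -
      have "0 \<le> L t - L s" using L[OF s st] by simp
      from ito_increment_approximation[OF W I s True this \<open>0 < \<eta>\<close> H[OF s st]]
      obtain D where D': "\<And>k::nat. centred_given s (real CARD('m) * (L t - L s + \<eta>)) (D k)"
        "\<And>\<epsilon>. 0 < \<epsilon> \<Longrightarrow> (\<lambda>k. prob {\<omega> \<in> space M. \<epsilon> < norm (D k \<omega> - ?Y \<omega>)}) \<longlonglongrightarrow> 0"
        by blast
      have D: "\<And>k. D k \<in> borel_measurable M"
        "\<And>k g. g \<in> borel_measurable (F s) \<Longrightarrow> (\<And>\<omega>. 0 \<le> g \<omega>) \<Longrightarrow> integrable M g \<Longrightarrow>
          integrable M (\<lambda>\<omega>. g \<omega> * (norm (D k \<omega>))\<^sup>2) \<and>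
          (\<integral>\<omega>. g \<omega> * (norm (D k \<omega>))\<^sup>2 \<partial>M) \<le> real CARD('m) * (L t - L s + \<eta>) * (\<integral>\<omega>. g \<omega> \<partial>M)"
        using D'(1) unfolding centred_given_def by blast+
      note [measurable] = D(1)
      obtain r :: "nat \<Rightarrow> nat" where r: "AE \<omega> in M. (\<lambda>k. norm (D (r k) \<omega> - ?Y \<omega>)) \<longlonglongrightarrow> 0"
        using null_in_probability_AE_subseq[OF _ _ D'(2)] by auto
      have "(\<integral>\<^sup>+\<omega>. ennreal (g \<omega> * (norm (?Y \<omega>))\<^sup>2) \<partial>M)
          = (\<integral>\<^sup>+\<omega>. liminf (\<lambda>k. ennreal (g \<omega> * (norm (D (r k) \<omega>))\<^sup>2)) \<partial>M)"
      proof (rule nn_integral_cong_AE)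
        show "AE \<omega> in M. ennreal (g \<omega> * (norm (?Y \<omega>))\<^sup>2) = liminf (\<lambda>k. ennreal (g \<omega> * (norm (D (r k) \<omega>))\<^sup>2))"
          using r
        proof eventually_elim
          case (elim \<omega>)
          then have "(\<lambda>k. D (r k) \<omega> - ?Y \<omega>) \<longlonglongrightarrow> 0" by (rule tendsto_norm_zero_cancel)
          then have "(\<lambda>k. D (r k) \<omega>) \<longlonglongrightarrow> ?Y \<omega>" by (rule LIM_zero_cancel)
          then have "(\<lambda>k. ennreal (g \<omega> * (norm (D (r k) \<omega>))\<^sup>2)) \<longlonglongrightarrow> ennreal (g \<omega> * (norm (?Y \<omega>))\<^sup>2)"
            by (intro tendsto_intros tendsto_ennrealI)
          then show ?case by (rule lim_imp_Liminf[OF sequentially_bot, symmetric])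
        qed
      qed
      also have "\<dots> \<le> liminf (\<lambda>k. \<integral>\<^sup>+\<omega>. ennreal (g \<omega> * (norm (D (r k) \<omega>))\<^sup>2) \<partial>M)"
        by (rule nn_integral_liminf) measurable
      also have "\<dots> \<le> liminf (\<lambda>k::nat. ennreal (real CARD('m) * (L t - L s + \<eta>) * (\<integral>\<omega>. g \<omega> \<partial>M)))"
      proof (intro Liminf_mono always_eventually allI)
        fix k
        show "(\<integral>\<^sup>+\<omega>. ennreal (g \<omega> * (norm (D (r k) \<omega>))\<^sup>2) \<partial>M)
            \<le> ennreal (real CARD('m) * (L t - L s + \<eta>) * (\<integral>\<omega>. g \<omega> \<partial>M))"
          using D(2)[of g "r k"] g by (subst nn_integral_eq_integral) (auto intro!: ennreal_leI)
      qed
      also have "\<dots> = ennreal (real CARD('m) * (L t - L s + \<eta>) * (\<integral>\<omega>. g \<omega> \<partial>M))"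
        by (rule lim_imp_Liminf) auto
      finally show ?thesis .
    qed
    then have "\<forall>\<^sub>F \<eta> in at_right 0. (\<integral>\<^sup>+\<omega>. ennreal (g \<omega> * (norm (?Y \<omega>))\<^sup>2) \<partial>M)
        \<le> ennreal (real CARD('m) * (L t - L s + \<eta>) * (\<integral>\<omega>. g \<omega> \<partial>M))"
      by (auto simp: eventually_at_right_field intro: exI[of _ 1])
    moreover have "((\<lambda>\<eta>. ennreal (real CARD('m) * (L t - L s + \<eta>) * (\<integral>\<omega>. g \<omega> \<partial>M)))
        \<longlongrightarrow> ennreal (real CARD('m) * (L t - L s + 0) * (\<integral>\<omega>. g \<omega> \<partial>M))) (at_right 0)"
      by (intro tendsto_ennrealI tendsto_intros)
    ultimately have "(\<integral>\<^sup>+\<omega>. ennreal (g \<omega> * (norm (?Y \<omega>))\<^sup>2) \<partial>M)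
        \<le> ennreal (real CARD('m) * (L t - L s + 0) * (\<integral>\<omega>. g \<omega> \<partial>M))"
      by (intro tendsto_lowerbound) auto
    moreover have "0 \<le> real CARD('m) * (L t - L s + 0) * (\<integral>\<omega>. g \<omega> \<partial>M)"
      using L[OF s st] g(2) by (intro mult_nonneg_nonneg Bochner_Integration.integral_nonneg) auto
    ultimately show ?thesis
      using integral_le_of_nn_integral_le[of "\<lambda>\<omega>. g \<omega> * (norm (?Y \<omega>))\<^sup>2" M] g(2)
      by (simp add: right_diff_distrib)
  qed (use st in simp)
  then show "integrable M (\<lambda>\<omega>. g \<omega> * (norm (?Y \<omega>))\<^sup>2)"
      "(\<integral>\<omega>. g \<omega> * (norm (?Y \<omega>))\<^sup>2 \<partial>M) \<le> (real CARD('m) * L t - real CARD('m) * L s) * (\<integral>\<omega>. g \<omega> \<partial>M)"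
    if "g \<in> borel_measurable (F s)" "\<forall>\<omega>. 0 \<le> g \<omega>" "integrable M g" for g
    using that by blast+
  show "(\<integral>\<omega>. v \<omega> \<bullet> ?Y \<omega> \<partial>M) = 0"
    if v: "v \<in> borel_measurable (F s)" and "\<exists>b. \<forall>\<omega>. norm (v \<omega>) \<le> b" for v
  proof (cases "s < t")
    case True
    obtain b where b: "\<And>\<omega>. norm (v \<omega>) \<le> b" using \<open>\<exists>b. _\<close> by blast
    have [measurable]: "v \<in> borel_measurable M" by (rule measurable_F_M[OF s v])
    have "0 \<le> b" using b norm_ge_zero order_trans by blast
    have Ls: "0 \<le> L t - L s" using L[OF s st] by simp
    from ito_increment_approximation[OF W I s True this zero_less_one H[OF s st]]
    obtain D where D': "\<And>k::nat. centred_given s (real CARD('m) * (L t - L s + 1)) (D k)"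
        "\<And>\<epsilon>. 0 < \<epsilon> \<Longrightarrow> (\<lambda>k. prob {\<omega> \<in> space M. \<epsilon> < norm (D k \<omega> - ?Y \<omega>)}) \<longlonglongrightarrow> 0"
      by blast
    have D: "\<And>k. D k \<in> borel_measurable M"
        "\<And>k v. v \<in> borel_measurable (F s) \<Longrightarrow> \<exists>b. \<forall>\<omega>. norm (v \<omega>) \<le> b \<Longrightarrow> (\<integral>\<omega>. v \<omega> \<bullet> D k \<omega> \<partial>M) = 0"
        "\<And>k g. g \<in> borel_measurable (F s) \<Longrightarrow> (\<And>\<omega>. 0 \<le> g \<omega>) \<Longrightarrow> integrable M g \<Longrightarrow>
          integrable M (\<lambda>\<omega>. g \<omega> * (norm (D k \<omega>))\<^sup>2) \<and>
          (\<integral>\<omega>. g \<omega> * (norm (D k \<omega>))\<^sup>2 \<partial>M) \<le> real CARD('m) * (L t - L s + 1) * (\<integral>\<omega>. g \<omega> \<partial>M)"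
      using D'(1) unfolding centred_given_def by blast+
    note [measurable] = D(1)
    let ?B = "real CARD('m) * (L t - L s + 1)"
    have D2: "integrable M (\<lambda>\<omega>. (norm (D k \<omega>))\<^sup>2) \<and> (\<integral>\<omega>. (norm (D k \<omega>))\<^sup>2 \<partial>M) \<le> ?B" for k
    proof -
      have "integrable M (\<lambda>\<omega>. 1 * (norm (D k \<omega>))\<^sup>2) \<and>
        (\<integral>\<omega>. 1 * (norm (D k \<omega>))\<^sup>2 \<partial>M) \<le> ?B * (\<integral>\<omega>. 1 \<partial>M)"
        by (rule D(3)) simp_all
      moreover have "?B * (\<integral>\<omega>. 1 \<partial>M) = ?B" by (simp only: lebesgue_integral_const prob_space scaleR_one mult_1_right)
      ultimately show ?thesis by (simp only: mult_1_left)
    qed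
    have "integrable M (\<lambda>\<omega>. 1 * (norm (?Y \<omega>))\<^sup>2)" by (rule conjunct1[OF sq]) simp_all
    then have Y2: "integrable M (\<lambda>\<omega>. (norm (?Y \<omega>))\<^sup>2)" by (simp only: mult_1_left)
    define Z where "Z k \<omega> = norm (D k \<omega> - ?Y \<omega>)" for k \<omega>
    have [measurable]: "Z k \<in> borel_measurable M" for k unfolding Z_def by measurable
    have Zle: "(Z k \<omega>)\<^sup>2 \<le> 2 * (norm (D k \<omega>))\<^sup>2 + 2 * (norm (?Y \<omega>))\<^sup>2" for k \<omega>
    proof -
      have "(Z k \<omega>)\<^sup>2 \<le> (norm (D k \<omega>) + norm (?Y \<omega>))\<^sup>2"
        unfolding Z_def by (intro power_mono norm_triangle_ineq4) simp
      also have "\<dots> \<le> 2 * (norm (D k \<omega>))\<^sup>2 + 2 * (norm (?Y \<omega>))\<^sup>2"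
        using sum_squares_bound[of "norm (D k \<omega>)" "norm (?Y \<omega>)"] by (simp add: power2_sum)
      finally show ?thesis .
    qed
    have Zb: "integrable M (\<lambda>\<omega>. 2 * (norm (D k \<omega>))\<^sup>2 + 2 * (norm (?Y \<omega>))\<^sup>2)" for k
      using D2 Y2 by simp
    have Z2: "integrable M (\<lambda>\<omega>. (Z k \<omega>)\<^sup>2)" for k
      by (rule Bochner_Integration.integrable_bound[OF Zb[of k]]) (use Zle in auto)
    have "(\<integral>\<omega>. (Z k \<omega>)\<^sup>2 \<partial>M) \<le> 2 * ?B + 2 * (\<integral>\<omega>. (norm (?Y \<omega>))\<^sup>2 \<partial>M)" for k
    proof -
      have "(\<integral>\<omega>. (Z k \<omega>)\<^sup>2 \<partial>M) \<le> (\<integral>\<omega>. 2 * (norm (D k \<omega>))\<^sup>2 + 2 * (norm (?Y \<omega>))\<^sup>2 \<partial>M)"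
        by (rule integral_mono[OF Z2 Zb Zle])
      also have "\<dots> = 2 * (\<integral>\<omega>. (norm (D k \<omega>))\<^sup>2 \<partial>M) + 2 * (\<integral>\<omega>. (norm (?Y \<omega>))\<^sup>2 \<partial>M)"
        using D2 Y2 by simp
      finally show ?thesis using D2[of k] by linarith
    qed
    then have Z0: "(\<lambda>k. \<integral>\<omega>. Z k \<omega> \<partial>M) \<longlonglongrightarrow> 0"
      using D'(2) Z2 by (intro null_in_probability_imp_L1) (auto simp: Z_def)
    have bound: "\<bar>\<integral>\<omega>. v \<omega> \<bullet> ?Y \<omega> \<partial>M\<bar> \<le> b * (\<integral>\<omega>. Z k \<omega> \<partial>M)" for k
    proof -
      have int: "integrable M (\<lambda>\<omega>. v \<omega> \<bullet> x \<omega>)"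
        if [measurable]: "x \<in> borel_measurable M" and "integrable M (\<lambda>\<omega>. (norm (x \<omega>))\<^sup>2)"
        for x :: "'w \<Rightarrow> real ^ 'd"
      proof (rule Bochner_Integration.integrable_bound)
        have "integrable M (\<lambda>\<omega>. norm (x \<omega>))" using that by (auto intro: square_integrable_imp_integrable)
        then show "integrable M (\<lambda>\<omega>. b * norm (x \<omega>))" by simp
        show "AE \<omega> in M. norm (v \<omega> \<bullet> x \<omega>) \<le> norm (b * norm (x \<omega>))"
        proof (rule AE_I2)
          fix \<omega>
          have "\<bar>v \<omega> \<bullet> x \<omega>\<bar> \<le> norm (v \<omega>) * norm (x \<omega>)" by (rule Cauchy_Schwarz_ineq2)
          also have "\<dots> \<le> b * norm (x \<omega>)" using b by (intro mult_right_mono) auto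
          finally show "norm (v \<omega> \<bullet> x \<omega>) \<le> norm (b * norm (x \<omega>))" using \<open>0 \<le> b\<close> by simp
        qed
      qed measurable
      have Zi: "integrable M (Z k)" using Z2 by (auto intro: square_integrable_imp_integrable)
      have iD: "integrable M (\<lambda>\<omega>. v \<omega> \<bullet> D k \<omega>)" and iY: "integrable M (\<lambda>\<omega>. v \<omega> \<bullet> ?Y \<omega>)"
        using D2 Y2 by (auto intro!: int)
      have "(\<integral>\<omega>. v \<omega> \<bullet> ?Y \<omega> \<partial>M) = - (\<integral>\<omega>. v \<omega> \<bullet> D k \<omega> - v \<omega> \<bullet> ?Y \<omega> \<partial>M)"
        using D(2)[OF v \<open>\<exists>b. _\<close>, of k] iD iY by simp
      then have "\<bar>\<integral>\<omega>. v \<omega> \<bullet> ?Y \<omega> \<partial>M\<bar> \<le> (\<integral>\<omega>. \<bar>v \<omega> \<bullet> D k \<omega> - v \<omega> \<bullet> ?Y \<omega>\<bar> \<partial>M)"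
        using integral_abs_bound[of M "\<lambda>\<omega>. v \<omega> \<bullet> D k \<omega> - v \<omega> \<bullet> ?Y \<omega>"] by simp
      also have "\<dots> \<le> (\<integral>\<omega>. b * Z k \<omega> \<partial>M)"
      proof (rule integral_mono)
        show "integrable M (\<lambda>\<omega>. \<bar>v \<omega> \<bullet> D k \<omega> - v \<omega> \<bullet> ?Y \<omega>\<bar>)" using iD iY by simp
        show "integrable M (\<lambda>\<omega>. b * Z k \<omega>)" using Zi by simp
        fix \<omega>
        have "\<bar>v \<omega> \<bullet> D k \<omega> - v \<omega> \<bullet> ?Y \<omega>\<bar> \<le> norm (v \<omega>) * Z k \<omega>"
          unfolding Z_def inner_diff_right[symmetric] by (rule Cauchy_Schwarz_ineq2)
        also have "\<dots> \<le> b * Z k \<omega>" using b by (intro mult_right_mono) (auto simp: Z_def)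
        finally show "\<bar>v \<omega> \<bullet> D k \<omega> - v \<omega> \<bullet> ?Y \<omega>\<bar> \<le> b * Z k \<omega>" .
      qed
      finally show ?thesis by simp
    qed
    have "(\<lambda>k. b * (\<integral>\<omega>. Z k \<omega> \<partial>M)) \<longlonglongrightarrow> b * 0" by (intro tendsto_mult_left Z0)
    then have "\<bar>\<integral>\<omega>. v \<omega> \<bullet> ?Y \<omega> \<partial>M\<bar> \<le> b * 0" by (rule LIMSEQ_le_const) (use bound in blast)
    then show ?thesis by simp
  qed (use st in simp)
qed

end

section \<open>Limits of expectations and Huber functions\<close>

text \<open>Fatou's lemma needs a lower bound, which \<open>N n + Q n\<close> does not have. But
\[ N + k \le N + k + N^2 / (4 k) = (N / 2 + k)^2 / k, \]
and the right-hand side is non-negative and has an expectation that exceeds \<open>k\<close> by at most \<open>B / (4 k)\<close>.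
The dominating variable \<open>U\<close> does not depend on \<open>y\<close>: one \<open>U\<close> serves for all \<open>y\<close> in a supremum.\<close>

lemma (in prob_space) limit_upper_bound:
  fixes N Q :: "nat \<Rightarrow> 'a \<Rightarrow> real"
  assumes N[measurable]: "\<And>n. N n \<in> borel_measurable M" and Qm[measurable]: "\<And>n. Q n \<in> borel_measurable M"
    and N2: "\<And>n. integrable M (\<lambda>\<omega>. (N n \<omega>)\<^sup>2)" "\<And>n. (\<integral>\<omega>. (N n \<omega>)\<^sup>2 \<partial>M) \<le> B"
    and N0: "\<And>n. (\<integral>\<omega>. N n \<omega> \<partial>M) = 0"
    and Q: "\<And>n \<omega>. 0 \<le> Q n \<omega>" "\<And>n. integrable M (Q n)" "\<And>n. (\<integral>\<omega>. Q n \<omega> \<partial>M) \<le> q"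
    and "0 < k"
  obtains U :: "'a \<Rightarrow> ennreal" where "U \<in> borel_measurable M"
    and "(\<integral>\<^sup>+\<omega>. U \<omega> \<partial>M) \<le> ennreal (q + k + B / (4 * k))"
    and "\<And>\<omega> y e. e \<longlonglongrightarrow> 0 \<Longrightarrow> (\<And>n. y \<le> N n \<omega> + Q n \<omega> + e n) \<Longrightarrow> ennreal (y + k) \<le> U \<omega>"
proof -
  define Y where "Y n \<omega> = Q n \<omega> + (N n \<omega> / 2 + k)\<^sup>2 / k" for n \<omega>
  have Y_eq: "Y n \<omega> = Q n \<omega> + ((N n \<omega>)\<^sup>2 / (4 * k) + N n \<omega> + k)" for n \<omega>
    using \<open>0 < k\<close> by (simp add: Y_def power2_eq_square field_simps)
  have [measurable]: "Y n \<in> borel_measurable M" for n unfolding Y_def by measurable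
  have Y0: "0 \<le> Y n \<omega>" for n \<omega> using Q(1) \<open>0 < k\<close> by (simp add: Y_def)
  have Ni: "integrable M (N n)" for n using N2(1)[of n] by (auto intro: square_integrable_imp_integrable)
  have Yi: "integrable M (Y n)" for n
    unfolding Y_eq using Q(2) N2(1) Ni by (intro Bochner_Integration.integrable_add integrable_divide integrable_const) auto
  have "(\<integral>\<omega>. Y n \<omega> \<partial>M) = (\<integral>\<omega>. Q n \<omega> \<partial>M) + ((\<integral>\<omega>. (N n \<omega>)\<^sup>2 \<partial>M) / (4 * k) + 0 + k)" for n
    unfolding Y_eq using Q(2)[of n] N2(1)[of n] Ni[of n] N0[of n] by (simp add: prob_space)
  then have Ys: "(\<integral>\<omega>. Y n \<omega> \<partial>M) \<le> q + k + B / (4 * k)" for n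
    using Q(3)[of n] divide_right_mono[OF N2(2)[of n], of "4 * k"] \<open>0 < k\<close> by simp
  show ?thesis
  proof (rule that[of "\<lambda>\<omega>. liminf (\<lambda>n. ennreal (Y n \<omega>))"])
    have "(\<integral>\<^sup>+\<omega>. liminf (\<lambda>n. ennreal (Y n \<omega>)) \<partial>M) \<le> liminf (\<lambda>n. \<integral>\<^sup>+\<omega>. ennreal (Y n \<omega>) \<partial>M)"
      by (rule nn_integral_liminf) measurable
    also have "\<dots> \<le> liminf (\<lambda>n::nat. ennreal (q + k + B / (4 * k)))"
      using Ys Yi Y0 by (intro Liminf_mono always_eventually allI) (simp add: nn_integral_eq_integral ennreal_leI)
    also have "\<dots> = ennreal (q + k + B / (4 * k))" by (rule lim_imp_Liminf) auto
    finally show "(\<integral>\<^sup>+\<omega>. liminf (\<lambda>n. ennreal (Y n \<omega>)) \<partial>M) \<le> ennreal (q + k + B / (4 * k))" .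
  next
    fix \<omega> y and e :: "nat \<Rightarrow> real"
    assume e: "e \<longlonglongrightarrow> 0" and y: "\<And>n. y \<le> N n \<omega> + Q n \<omega> + e n"
    have "(\<lambda>n. ennreal (y + k - e n)) \<longlonglongrightarrow> ennreal (y + k - 0)"
      by (intro tendsto_ennrealI tendsto_intros e)
    then have "ennreal (y + k) = liminf (\<lambda>n. ennreal (y + k - e n))"
      by (intro lim_imp_Liminf[symmetric]) auto
    also have "\<dots> \<le> liminf (\<lambda>n. ennreal (Y n \<omega>))"
    proof (intro Liminf_mono always_eventually allI ennreal_leI)
      fix n
      have "0 \<le> (N n \<omega>)\<^sup>2 / (4 * k)" using \<open>0 < k\<close> by simp
      then show "y + k - e n \<le> Y n \<omega>" using y[of n] by (simp add: Y_eq)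
    qed
    finally show "ennreal (y + k) \<le> liminf (\<lambda>n. ennreal (Y n \<omega>))" .
  qed measurable
qed

text \<open>The factor by which the metric projection onto the ball of radius \<open>N\<close> around 0 multiplies \<open>x\<close>.\<close>

definition shrink :: "real \<Rightarrow> 'a::real_inner \<Rightarrow> real" where
  "shrink N x = (if norm x \<le> N then 1 else N / norm x)"

text \<open>The squared norm minus the squared distance to the ball of radius \<open>N\<close>; its gradient is twice the
metric projection onto that ball, hence bounded by \<open>2 N\<close>.\<close>

definition huber :: "real \<Rightarrow> 'a::real_inner \<Rightarrow> real" where
  "huber N x = (if norm x \<le> N then (norm x)\<^sup>2 else 2 * N * norm x - N\<^sup>2)"

lemma shrink_bounds:
  assumes "0 < N"
  shows "0 \<le> shrink N x" "shrink N x \<le> 1" "norm (shrink N x *\<^sub>R x) \<le> N"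
  using assms by (auto simp: shrink_def divide_simps)

lemma shrink_le_huber:
  assumes "0 < N"
  shows "(norm (shrink N x *\<^sub>R x))\<^sup>2 \<le> huber N x"
proof (cases "norm x \<le> N")
  case False
  then have "norm (shrink N x *\<^sub>R x) = N" using assms by (auto simp: shrink_def)
  moreover have "N * N \<le> N * norm x" using False assms by (intro mult_left_mono) auto
  ultimately show ?thesis using False by (simp add: huber_def power2_eq_square)
qed (simp add: shrink_def huber_def)

lemma huber_bounds:
  assumes "0 < N"
  shows "0 \<le> huber N x" "huber N x \<le> (norm x)\<^sup>2"
proof -
  show "0 \<le> huber N x" using shrink_le_huber[OF assms, of x] by (meson order_trans zero_le_power2)
  have "0 \<le> (norm x - N)\<^sup>2" by simp
  then show "huber N x \<le> (norm x)\<^sup>2" by (simp add: huber_def power2_diff mult_ac)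
qed

lemma huber_eq: "huber N x = 2 * ((shrink N x *\<^sub>R x) \<bullet> x) - (norm (shrink N x *\<^sub>R x))\<^sup>2" if "0 < N"
  using that by (auto simp: huber_def shrink_def power2_norm_eq_inner[symmetric] power2_eq_square)

text \<open>For the projections \<open>p\<close> of \<open>x\<close> and \<open>q\<close> of \<open>y\<close> the difference of the two sides is
\<open>\<bar>(y - q) - (x - p)\<bar>\<^sup>2 - 2 \<langle>x - p, q - p\<rangle>\<close>, and the inner product is non-positive by the variational
characterisation of \<open>p\<close>. The coefficient 1 of the squared increment is the same as for the square
itself.\<close>

lemma huber_increment:
  fixes x y :: "'a::real_inner"
  assumes "0 < N"
  shows "huber N y \<le> huber N x + 2 * ((shrink N x *\<^sub>R x) \<bullet> (y - x)) + (norm (y - x))\<^sup>2"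
proof -
  let ?p = "shrink N x *\<^sub>R x" and ?q = "shrink N y *\<^sub>R y"
  have proj: "(x - ?p) \<bullet> (?q - ?p) \<le> 0"
  proof (cases "norm x \<le> N")
    case False
    have xp: "x - ?p = (1 - N / norm x) *\<^sub>R x" using False by (simp add: shrink_def algebra_simps)
    have "x \<bullet> ?q \<le> norm x * norm ?q" by (rule norm_cauchy_schwarz)
    also have "\<dots> \<le> norm x * N" using shrink_bounds(3)[OF assms, of y] by (intro mult_left_mono) auto
    also have "\<dots> = x \<bullet> ?p" using False by (simp add: shrink_def power2_norm_eq_inner[symmetric] power2_eq_square)
    finally have "x \<bullet> (?q - ?p) \<le> 0" by (simp add: inner_diff_right)
    moreover have "0 \<le> 1 - N / norm x" using False assms by (simp add: divide_simps)
    ultimately show ?thesis unfolding xp by (simp add: mult_nonneg_nonpos)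
  qed (simp add: shrink_def)
  have "0 \<le> (norm ((y - ?q) - (x - ?p)))\<^sup>2 - 2 * ((x - ?p) \<bullet> (?q - ?p))"
    using proj zero_le_power2[of "norm ((y - ?q) - (x - ?p))"] by linarith
  also have "\<dots> = huber N x + 2 * (?p \<bullet> (y - x)) + (norm (y - x))\<^sup>2 - huber N y"
    unfolding huber_eq[OF assms] power2_norm_eq_inner
    by (simp only: inner_diff_left inner_diff_right inner_commute) (simp add: algebra_simps inner_commute)
  finally show ?thesis by simp
qed

lemma borel_measurable_shrink[measurable]: "shrink N \<in> borel_measurable borel"
  unfolding shrink_def by measurable

lemma borel_measurable_huber[measurable]: "huber N \<in> borel_measurable borel"
  unfolding huber_def by measurable

lemma ereal_expectation_le:
  assumes g: "integrable M g" and le: "AE \<omega> in M. f \<omega> \<le> ereal (g \<omega>)"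
  shows "ereal_expectation M f \<le> ereal (\<integral>\<omega>. g \<omega> \<partial>M)"
proof -
  have fin: "(\<integral>\<^sup>+\<omega>. ennreal (g \<omega>) \<partial>M) < \<infinity>" "(\<integral>\<^sup>+\<omega>. ennreal (- g \<omega>) \<partial>M) < \<infinity>"
    using g unfolding real_integrable_def by (auto simp: less_top)
  have "(\<integral>\<^sup>+\<omega>. e2ennreal (f \<omega>) \<partial>M) \<le> (\<integral>\<^sup>+\<omega>. ennreal (g \<omega>) \<partial>M)"
  proof (rule nn_integral_mono_AE)
    show "AE \<omega> in M. e2ennreal (f \<omega>) \<le> ennreal (g \<omega>)"
      using le by eventually_elim (metis e2ennreal_mono e2ennreal_ereal)
  qed
  moreover have "(\<integral>\<^sup>+\<omega>. ennreal (- g \<omega>) \<partial>M) \<le> (\<integral>\<^sup>+\<omega>. e2ennreal (- f \<omega>) \<partial>M)"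
  proof (rule nn_integral_mono_AE)
    show "AE \<omega> in M. ennreal (- g \<omega>) \<le> e2ennreal (- f \<omega>)"
      using le
    proof eventually_elim
      case (elim \<omega>)
      then have "ereal (- g \<omega>) \<le> - f \<omega>" by (simp add: uminus_ereal.simps(1)[symmetric] del: uminus_ereal.simps)
      then show ?case by (metis e2ennreal_mono e2ennreal_ereal)
    qed
  qed
  ultimately have "ereal_expectation M f
      \<le> enn2ereal (\<integral>\<^sup>+\<omega>. ennreal (g \<omega>) \<partial>M) - enn2ereal (\<integral>\<^sup>+\<omega>. ennreal (- g \<omega>) \<partial>M)"
    unfolding ereal_expectation_def by (intro ereal_minus_mono) (auto simp: less_eq_ennreal.rep_eq)
  also have "\<dots> = ereal (\<integral>\<omega>. g \<omega> \<partial>M)"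
    unfolding real_lebesgue_integral_def[OF g] using fin
    by (cases "\<integral>\<^sup>+\<omega>. ennreal (g \<omega>) \<partial>M"; cases "\<integral>\<^sup>+\<omega>. ennreal (- g \<omega>) \<partial>M") auto
  finally show ?thesis .
qed

text \<open>On the segment from \<open>x\<close> to \<open>y\<close> the function stays below its value at \<open>x\<close>, so that its derivative in the
direction \<open>y - x\<close> is not positive.\<close>

lemma convex_gradient_drift:
  fixes \<Psi> :: "'a::real_inner \<Rightarrow> real"
  assumes "convex_on UNIV \<Psi>" "GDERIV \<Psi> x :> g" "\<Psi> y \<le> \<Psi> x"
  shows "0 \<le> g \<bullet> (x - y)"
proof (rule ccontr)
  assume "\<not> ?thesis"
  moreover have "g \<bullet> (x - y) = - ((y - x) \<bullet> g)"
    by (metis inner_commute inner_minus_right minus_diff_eq)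
  ultimately have pos: "0 < (y - x) \<bullet> g" by simp
  define f where "f t = \<Psi> (x + t *\<^sub>R (y - x))" for t :: real
  have d\<Psi>: "(\<Psi> has_derivative (\<lambda>h. h \<bullet> g)) (at (x + 0 *\<^sub>R (y - x)))" using assms(2) by (simp add: gderiv_def)
  have "((\<lambda>t. x + t *\<^sub>R (y - x)) has_derivative (\<lambda>t. t *\<^sub>R (y - x))) (at (0::real))"
    by (auto intro!: derivative_eq_intros)
  from has_derivative_compose[OF this d\<Psi>] have "(f has_derivative (\<lambda>t. (t *\<^sub>R (y - x)) \<bullet> g)) (at 0)"
    by (simp add: f_def[abs_def])
  then have "DERIV f 0 :> (y - x) \<bullet> g"
    unfolding has_field_derivative_def by (rule has_derivative_eq_rhs) (simp add: fun_eq_iff)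
  then obtain d where d: "0 < d" "\<And>h. 0 < h \<Longrightarrow> h < d \<Longrightarrow> f 0 < f (0 + h)"
    using DERIV_pos_inc_right[OF _ pos] by blast
  define h where "h = min (d / 2) 1"
  have h: "0 < h" "h < d" "h \<le> 1" using d(1) by (auto simp: h_def)
  have "f h \<le> (1 - h) * \<Psi> x + h * \<Psi> y"
  proof -
    have "x + h *\<^sub>R (y - x) = (1 - h) *\<^sub>R x + h *\<^sub>R y" by (simp add: algebra_simps)
    then show ?thesis unfolding f_def using convex_onD[OF assms(1), of h x y] h by simp
  qed
  also have "\<dots> \<le> (1 - h) * \<Psi> x + h * \<Psi> x" using assms(3) h by (intro add_left_mono mult_left_mono) auto
  finally have "f h \<le> f 0" by (simp add: f_def algebra_simps)
  then show False using d(2)[OF h(1,2)] by simp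
qed

lemma abs_continuous_on_imp_continuous_on:
  assumes "abs_continuous_on a b f"
  shows "continuous_on {a..b} f"
  unfolding continuous_on_iff
proof (intro ballI allI impI)
  fix x e :: real assume x: "x \<in> {a..b}" and "0 < e"
  then obtain d where d: "0 < d" "\<And>(n::nat) l r.
     (\<forall>i<n. a \<le> l i \<and> l i \<le> r i \<and> r i \<le> b) \<Longrightarrow>
     disjoint_family_on (\<lambda>i. {l i<..<r i}) {..<n} \<Longrightarrow> (\<Sum>i<n. r i - l i) < d \<Longrightarrow>
     (\<Sum>i<n. \<bar>f (r i) - f (l i)\<bar>) < e"
    using assms unfolding abs_continuous_on_def by meson
  have one: "\<bar>f r - f l\<bar> < e" if "a \<le> l" "l \<le> r" "r \<le> b" "r - l < d" for l r
    using d(2)[of 1 "\<lambda>_. l" "\<lambda>_. r"] that by (simp add: disjoint_family_on_def)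
  show "\<exists>d>0. \<forall>x'\<in>{a..b}. dist x' x < d \<longrightarrow> dist (f x') (f x) < e"
  proof (intro exI[of _ d] conjI d(1) ballI impI)
    fix x' assume "x' \<in> {a..b}" "dist x' x < d"
    then show "dist (f x') (f x) < e"
      using one[of x x'] one[of x' x] x by (cases "x \<le> x'") (auto simp: dist_real_def abs_minus_commute)
  qed
qed

section \<open>Moments of the solution and of the gap function\<close>

lemma ennreal_add_le: "0 \<le> y \<Longrightarrow> ennreal (x + y) \<le> ennreal x + ennreal y"
  by (cases "0 \<le> x") (auto simp: ennreal_neg intro!: ennreal_leI)

text \<open>A solution of \<open>dX = - b(t,X) dt + dI - dK\<close> whose drift \<open>- b\<close> points towards \<open>C\<close>, driven by a martingale
\<open>I\<close> of total energy at most \<open>\<Lambda>\<close>.\<close>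

locale averaged_solution = stochastic_basis M F
  for M :: "'w measure" and F :: "real \<Rightarrow> 'w measure" +
  fixes A :: "real ^ 'd \<Rightarrow> (real ^ 'd) set" and C :: "(real ^ 'd) set"
    and b :: "real \<Rightarrow> real ^ 'd \<Rightarrow> real ^ 'd"
    and X K I :: "real \<Rightarrow> 'w \<Rightarrow> real ^ 'd" and L :: "real \<Rightarrow> real" and \<Lambda> :: real
  assumes X: "continuous_adapted M F X" and K: "continuous_adapted M F K"
    and I: "continuous_adapted M F I" "L2_martingale L I"
    and bv: "\<And>T. 0 < T \<Longrightarrow> AE \<omega> in M. bounded_variation_on 0 T (\<lambda>t. K t \<omega>)"
    and eq: "AE \<omega> in M. \<forall>t\<ge>0. X t \<omega> = X 0 \<omega> - (LINT s:{0..t}|lborel. b s (X s \<omega>)) + I t \<omega> - (K t \<omega> - K 0 \<omega>)"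
    and b: "\<And>T \<omega>. 0 < T \<Longrightarrow> \<omega> \<in> space M \<Longrightarrow> set_integrable lborel {0..T} (\<lambda>s. b s (X s \<omega>))"
    and drift: "\<And>s x y. 0 \<le> s \<Longrightarrow> y \<in> C \<Longrightarrow> 0 \<le> b s x \<bullet> (x - y)"
    and pairing: "\<And>T y y'. 0 < T \<Longrightarrow> y' \<in> A y \<Longrightarrow> AE \<omega> in M. \<forall>B\<in>sets borel. B \<subseteq> {0..T} \<longrightarrow>
        0 \<le> pairing_measure T (\<lambda>t. X t \<omega> - y) (\<lambda>t. K t \<omega>) (\<lambda>t. y') B"
    and L_bound: "\<And>t. 0 \<le> t \<Longrightarrow> L t - L 0 \<le> \<Lambda>"
    and X0: "integrable M (\<lambda>\<omega>. (norm (X 0 \<omega>))\<^sup>2)"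
begin

lemma X_measurable_F: "0 \<le> t \<Longrightarrow> X t \<in> borel_measurable (F t)"
  using X by (simp add: continuous_adapted_def)

lemma X_measurable[measurable]: "0 \<le> t \<Longrightarrow> X t \<in> borel_measurable M"
  using X_measurable_F measurable_F_M by blast

lemma I_measurable[measurable]: "0 \<le> t \<Longrightarrow> I t \<in> borel_measurable M"
  using I(2) L2_martingale_measurable_M by blast

lemma paths_continuous:
  assumes "\<omega> \<in> space M"
  shows "continuous_on {0..T} (\<lambda>t. X t \<omega>)" "continuous_on {0..T} (\<lambda>t. K t \<omega>)" "continuous_on {0..T} (\<lambda>t. I t \<omega>)"
proof -
  have sub: "{0..T} \<subseteq> {0..}" by auto
  show "continuous_on {0..T} (\<lambda>t. X t \<omega>)" "continuous_on {0..T} (\<lambda>t. K t \<omega>)" "continuous_on {0..T} (\<lambda>t. I t \<omega>)"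
    using X K I(1) assms unfolding continuous_adapted_def by (blast intro: continuous_on_subset[OF _ sub])+
qed

lemma \<Lambda>_nonneg: "0 \<le> \<Lambda>"
  using L_bound[of 0] by simp

lemma X0_minus:
  shows "integrable M (\<lambda>\<omega>. (norm (X 0 \<omega> - a))\<^sup>2)"
proof (rule Bochner_Integration.integrable_bound)
  show "integrable M (\<lambda>\<omega>. 2 * (norm (X 0 \<omega>))\<^sup>2 + 2 * (norm a)\<^sup>2)" using X0 by simp
  show "AE \<omega> in M. norm ((norm (X 0 \<omega> - a))\<^sup>2) \<le> norm (2 * (norm (X 0 \<omega>))\<^sup>2 + 2 * (norm a)\<^sup>2)"
  proof (rule AE_I2)
    fix \<omega>
    have "(norm (X 0 \<omega> - a))\<^sup>2 \<le> (norm (X 0 \<omega>) + norm a)\<^sup>2" by (intro power_mono norm_triangle_ineq4) simp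
    also have "\<dots> \<le> 2 * (norm (X 0 \<omega>))\<^sup>2 + 2 * (norm a)\<^sup>2"
      using sum_squares_bound[of "norm (X 0 \<omega>)" "norm a"] by (simp add: power2_sum)
    finally show "norm ((norm (X 0 \<omega> - a))\<^sup>2) \<le> norm (2 * (norm (X 0 \<omega>))\<^sup>2 + 2 * (norm a)\<^sup>2)" by simp
  qed
qed simp

lemma I_increment:
  assumes "0 \<le> s" "s \<le> t"
  shows "integrable M (\<lambda>\<omega>. (norm (I t \<omega> - I s \<omega>))\<^sup>2)" "(\<integral>\<omega>. (norm (I t \<omega> - I s \<omega>))\<^sup>2 \<partial>M) \<le> L t - L s"
proof -
  have "integrable M (\<lambda>\<omega>. 1 * (norm (I t \<omega> - I s \<omega>))\<^sup>2)"
    by (rule L2_martingale_square(1)[OF I(2) assms]) auto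
  then show "integrable M (\<lambda>\<omega>. (norm (I t \<omega> - I s \<omega>))\<^sup>2)" by (simp only: mult_1_left)
  have "(\<integral>\<omega>. 1 * (norm (I t \<omega> - I s \<omega>))\<^sup>2 \<partial>M) \<le> (L t - L s) * (\<integral>\<omega>. 1 \<partial>M)"
    by (rule L2_martingale_square(2)[OF I(2) assms]) auto
  then show "(\<integral>\<omega>. (norm (I t \<omega> - I s \<omega>))\<^sup>2 \<partial>M) \<le> L t - L s"
    by (simp only: mult_1_left mult_1_right lebesgue_integral_const prob_space scaleR_one)
qed

lemma quadratic_sum:
  assumes "0 \<le> T"
  defines "Q \<equiv> \<lambda>n \<omega>. \<Sum>i<Suc n. (norm (I (grid T n (Suc i)) \<omega> - I (grid T n i) \<omega>))\<^sup>2"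
  shows "Q n \<in> borel_measurable M" "integrable M (Q n)" "(\<integral>\<omega>. Q n \<omega> \<partial>M) \<le> \<Lambda>"
proof -
  have g: "0 \<le> grid T n i" "grid T n i \<le> grid T n (Suc i)" for i
    using assms(1) by (auto intro: grid_nonneg grid_mono)
  have [measurable]: "I (grid T n i) \<in> borel_measurable M" for i using g(1) by (rule I_measurable)
  show "Q n \<in> borel_measurable M" unfolding Q_def by measurable
  show "integrable M (Q n)" unfolding Q_def using I_increment(1)[OF g] by (intro Bochner_Integration.integrable_sum)
  have "(\<integral>\<omega>. Q n \<omega> \<partial>M) = (\<Sum>i<Suc n. \<integral>\<omega>. (norm (I (grid T n (Suc i)) \<omega> - I (grid T n i) \<omega>))\<^sup>2 \<partial>M)"
    unfolding Q_def using I_increment(1)[OF g] by (intro Bochner_Integration.integral_sum)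
  also have "\<dots> \<le> (\<Sum>i<Suc n. L (grid T n (Suc i)) - L (grid T n i))"
    by (intro sum_mono I_increment(2)[OF g])
  also have "\<dots> = L T - L 0" by (subst sum_lessThan_telescope) simp
  also have "\<dots> \<le> \<Lambda>" by (rule L_bound[OF assms(1)])
  finally show "(\<integral>\<omega>. Q n \<omega> \<partial>M) \<le> \<Lambda>" .
qed

lemma martingale_sum:
  assumes "0 \<le> T"
    and vF: "\<And>t. 0 \<le> t \<Longrightarrow> v t \<in> borel_measurable (F t)"
    and vi: "\<And>t. 0 \<le> t \<Longrightarrow> t \<le> T \<Longrightarrow> integrable M (\<lambda>\<omega>. (norm (v t \<omega>))\<^sup>2)"
      "\<And>t. 0 \<le> t \<Longrightarrow> t \<le> T \<Longrightarrow> (\<integral>\<omega>. (norm (v t \<omega>))\<^sup>2 \<partial>M) \<le> B"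
  defines "N \<equiv> \<lambda>n \<omega>. \<Sum>i<Suc n. v (grid T n i) \<omega> \<bullet> (I (grid T n (Suc i)) \<omega> - I (grid T n i) \<omega>)"
  shows "N n \<in> borel_measurable M" "integrable M (\<lambda>\<omega>. (N n \<omega>)\<^sup>2)" "(\<integral>\<omega>. N n \<omega> \<partial>M) = 0"
    "(\<integral>\<omega>. (N n \<omega>)\<^sup>2 \<partial>M) \<le> B * \<Lambda>"
proof -
  have g: "0 \<le> grid T n i" "grid T n i \<le> grid T n (Suc i)" for i
    using assms(1) by (auto intro: grid_nonneg grid_mono)
  have gT: "grid T n i \<le> T" if "i < Suc n" for i using assms(1) that by (intro grid_le) auto
  note tr = martingale_transform[OF I(2), of "Suc n" "grid T n" "\<lambda>i. v (grid T n i)",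
      OF g(1) g(2) vF[OF g(1)] vi(1)[OF g(1) gT]]
  show "N n \<in> borel_measurable M" unfolding N_def by (rule measurable_F_M[OF g(1) tr(1)])
  show "integrable M (\<lambda>\<omega>. (N n \<omega>)\<^sup>2)" unfolding N_def by (rule tr(2))
  show "(\<integral>\<omega>. N n \<omega> \<partial>M) = 0" unfolding N_def by (rule tr(3))
  have "0 \<le> (\<integral>\<omega>. (norm (v 0 \<omega>))\<^sup>2 \<partial>M)" by simp
  also have "\<dots> \<le> B" using vi(2)[of 0] assms(1) by simp
  finally have "0 \<le> B" .
  have Lg: "0 \<le> L (grid T n (Suc i)) - L (grid T n i)" for i
    using L2_martingale_mono[OF I(2) g] by simp
  have "(\<integral>\<omega>. (N n \<omega>)\<^sup>2 \<partial>M)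
      \<le> (\<Sum>i<Suc n. (\<integral>\<omega>. (norm (v (grid T n i) \<omega>))\<^sup>2 \<partial>M) * (L (grid T n (Suc i)) - L (grid T n i)))"
    unfolding N_def by (rule tr(4))
  also have "\<dots> \<le> (\<Sum>i<Suc n. B * (L (grid T n (Suc i)) - L (grid T n i)))"
    using vi(2)[OF g(1) gT] Lg by (intro sum_mono mult_right_mono) auto
  also have "\<dots> = B * (L T - L 0)"
    unfolding sum_distrib_left[symmetric] by (subst sum_lessThan_telescope) simp
  also have "\<dots> \<le> B * \<Lambda>" using L_bound[OF assms(1)] \<open>0 \<le> B\<close> by (intro mult_left_mono)
  finally show "(\<integral>\<omega>. (N n \<omega>)\<^sup>2 \<partial>M) \<le> B * \<Lambda>" .
qed

lemma solution_grid_bounds: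
  assumes "0 < T" "y \<in> C" "y' \<in> A y"
  shows "AE \<omega> in M. \<exists>e. grid_bounds T (\<lambda>t. X t \<omega>) (\<lambda>t. I t \<omega>) y y' e"
  using eq bv[OF assms(1)] pairing[OF assms(1,3)] AE_space
proof eventually_elim
  case (elim \<omega>)
  show ?case
  proof (rule grid_bounds_solution[where x = "\<lambda>t. X t \<omega>" and I = "\<lambda>t. I t \<omega>" and K = "\<lambda>t. K t \<omega>"
        and b = "\<lambda>s. b s (X s \<omega>)" and y = y and y' = y' and T = T])
    show "bounded_variation_on 0 T (\<lambda>t. K t \<omega>)" using elim by simp
    show "set_integrable lborel {0..T} (\<lambda>s. b s (X s \<omega>))" using b[OF assms(1)] elim by simp
    show "0 \<le> b s (X s \<omega>) \<bullet> (X s \<omega> - y)" if "s \<in> {0..T}" for s using drift assms(2) that by simp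
    show "X t \<omega> = X 0 \<omega> - (LINT s:{0..t}|lborel. b s (X s \<omega>)) + I t \<omega> - (K t \<omega> - K 0 \<omega>)"
      if "t \<in> {0..T}" for t by (rule elim(1)[rule_format]) (use that in simp)
    show "0 \<le> pairing_measure T (\<lambda>t. X t \<omega> - y) (\<lambda>t. K t \<omega>) (\<lambda>t. y') B"
      if "B \<in> sets borel" "B \<subseteq> {0..T}" for B using elim(3) that by blast
  qed (rule assms paths_continuous elim)+
qed

text \<open>The martingale sums are formed with the projection of \<open>X - a\<close> onto a ball, which is bounded, so that
no moment of \<open>X\<close> has to be known beforehand. The monotonicity condition is used for the pair
\<open>(a, a')\<close>; it leaves a drift of at most \<open>2 \<bar>a'\<bar>\<close> times the size of that projection, and \<open>r\<close> bounds its
expected total up to time \<open>T\<close>.\<close>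

lemma huber_moment_step:
  assumes "0 < N" "a \<in> C" "a' \<in> A a" "0 < T"
    and r: "\<And>s. 0 \<le> s \<Longrightarrow> s \<le> T \<Longrightarrow>
        2 * norm a' * T * (\<integral>\<omega>. norm (shrink N (X s \<omega> - a) *\<^sub>R (X s \<omega> - a)) \<partial>M) \<le> r"
  shows "(\<integral>\<^sup>+\<omega>. ennreal (huber N (X T \<omega> - a)) \<partial>M)
    \<le> ennreal ((\<integral>\<omega>. (norm (X 0 \<omega> - a))\<^sup>2 \<partial>M) + \<Lambda> + 1 + r)"
proof -
  have "0 \<le> T" using \<open>0 < T\<close> by simp
  define p where "p s \<omega> = shrink N (X s \<omega> - a) *\<^sub>R (X s \<omega> - a)" for s \<omega>
  have pF: "p s \<in> borel_measurable (F s)" if "0 \<le> s" for s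
    unfolding p_def using X_measurable_F[OF that] by measurable
  have pM[measurable]: "p s \<in> borel_measurable M" if "0 \<le> s" for s
    using measurable_F_M[OF that pF[OF that]] .
  have pN: "norm (p s \<omega>) \<le> N" for s \<omega> unfolding p_def by (rule shrink_bounds(3)[OF \<open>0 < N\<close>])
  have pi: "integrable M (\<lambda>\<omega>. norm (p s \<omega>))" if "0 \<le> s" for s
    using pN pM[OF that] by (intro integrable_const_bound[of _ N]) auto
  define v where "v s \<omega> = 2 *\<^sub>R p s \<omega>" for s \<omega>
  have vF: "v s \<in> borel_measurable (F s)" if "0 \<le> s" for s unfolding v_def using pF[OF that] by measurable
  have v2: "(norm (v s \<omega>))\<^sup>2 \<le> 4 * N\<^sup>2" for s \<omega>
    using power_mono[OF pN[of s \<omega>], of 2] by (simp add: v_def power_mult_distrib)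
  have vi: "integrable M (\<lambda>\<omega>. (norm (v s \<omega>))\<^sup>2)" if "0 \<le> s" for s
    using v2 measurable_F_M[OF that vF[OF that]] by (intro integrable_const_bound[of _ "4 * N\<^sup>2"]) auto
  have vB: "(\<integral>\<omega>. (norm (v s \<omega>))\<^sup>2 \<partial>M) \<le> 4 * N\<^sup>2" if "0 \<le> s" for s
    using integral_mono[OF vi[OF that], of "\<lambda>_. 4 * N\<^sup>2"] v2 by (simp add: prob_space)
  define Nn where "Nn n \<omega> = (\<Sum>i<Suc n. v (grid T n i) \<omega> \<bullet> (I (grid T n (Suc i)) \<omega> - I (grid T n i) \<omega>))" for n \<omega>
  define QI where "QI n \<omega> = (\<Sum>i<Suc n. (norm (I (grid T n (Suc i)) \<omega> - I (grid T n i) \<omega>))\<^sup>2)" for n \<omega>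
  define QP where "QP n \<omega> = 2 * norm a' * (\<Sum>i<Suc n. norm (p (grid T n i) \<omega>) * (T / real (Suc n)))" for n \<omega>
  note Nn = martingale_sum[OF \<open>0 \<le> T\<close> vF vi vB, folded Nn_def]
  note QI = quadratic_sum[OF \<open>0 \<le> T\<close>, folded QI_def]
  have g0: "0 \<le> grid T n i" for n i using \<open>0 \<le> T\<close> by (rule grid_nonneg)
  have QPi: "integrable M (QP n)" for n
    unfolding QP_def using pi[OF g0] by (intro integrable_mult_right Bochner_Integration.integrable_sum integrable_mult_left) auto
  have QPr: "(\<integral>\<omega>. QP n \<omega> \<partial>M) \<le> r" for n
  proof -
    have "(\<integral>\<omega>. QP n \<omega> \<partial>M) = (\<Sum>i<Suc n. (2 * norm a' * T * (\<integral>\<omega>. norm (p (grid T n i) \<omega>) \<partial>M)) / real (Suc n))"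
      unfolding QP_def using pi[OF g0]
      by (simp del: sum.lessThan_Suc of_nat_Suc add: sum_distrib_left mult_ac)
    also have "\<dots> \<le> (\<Sum>i<Suc n. r / real (Suc n))"
      using r[OF g0 grid_le[OF \<open>0 \<le> T\<close>], of _ n] unfolding p_def by (intro sum_mono divide_right_mono) auto
    also have "\<dots> = r" by (simp del: of_nat_Suc)
    finally show ?thesis .
  qed
  have QP0: "0 \<le> QP n \<omega>" for n \<omega> unfolding QP_def using \<open>0 \<le> T\<close> by (intro mult_nonneg_nonneg sum_nonneg) auto
  \<comment> \<open>the martingale sums have second moment at most \<open>4 N\<^sup>2 \<Lambda>\<close>, so that this \<open>k\<close> leaves an excess of at most 1\<close>
  define k where "k = N\<^sup>2 * \<Lambda> + 1"
  have "0 < k" using \<Lambda>_nonneg by (simp add: k_def add_nonneg_pos)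
  have kB: "4 * N\<^sup>2 * \<Lambda> / (4 * k) \<le> 1"
    using \<open>0 < k\<close> by (simp add: divide_simps) (simp add: k_def)
  obtain U where U: "U \<in> borel_measurable M" "(\<integral>\<^sup>+\<omega>. U \<omega> \<partial>M) \<le> ennreal (\<Lambda> + r + k + 4 * N\<^sup>2 * \<Lambda> / (4 * k))"
    "\<And>\<omega> y e. e \<longlonglongrightarrow> 0 \<Longrightarrow> (\<And>n. y \<le> Nn n \<omega> + (QI n \<omega> + QP n \<omega>) + e n) \<Longrightarrow> ennreal (y + k) \<le> U \<omega>"
  proof (rule limit_upper_bound[of Nn "\<lambda>n \<omega>. QI n \<omega> + QP n \<omega>" "4 * N\<^sup>2 * \<Lambda>" "\<Lambda> + r" k])
    show "(\<lambda>\<omega>. QI n \<omega> + QP n \<omega>) \<in> borel_measurable M" for n using QI(1) QPi by auto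
    show "0 \<le> QI n \<omega> + QP n \<omega>" for n \<omega> using QP0[of n \<omega>] by (simp add: QI_def sum_nonneg)
    show "integrable M (\<lambda>\<omega>. QI n \<omega> + QP n \<omega>)" for n using QI(2) QPi by auto
    show "(\<integral>\<omega>. QI n \<omega> + QP n \<omega> \<partial>M) \<le> \<Lambda> + r" for n
      using QI(2,3)[of n] QPi[of n] QPr[of n] by simp
  qed (use Nn \<open>0 < k\<close> in auto)
  have le: "AE \<omega> in M. ennreal (huber N (X T \<omega> - a) + k) \<le> U \<omega> + ennreal ((norm (X 0 \<omega> - a))\<^sup>2)"
    using solution_grid_bounds[OF \<open>0 < T\<close> assms(2,3)] AE_space
  proof eventually_elim
    case (elim \<omega>)
    then obtain e where "grid_bounds T (\<lambda>t. X t \<omega>) (\<lambda>t. I t \<omega>) a a' e" by blast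
    note e = grid_boundsD[OF this]
    have Xc: "continuous_on {0..T} (\<lambda>t. X t \<omega>)" using elim by (intro paths_continuous) simp
    obtain \<rho> where \<rho>: "\<rho> \<longlonglongrightarrow> (0::real)" "\<And>n. 0 \<le> \<rho> n"
      "\<And>n i s. i \<le> n \<Longrightarrow> s \<in> {grid T n i..grid T n (Suc i)} \<Longrightarrow> dist (X s \<omega>) (X (grid T n i) \<omega>) \<le> \<rho> n"
      using modulus_of_continuity[OF \<open>0 \<le> T\<close> Xc] by blast
    have "huber N (X T \<omega> - a) - huber N (X 0 \<omega> - a)
        \<le> Nn n \<omega> + (QI n \<omega> + QP n \<omega>) + (3 * e n + 2 * norm a' * T * \<rho> n)" for n
    proof -
      let ?x = "\<lambda>i. X (grid T n i) \<omega>" and ?I = "\<lambda>i. I (grid T n i) \<omega>"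
      define w where "w i = shrink N (?x i - a)" for i
      have w: "0 \<le> w i \<and> w i \<le> 1" for i unfolding w_def using shrink_bounds[OF \<open>0 < N\<close>] by blast
      have pw: "p (grid T n i) \<omega> = w i *\<^sub>R (?x i - a)" for i by (simp add: p_def w_def)
      let ?J = "\<lambda>i. LINT s:{grid T n i<..grid T n (Suc i)}|lborel. (X s \<omega> - a) \<bullet> a'"
      have J: "- (w i * ?J i) \<le> norm a' * (norm (p (grid T n i) \<omega>) * (T / real (Suc n)))
          + norm a' * (\<rho> n * (T / real (Suc n)))" if "i < Suc n" for i
      proof -
        let ?l = "grid T n i" and ?r = "grid T n (Suc i)"
        have lr: "0 \<le> ?l" "?l \<le> ?r" "?r \<le> T"
          using \<open>0 \<le> T\<close> that by (auto intro: grid_nonneg grid_mono grid_le)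
        have c: "continuous_on {?l..?r} (\<lambda>s. (X s \<omega> - a) \<bullet> a')"
          using lr by (intro continuous_intros continuous_on_subset[OF Xc]) auto
        have int: "set_integrable lborel {?l<..?r} (\<lambda>s. (X s \<omega> - a) \<bullet> a')"
          by (rule set_integrable_subset[OF borel_integrable_atLeastAtMost'[OF c]]) auto
        have const: "set_integrable lborel {?l<..?r} (\<lambda>s. c)" for c :: real
          unfolding set_integrable_def using lr
          by (intro integrable_scaleR_left integrable_real_indicator) auto
        have "norm (?J i) \<le> (LINT s:{?l<..?r}|lborel. norm ((X s \<omega> - a) \<bullet> a'))"
          by (rule set_integral_norm_bound[OF int])
        also have "\<dots> \<le> (LINT s:{?l<..?r}|lborel. norm a' * (norm (?x i - a) + \<rho> n))"
        proof (rule set_integral_mono)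
          show "set_integrable lborel {?l<..?r} (\<lambda>s. norm ((X s \<omega> - a) \<bullet> a'))"
            by (rule set_integrable_norm[OF int])
          fix s assume "s \<in> {?l<..?r}"
          then have "dist (X s \<omega>) (?x i) \<le> \<rho> n" using that by (intro \<rho>(3)) auto
          then have "norm (X s \<omega> - a) \<le> norm (?x i - a) + \<rho> n"
            using norm_triangle_ineq[of "X s \<omega> - ?x i" "?x i - a"] by (simp add: dist_norm)
          then have "norm (X s \<omega> - a) * norm a' \<le> (norm (?x i - a) + \<rho> n) * norm a'"
            by (rule mult_right_mono) simp
          then show "norm ((X s \<omega> - a) \<bullet> a') \<le> norm a' * (norm (?x i - a) + \<rho> n)"
            using Cauchy_Schwarz_ineq2[of "X s \<omega> - a" a'] by (simp add: mult.commute)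
        qed (rule const)
        also have "\<dots> = (?r - ?l) * (norm a' * (norm (?x i - a) + \<rho> n))"
          using lr by (simp add: set_lebesgue_integral_def)
        finally have "norm (?J i) \<le> (T / real (Suc n)) * (norm a' * (norm (?x i - a) + \<rho> n))"
          unfolding grid_step .
        then have "w i * norm (?J i) \<le> w i * ((T / real (Suc n)) * (norm a' * (norm (?x i - a) + \<rho> n)))"
          using w by (intro mult_left_mono) auto
        moreover have "- (w i * ?J i) \<le> w i * norm (?J i)"
          using w[of i] mult_left_mono[of "- ?J i" "norm (?J i)" "w i"] by simp
        moreover have "w i * ((T / real (Suc n)) * (norm a' * (norm (?x i - a) + \<rho> n)))
          = norm a' * (norm (p (grid T n i) \<omega>) * (T / real (Suc n))) + w i * (norm a' * (\<rho> n * (T / real (Suc n))))"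
        proof -
          have "norm (p (grid T n i) \<omega>) = w i * norm (?x i - a)" unfolding pw using w[of i] by simp
          then show ?thesis by (simp only:) (simp only: algebra_simps)
        qed
        moreover have "w i * (norm a' * (\<rho> n * (T / real (Suc n)))) \<le> 1 * (norm a' * (\<rho> n * (T / real (Suc n))))"
          using w[of i] \<rho>(2)[of n] \<open>0 \<le> T\<close> by (intro mult_right_mono mult_nonneg_nonneg) auto
        ultimately show ?thesis by linarith
      qed
      have "huber N (X T \<omega> - a) - huber N (X 0 \<omega> - a) = (\<Sum>i<Suc n. huber N (?x (Suc i) - a) - huber N (?x i - a))"
        by (subst sum_lessThan_telescope) simp
      also have "\<dots> \<le> (\<Sum>i<Suc n. 2 * (w i * ((?x i - a) \<bullet> (?x (Suc i) - ?x i))) + (norm (?x (Suc i) - ?x i))\<^sup>2)"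
      proof (rule sum_mono)
        fix i
        show "huber N (?x (Suc i) - a) - huber N (?x i - a)
            \<le> 2 * (w i * ((?x i - a) \<bullet> (?x (Suc i) - ?x i))) + (norm (?x (Suc i) - ?x i))\<^sup>2"
          using huber_increment[OF \<open>0 < N\<close>, of "?x (Suc i) - a" "?x i - a"] by (simp add: w_def)
      qed
      also have "\<dots> = 2 * (\<Sum>i<Suc n. w i * ((?x i - a) \<bullet> (?x (Suc i) - ?x i))) + (\<Sum>i<Suc n. (norm (?x (Suc i) - ?x i))\<^sup>2)"
        by (simp only: sum.distrib sum_distrib_left)
      also have "\<dots> \<le> 2 * ((\<Sum>i<Suc n. w i * ((?x i - a) \<bullet> (?I (Suc i) - ?I i))) - (\<Sum>i<Suc n. w i * ?J i) + e n)
          + (QI n \<omega> + e n)"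
        by (intro add_mono mult_left_mono e(3)[OF w] e(2)[of n, folded QI_def]) auto
      also have "\<dots> = 2 * (\<Sum>i<Suc n. w i * ((?x i - a) \<bullet> (?I (Suc i) - ?I i))) + 2 * (\<Sum>i<Suc n. - (w i * ?J i))
          + QI n \<omega> + 3 * e n"
        by (simp only: sum_negf) simp
      also have "2 * (\<Sum>i<Suc n. w i * ((?x i - a) \<bullet> (?I (Suc i) - ?I i))) = Nn n \<omega>"
        unfolding Nn_def v_def pw by (simp only: sum_distrib_left inner_scaleR_left)
      also have "(\<Sum>i<Suc n. - (w i * ?J i)) \<le> (\<Sum>i<Suc n. norm a' * (norm (p (grid T n i) \<omega>) * (T / real (Suc n)))
          + norm a' * (\<rho> n * (T / real (Suc n))))"
        using J by (intro sum_mono) auto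
      also have "\<dots> = norm a' * (\<Sum>i<Suc n. norm (p (grid T n i) \<omega>) * (T / real (Suc n))) + norm a' * (\<rho> n * T)"
        by (simp only: sum.distrib sum_distrib_left[symmetric]) (simp del: sum.lessThan_Suc of_nat_Suc)
      finally show ?thesis by (simp add: QP_def algebra_simps)
    qed
    moreover have "(\<lambda>n. 3 * e n + 2 * norm a' * T * \<rho> n) \<longlonglongrightarrow> 0"
      using tendsto_add[OF tendsto_mult_left[OF e(1), of 3] tendsto_mult_left[OF \<rho>(1), of "2 * norm a' * T"]] by simp
    ultimately have "ennreal (huber N (X T \<omega> - a) - huber N (X 0 \<omega> - a) + k) \<le> U \<omega>"
      by (intro U(3))
    then have "ennreal (huber N (X T \<omega> - a) - huber N (X 0 \<omega> - a) + k) + ennreal (huber N (X 0 \<omega> - a))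
        \<le> U \<omega> + ennreal ((norm (X 0 \<omega> - a))\<^sup>2)"
      using huber_bounds(2)[OF \<open>0 < N\<close>] by (intro add_mono ennreal_leI) auto
    moreover have "ennreal (huber N (X T \<omega> - a) + k)
        \<le> ennreal (huber N (X T \<omega> - a) - huber N (X 0 \<omega> - a) + k) + ennreal (huber N (X 0 \<omega> - a))"
      using ennreal_add_le[OF huber_bounds(1)[OF \<open>0 < N\<close>],
          of "huber N (X T \<omega> - a) - huber N (X 0 \<omega> - a) + k" "X 0 \<omega> - a"] by simp
    ultimately show ?case by (rule order_trans[rotated])
  qed
  have huM: "(\<lambda>\<omega>. huber N (X T \<omega> - a)) \<in> borel_measurable M" using X_measurable[OF \<open>0 \<le> T\<close>] by measurable
  have "(\<integral>\<^sup>+\<omega>. ennreal (huber N (X T \<omega> - a)) \<partial>M) + ennreal k = (\<integral>\<^sup>+\<omega>. ennreal (huber N (X T \<omega> - a)) + ennreal k \<partial>M)"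
    using huM by (subst nn_integral_add) (auto simp: emeasure_space_1)
  also have "\<dots> = (\<integral>\<^sup>+\<omega>. ennreal (huber N (X T \<omega> - a) + k) \<partial>M)"
    using \<open>0 < k\<close> by (intro nn_integral_cong) (simp add: ennreal_plus huber_bounds(1)[OF \<open>0 < N\<close>])
  also have "\<dots> \<le> (\<integral>\<^sup>+\<omega>. U \<omega> + ennreal ((norm (X 0 \<omega> - a))\<^sup>2) \<partial>M)" by (rule nn_integral_mono_AE[OF le])
  also have "\<dots> = (\<integral>\<^sup>+\<omega>. U \<omega> \<partial>M) + ennreal (\<integral>\<omega>. (norm (X 0 \<omega> - a))\<^sup>2 \<partial>M)"
    using U(1) X0_minus[of a] by (subst nn_integral_add) (auto simp: nn_integral_eq_integral)
  also have "\<dots> \<le> ennreal (\<Lambda> + r + k + 1) + ennreal (\<integral>\<omega>. (norm (X 0 \<omega> - a))\<^sup>2 \<partial>M)"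
    using U(2) kB by (intro add_mono order_refl) (erule order_trans, intro ennreal_leI, simp)
  also have "\<dots> = ennreal ((\<integral>\<omega>. (norm (X 0 \<omega> - a))\<^sup>2 \<partial>M) + \<Lambda> + 1 + r) + ennreal k"
  proof -
    have "0 \<le> (\<integral>\<omega>. QP 0 \<omega> \<partial>M)" using QP0 by simp
    then have "0 \<le> r" using QPr[of 0] by linarith
    then show ?thesis using \<Lambda>_nonneg \<open>0 < k\<close> by (simp add: ennreal_plus[symmetric] algebra_simps del: ennreal_plus)
  qed
  finally show ?thesis by (simp add: ennreal_add_left_cancel_le add.commute)
qed

end

context averaged_solution begin

text \<open>The contribution \<open>r\<close> of \<open>a'\<close> is first bounded crudely by means of \<open>N\<close>. This shows that the supremum
\<open>G\<close> of the moments over \<open>{0..T}\<close> is finite, and then \<open>r\<close> can be taken as \<open>G / 2\<close> plus a constant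
in which \<open>N\<close> does not occur; this gives \<open>G \<le> const + G / 2\<close>.\<close>

lemma huber_moment:
  assumes "0 < N" "a \<in> C" "a' \<in> A a" "0 < T" "0 \<le> s" "s \<le> T"
  shows "(\<integral>\<^sup>+\<omega>. ennreal (huber N (X s \<omega> - a)) \<partial>M)
    \<le> ennreal (2 * ((\<integral>\<omega>. (norm (X 0 \<omega> - a))\<^sup>2 \<partial>M) + \<Lambda> + 1) + 4 * (norm a')\<^sup>2 * T\<^sup>2)"
proof -
  define c where "c = (\<integral>\<omega>. (norm (X 0 \<omega> - a))\<^sup>2 \<partial>M) + \<Lambda> + 1"
  have "0 \<le> (\<integral>\<omega>. (norm (X 0 \<omega> - a))\<^sup>2 \<partial>M)" by simp
  then have c0: "0 \<le> c" using \<Lambda>_nonneg unfolding c_def by linarith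
  define p where "p s \<omega> = norm (shrink N (X s \<omega> - a) *\<^sub>R (X s \<omega> - a))" for s \<omega>
  have pM[measurable]: "p s \<in> borel_measurable M" if "0 \<le> s" for s
    unfolding p_def using X_measurable[OF that] by measurable
  have pN: "0 \<le> p s \<omega>" "p s \<omega> \<le> N" for s \<omega> unfolding p_def using shrink_bounds(3)[OF \<open>0 < N\<close>] by auto
  have pi: "integrable M (p s)" if "0 \<le> s" for s
    using pN pM[OF that] by (intro integrable_const_bound[of _ N]) auto
  have huM[measurable]: "(\<lambda>\<omega>. huber N (X s \<omega> - a)) \<in> borel_measurable M" if "0 \<le> s" for s
    using X_measurable[OF that] by measurable
  have step: "(\<integral>\<^sup>+\<omega>. ennreal (huber N (X s \<omega> - a)) \<partial>M) \<le> ennreal (c + r)"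
    if r: "\<And>s. 0 \<le> s \<Longrightarrow> s \<le> T \<Longrightarrow> 2 * norm a' * T * (\<integral>\<omega>. p s \<omega> \<partial>M) \<le> r" and s: "0 \<le> s" "s \<le> T" for s r
  proof (cases "s = 0")
    case True
    have "0 \<le> 2 * norm a' * T * (\<integral>\<omega>. p 0 \<omega> \<partial>M)" using pN \<open>0 < T\<close> by (intro mult_nonneg_nonneg integral_nonneg) auto
    then have "0 \<le> r" using r[OF order_refl less_imp_le[OF \<open>0 < T\<close>]] by linarith
    have "(\<integral>\<^sup>+\<omega>. ennreal (huber N (X 0 \<omega> - a)) \<partial>M) \<le> (\<integral>\<^sup>+\<omega>. ennreal ((norm (X 0 \<omega> - a))\<^sup>2) \<partial>M)"
      using huber_bounds(2)[OF \<open>0 < N\<close>] by (intro nn_integral_mono ennreal_leI)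
    also have "\<dots> = ennreal (\<integral>\<omega>. (norm (X 0 \<omega> - a))\<^sup>2 \<partial>M)"
      using X0_minus by (intro nn_integral_eq_integral) auto
    also have "\<dots> \<le> ennreal (c + r)"
      using \<open>0 \<le> r\<close> \<Lambda>_nonneg unfolding c_def by (intro ennreal_leI) linarith
    finally show ?thesis using True by simp
  next
    case False
    then have "0 < s" using s by simp
    show ?thesis
      unfolding c_def
    proof (rule huber_moment_step[OF \<open>0 < N\<close> assms(2,3) \<open>0 < s\<close>])
      fix u assume u: "0 \<le> u" "u \<le> s"
      have "2 * norm a' * s * (\<integral>\<omega>. p u \<omega> \<partial>M) \<le> 2 * norm a' * T * (\<integral>\<omega>. p u \<omega> \<partial>M)"
        using pN s by (intro mult_right_mono mult_left_mono integral_nonneg) auto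
      also have "\<dots> \<le> r" using r[of u] u s by simp
      finally show "2 * norm a' * s * (\<integral>\<omega>. norm (shrink N (X u \<omega> - a) *\<^sub>R (X u \<omega> - a)) \<partial>M) \<le> r"
        by (simp add: p_def)
    qed
  qed
  define g where "g s = (\<integral>\<omega>. huber N (X s \<omega> - a) \<partial>M)" for s
  have g: "integrable M (\<lambda>\<omega>. huber N (X s \<omega> - a)) \<and> g s \<le> c + r"
    if r: "\<And>s. 0 \<le> s \<Longrightarrow> s \<le> T \<Longrightarrow> 2 * norm a' * T * (\<integral>\<omega>. p s \<omega> \<partial>M) \<le> r"
      and s: "0 \<le> s" "s \<le> T" for s r
  proof -
    have "0 \<le> 2 * norm a' * T * (\<integral>\<omega>. p 0 \<omega> \<partial>M)" using pN \<open>0 < T\<close> by (intro mult_nonneg_nonneg integral_nonneg) auto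
    then have "0 \<le> r" using r[OF order_refl less_imp_le[OF \<open>0 < T\<close>]] by linarith
    then show ?thesis
      using step[OF r s] huM[OF s(1)] huber_bounds(1)[OF \<open>0 < N\<close>] c0 unfolding g_def
      by (intro integral_le_of_nn_integral_le) auto
  qed
  have crude: "2 * norm a' * T * (\<integral>\<omega>. p u \<omega> \<partial>M) \<le> 2 * norm a' * T * N" if "0 \<le> u" for u
  proof -
    have "(\<integral>\<omega>. p u \<omega> \<partial>M) \<le> N"
      using integral_mono[OF pi[OF that], of "\<lambda>_. N"] pN by (simp add: prob_space)
    then show ?thesis using \<open>0 < T\<close> by (intro mult_left_mono) auto
  qed
  have hi: "integrable M (\<lambda>\<omega>. huber N (X s \<omega> - a))" if "0 \<le> s" "s \<le> T" for s
    using g[OF crude that] by blast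
  \<comment> \<open>\<open>2 x y \<le> x\<^sup>2 / 2 + 2 y\<^sup>2\<close>: only half of the moment returns on the right\<close>
  have absorb: "2 * norm a' * T * (\<integral>\<omega>. p s \<omega> \<partial>M) \<le> g s / 2 + 2 * (norm a')\<^sup>2 * T\<^sup>2" if s: "0 \<le> s" "s \<le> T" for s
  proof -
    have "2 * norm a' * T * (\<integral>\<omega>. p s \<omega> \<partial>M) = (\<integral>\<omega>. 2 * norm a' * T * p s \<omega> \<partial>M)" by simp
    also have "\<dots> \<le> (\<integral>\<omega>. huber N (X s \<omega> - a) / 2 + 2 * (norm a')\<^sup>2 * T\<^sup>2 \<partial>M)"
    proof (rule integral_mono)
      show "integrable M (\<lambda>\<omega>. 2 * norm a' * T * p s \<omega>)" using pi[OF s(1)] by simp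
      show "integrable M (\<lambda>\<omega>. huber N (X s \<omega> - a) / 2 + 2 * (norm a')\<^sup>2 * T\<^sup>2)" using hi[OF s] by simp
      fix \<omega>
      have "0 \<le> (p s \<omega> - 2 * norm a' * T)\<^sup>2 / 2" by simp
      also have "\<dots> = (p s \<omega>)\<^sup>2 / 2 + 2 * (norm a')\<^sup>2 * T\<^sup>2 - 2 * norm a' * T * p s \<omega>"
        by (simp add: power2_eq_square field_simps)
      finally show "2 * norm a' * T * p s \<omega> \<le> huber N (X s \<omega> - a) / 2 + 2 * (norm a')\<^sup>2 * T\<^sup>2"
        using shrink_le_huber[OF \<open>0 < N\<close>, of "X s \<omega> - a"] by (simp add: p_def)
    qed
    also have "\<dots> = g s / 2 + 2 * (norm a')\<^sup>2 * T\<^sup>2" using hi[OF s] by (simp add: g_def prob_space)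
    finally show ?thesis .
  qed
  define G where "G = (SUP s\<in>{0..T}. g s)"
  have bdd: "bdd_above (g ` {0..T})"
    using g[OF crude] by (intro bdd_aboveI[of _ "c + 2 * norm a' * T * N"]) auto
  have le_G: "g s \<le> G" if "0 \<le> s" "s \<le> T" for s
    unfolding G_def using that by (intro cSUP_upper bdd) auto
  have "g s \<le> c + (G / 2 + 2 * (norm a')\<^sup>2 * T\<^sup>2)" if "0 \<le> s" "s \<le> T" for s
  proof (rule conjunct2[OF g[OF _ that]])
    fix u assume u: "0 \<le> u" "u \<le> T"
    show "2 * norm a' * T * (\<integral>\<omega>. p u \<omega> \<partial>M) \<le> G / 2 + 2 * (norm a')\<^sup>2 * T\<^sup>2"
      using absorb[OF u] le_G[OF u] by linarith
  qed
  then have "G \<le> c + (G / 2 + 2 * (norm a')\<^sup>2 * T\<^sup>2)"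
    unfolding G_def[of] using \<open>0 < T\<close> by (intro cSUP_least) (auto simp: G_def)
  then have "g s \<le> 2 * c + 4 * (norm a')\<^sup>2 * T\<^sup>2" using le_G[OF assms(5,6)] by linarith
  then have "ennreal (g s) \<le> ennreal (2 * c + 4 * (norm a')\<^sup>2 * T\<^sup>2)" by (rule ennreal_leI)
  then show ?thesis
    using hi[OF assms(5,6)] huber_bounds(1)[OF \<open>0 < N\<close>] unfolding g_def c_def
    by (subst nn_integral_eq_integral) auto
qed

text \<open>The bound of the Huber moments is uniform in \<open>N\<close>, and on each path the Huber function agrees with the
square for large \<open>N\<close>.\<close>

lemma second_moment_bound:
  assumes "a \<in> C" "a' \<in> A a" "0 < T"
  obtains B where "0 \<le> B"
    and "\<And>s. 0 \<le> s \<Longrightarrow> s \<le> T \<Longrightarrow> integrable M (\<lambda>\<omega>. (norm (X s \<omega> - a))\<^sup>2)"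
    and "\<And>s. 0 \<le> s \<Longrightarrow> s \<le> T \<Longrightarrow> (\<integral>\<omega>. (norm (X s \<omega> - a))\<^sup>2 \<partial>M) \<le> B"
proof -
  define B where "B = 2 * ((\<integral>\<omega>. (norm (X 0 \<omega> - a))\<^sup>2 \<partial>M) + \<Lambda> + 1) + 4 * (norm a')\<^sup>2 * T\<^sup>2"
  have "0 \<le> B"
    using \<Lambda>_nonneg unfolding B_def by (intro add_nonneg_nonneg mult_nonneg_nonneg integral_nonneg) auto
  have main: "(\<integral>\<^sup>+\<omega>. ennreal ((norm (X s \<omega> - a))\<^sup>2) \<partial>M) \<le> ennreal B" if s: "0 \<le> s" "s \<le> T" for s
  proof -
    have lim: "(\<lambda>n. ennreal (huber (real (Suc n)) (X s \<omega> - a))) \<longlonglongrightarrow> ennreal ((norm (X s \<omega> - a))\<^sup>2)" for \<omega>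
    proof (rule tendsto_eventually)
      show "\<forall>\<^sub>F n in sequentially. ennreal (huber (real (Suc n)) (X s \<omega> - a)) = ennreal ((norm (X s \<omega> - a))\<^sup>2)"
        using eventually_ge_at_top[of "nat \<lceil>norm (X s \<omega> - a)\<rceil>"]
      proof eventually_elim
        case (elim n)
        then have "norm (X s \<omega> - a) \<le> real (Suc n)" by (simp add: nat_le_iff ceiling_le_iff)
        then show ?case by (simp add: huber_def del: of_nat_Suc)
      qed
    qed
    have [measurable]: "X s \<in> borel_measurable M" by (rule X_measurable[OF s(1)])
    have "(\<integral>\<^sup>+\<omega>. ennreal ((norm (X s \<omega> - a))\<^sup>2) \<partial>M)
        = (\<integral>\<^sup>+\<omega>. liminf (\<lambda>n. ennreal (huber (real (Suc n)) (X s \<omega> - a))) \<partial>M)"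
      using lim by (intro nn_integral_cong lim_imp_Liminf[symmetric]) auto
    also have "\<dots> \<le> liminf (\<lambda>n. \<integral>\<^sup>+\<omega>. ennreal (huber (real (Suc n)) (X s \<omega> - a)) \<partial>M)"
      by (rule nn_integral_liminf) measurable
    also have "\<dots> \<le> liminf (\<lambda>n::nat. ennreal B)"
      unfolding B_def using assms s by (intro Liminf_mono always_eventually allI huber_moment) auto
    also have "\<dots> = ennreal B" by (rule lim_imp_Liminf) auto
    finally show ?thesis .
  qed
  have "integrable M (\<lambda>\<omega>. (norm (X s \<omega> - a))\<^sup>2) \<and> (\<integral>\<omega>. (norm (X s \<omega> - a))\<^sup>2 \<partial>M) \<le> B"
    if s: "0 \<le> s" "s \<le> T" for s
    using main[OF s] X_measurable[OF s(1)] \<open>0 \<le> B\<close> by (intro integral_le_of_nn_integral_le) auto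
  then show ?thesis using that[OF \<open>0 \<le> B\<close>] by blast
qed

text \<open>Both \<open>R\<close> and \<open>k\<close> are independent of \<open>(y, y')\<close>, and the expectation of \<open>R\<close> exceeds \<open>k\<close> by a quantity
independent of \<open>t\<close>. The shift \<open>k\<close> makes the negative part of the martingale term harmless; it
grows with the second moments of \<open>X\<close> on \<open>{0..t}\<close>, but cancels at the end.\<close>

lemma gap_upper_bound:
  assumes "a \<in> C" "a' \<in> A a" "0 < t" "0 \<le> \<delta>"
  obtains R :: "'w \<Rightarrow> ennreal" and k where "R \<in> borel_measurable M" "0 < k"
    and "(\<integral>\<^sup>+\<omega>. R \<omega> \<partial>M) \<le> ennreal (2 * (\<integral>\<omega>. (norm (X 0 \<omega> - a))\<^sup>2 \<partial>M) + 2 * \<delta>\<^sup>2 + \<delta> * (1 + \<Lambda>) + \<Lambda> + 1 + k)"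
    and "\<And>y y'. y \<in> C \<Longrightarrow> y' \<in> A y \<Longrightarrow> dist a y \<le> \<delta> \<Longrightarrow>
      AE \<omega> in M. ennreal (2 * t * (y' \<bullet> (time_average X t \<omega> - y)) + k) \<le> R \<omega>"
proof -
  have "0 \<le> t" using \<open>0 < t\<close> by simp
  obtain B where B: "0 \<le> B"
    "\<And>s. 0 \<le> s \<Longrightarrow> s \<le> t \<Longrightarrow> integrable M (\<lambda>\<omega>. (norm (X s \<omega> - a))\<^sup>2)"
    "\<And>s. 0 \<le> s \<Longrightarrow> s \<le> t \<Longrightarrow> (\<integral>\<omega>. (norm (X s \<omega> - a))\<^sup>2 \<partial>M) \<le> B"
    using second_moment_bound[OF assms(1-3)] by blast
  define v where "v s \<omega> = 2 *\<^sub>R (X s \<omega> - a)" for s \<omega>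
  have vF: "v s \<in> borel_measurable (F s)" if "0 \<le> s" for s
    unfolding v_def using X_measurable_F[OF that] by measurable
  have v2: "(norm (v s \<omega>))\<^sup>2 = 4 * (norm (X s \<omega> - a))\<^sup>2" for s \<omega> by (simp add: v_def power_mult_distrib)
  have vi: "integrable M (\<lambda>\<omega>. (norm (v s \<omega>))\<^sup>2)" if "0 \<le> s" "s \<le> t" for s
    unfolding v2 using B(2)[OF that] by simp
  have vB: "(\<integral>\<omega>. (norm (v s \<omega>))\<^sup>2 \<partial>M) \<le> 4 * B" if "0 \<le> s" "s \<le> t" for s
    unfolding v2 using B(3)[OF that] by simp
  define N where "N n \<omega> = (\<Sum>i<Suc n. v (grid t n i) \<omega> \<bullet> (I (grid t n (Suc i)) \<omega> - I (grid t n i) \<omega>))" for n \<omega>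
  define Q where "Q n \<omega> = (\<Sum>i<Suc n. (norm (I (grid t n (Suc i)) \<omega> - I (grid t n i) \<omega>))\<^sup>2)" for n \<omega>
  note N = martingale_sum[OF \<open>0 \<le> t\<close> vF vi vB, folded N_def]
  note Q = quadratic_sum[OF \<open>0 \<le> t\<close>, folded Q_def]
  \<comment> \<open>the martingale sums have second moment at most \<open>4 B \<Lambda>\<close>, so that this \<open>k\<close> leaves an excess of at most 1\<close>
  define k where "k = B * \<Lambda> + 1"
  have "0 < k" using B(1) \<Lambda>_nonneg by (simp add: k_def add_nonneg_pos)
  have kB: "4 * B * \<Lambda> / (4 * k) \<le> 1"
    using \<open>0 < k\<close> by (simp add: divide_simps) (simp add: k_def)
  obtain U where U: "U \<in> borel_measurable M" "(\<integral>\<^sup>+\<omega>. U \<omega> \<partial>M) \<le> ennreal (\<Lambda> + k + 4 * B * \<Lambda> / (4 * k))"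
    "\<And>\<omega> y e. e \<longlonglongrightarrow> 0 \<Longrightarrow> (\<And>n. y \<le> N n \<omega> + Q n \<omega> + e n) \<Longrightarrow> ennreal (y + k) \<le> U \<omega>"
  proof (rule limit_upper_bound[of N Q "4 * B * \<Lambda>" \<Lambda> k])
    show "0 \<le> Q n \<omega>" for n \<omega> by (simp add: Q_def sum_nonneg)
  qed (use N Q \<open>0 < k\<close> in auto)
  define S where "S \<omega> = 2 * (norm (X 0 \<omega> - a))\<^sup>2 + 2 * \<delta>\<^sup>2 + 2 * \<delta> * norm (I t \<omega> - I 0 \<omega>)" for \<omega>
  have [measurable]: "X 0 \<in> borel_measurable M" "I t \<in> borel_measurable M" "I 0 \<in> borel_measurable M"
    using \<open>0 \<le> t\<close> by (auto intro: X_measurable I_measurable)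
  have S0: "0 \<le> S \<omega>" for \<omega> using \<open>0 \<le> \<delta>\<close> by (simp add: S_def)
  have I2: "integrable M (\<lambda>\<omega>. (norm (I t \<omega> - I 0 \<omega>))\<^sup>2)" "(\<integral>\<omega>. (norm (I t \<omega> - I 0 \<omega>))\<^sup>2 \<partial>M) \<le> \<Lambda>"
    using I_increment[of 0 t] L_bound[OF \<open>0 \<le> t\<close>] \<open>0 \<le> t\<close> by auto
  have I1: "integrable M (\<lambda>\<omega>. norm (I t \<omega> - I 0 \<omega>))"
  proof (rule square_integrable_imp_integrable[OF _ I2(1)])
    show "(\<lambda>\<omega>. norm (I t \<omega> - I 0 \<omega>)) \<in> borel_measurable M" by measurable
  qed
  have "(\<integral>\<omega>. 2 * norm (I t \<omega> - I 0 \<omega>) \<partial>M) \<le> (\<integral>\<omega>. 1 + (norm (I t \<omega> - I 0 \<omega>))\<^sup>2 \<partial>M)"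
  proof (rule integral_mono)
    show "2 * norm (I t \<omega> - I 0 \<omega>) \<le> 1 + (norm (I t \<omega> - I 0 \<omega>))\<^sup>2" for \<omega>
      using sum_squares_bound[of 1 "norm (I t \<omega> - I 0 \<omega>)"] by simp
  qed (use I1 I2 in auto)
  then have I1le: "2 * (\<integral>\<omega>. norm (I t \<omega> - I 0 \<omega>) \<partial>M) \<le> 1 + \<Lambda>" using I2 by (simp add: prob_space)
  have Si: "integrable M S" unfolding S_def using X0_minus[of a] I1 by auto
  have "(\<integral>\<omega>. S \<omega> \<partial>M) = 2 * (\<integral>\<omega>. (norm (X 0 \<omega> - a))\<^sup>2 \<partial>M) + 2 * \<delta>\<^sup>2 + \<delta> * (2 * (\<integral>\<omega>. norm (I t \<omega> - I 0 \<omega>) \<partial>M))"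
    unfolding S_def using X0_minus[of a] I1 by (simp add: prob_space)
  also have "\<dots> \<le> 2 * (\<integral>\<omega>. (norm (X 0 \<omega> - a))\<^sup>2 \<partial>M) + 2 * \<delta>\<^sup>2 + \<delta> * (1 + \<Lambda>)"
    using I1le \<open>0 \<le> \<delta>\<close> by (intro add_left_mono mult_left_mono)
  finally have Sle: "(\<integral>\<omega>. S \<omega> \<partial>M) \<le> 2 * (\<integral>\<omega>. (norm (X 0 \<omega> - a))\<^sup>2 \<partial>M) + 2 * \<delta>\<^sup>2 + \<delta> * (1 + \<Lambda>)" .
  show ?thesis
  proof (rule that[of "\<lambda>\<omega>. U \<omega> + ennreal (S \<omega>)" k])
    show "(\<lambda>\<omega>. U \<omega> + ennreal (S \<omega>)) \<in> borel_measurable M" using U(1) Si by measurable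
    have SS: "0 \<le> (\<integral>\<omega>. S \<omega> \<partial>M)" using S0 by simp
    have "(\<integral>\<^sup>+\<omega>. U \<omega> + ennreal (S \<omega>) \<partial>M) = (\<integral>\<^sup>+\<omega>. U \<omega> \<partial>M) + ennreal (\<integral>\<omega>. S \<omega> \<partial>M)"
      using U(1) Si S0 by (subst nn_integral_add) (auto simp: nn_integral_eq_integral)
    also have "\<dots> \<le> ennreal (\<Lambda> + k + 1) + ennreal (\<integral>\<omega>. S \<omega> \<partial>M)"
      using U(2) kB by (intro add_mono order_refl) (erule order_trans, intro ennreal_leI, simp)
    also have "\<dots> = ennreal (\<Lambda> + k + 1 + (\<integral>\<omega>. S \<omega> \<partial>M))"
      using SS \<Lambda>_nonneg \<open>0 < k\<close> by (simp add: ennreal_plus[symmetric] del: ennreal_plus)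
    also have "\<dots> \<le> ennreal (2 * (\<integral>\<omega>. (norm (X 0 \<omega> - a))\<^sup>2 \<partial>M) + 2 * \<delta>\<^sup>2 + \<delta> * (1 + \<Lambda>) + \<Lambda> + 1 + k)"
      using Sle by (intro ennreal_leI) linarith
    finally show "(\<integral>\<^sup>+\<omega>. U \<omega> + ennreal (S \<omega>) \<partial>M)
      \<le> ennreal (2 * (\<integral>\<omega>. (norm (X 0 \<omega> - a))\<^sup>2 \<partial>M) + 2 * \<delta>\<^sup>2 + \<delta> * (1 + \<Lambda>) + \<Lambda> + 1 + k)" .
  next
    fix y y' assume y: "y \<in> C" "y' \<in> A y" "dist a y \<le> \<delta>"
    show "AE \<omega> in M. ennreal (2 * t * (y' \<bullet> (time_average X t \<omega> - y)) + k) \<le> U \<omega> + ennreal (S \<omega>)"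
      using solution_grid_bounds[OF \<open>0 < t\<close> y(1,2)] AE_space
    proof eventually_elim
      case (elim \<omega>)
      then obtain e where "grid_bounds t (\<lambda>s. X s \<omega>) (\<lambda>s. I s \<omega>) y y' e" by blast
      note e = grid_boundsD[OF this]
      have Xc: "continuous_on {0..t} (\<lambda>s. X s \<omega>)" using elim by (intro paths_continuous) simp
      have Xi: "set_integrable lborel {0..t} (\<lambda>s. X s \<omega>)" by (rule borel_integrable_atLeastAtMost'[OF Xc])
      have inti: "set_integrable lborel {0..t} (\<lambda>s. (X s \<omega> - y) \<bullet> y')"
        by (intro borel_integrable_atLeastAtMost' continuous_intros Xc)
      define J where "J s = (LINT r:{0..s}|lborel. (X r \<omega> - y) \<bullet> y')" for s
      have Jt: "J t = t * (y' \<bullet> (time_average X t \<omega> - y))"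
      proof -
        have c: "set_integrable lborel {0..t} (\<lambda>s. y)" by (intro borel_integrable_atLeastAtMost' continuous_intros)
        have "J t = (LINT r:{0..t}|lborel. X r \<omega> - y) \<bullet> y'"
          using integral_inner_left[of y' lborel "\<lambda>r. indicator {0..t} r *\<^sub>R (X r \<omega> - y)"] set_integral_diff(1)[OF Xi c]
          by (simp add: J_def set_lebesgue_integral_def set_integrable_def)
        also have "(LINT r:{0..t}|lborel. X r \<omega> - y) = (LINT r:{0..t}|lborel. X r \<omega>) - t *\<^sub>R y"
          using set_integral_diff(2)[OF Xi c] \<open>0 < t\<close> by (simp add: set_lebesgue_integral_def)
        also have "\<dots> = t *\<^sub>R (time_average X t \<omega> - y)"
          using \<open>0 < t\<close> by (simp add: time_average_def scaleR_diff_right)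
        finally show ?thesis by (simp add: inner_commute)
      qed
      have "2 * J t - (norm (X 0 \<omega> - y))\<^sup>2 - 2 * ((a - y) \<bullet> (I t \<omega> - I 0 \<omega>)) \<le> N n \<omega> + Q n \<omega> + 3 * e n" for n
      proof -
        let ?x = "\<lambda>i. X (grid t n i) \<omega>" and ?I = "\<lambda>i. I (grid t n i) \<omega>"
        have "0 \<le> (norm (X t \<omega> - y))\<^sup>2" by simp
        then have "- (norm (X 0 \<omega> - y))\<^sup>2 \<le> (norm (X t \<omega> - y))\<^sup>2 - (norm (X 0 \<omega> - y))\<^sup>2" by linarith
        also have "\<dots> = (\<Sum>i<Suc n. (norm (?x (Suc i) - y))\<^sup>2 - (norm (?x i - y))\<^sup>2)"
          by (subst sum_lessThan_telescope) simp
        also have "\<dots> = (\<Sum>i<Suc n. 2 * (1 * ((?x i - y) \<bullet> (?x (Suc i) - ?x i))) + (norm (?x (Suc i) - ?x i))\<^sup>2)"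
        proof (rule sum.cong[OF refl])
          fix i
          have "?x (Suc i) - y = (?x i - y) + (?x (Suc i) - ?x i)" by simp
          then show "(norm (?x (Suc i) - y))\<^sup>2 - (norm (?x i - y))\<^sup>2
              = 2 * (1 * ((?x i - y) \<bullet> (?x (Suc i) - ?x i))) + (norm (?x (Suc i) - ?x i))\<^sup>2"
            using dot_norm[of "?x i - y" "?x (Suc i) - ?x i"] by (simp add: field_simps)
        qed
        also have "\<dots> = 2 * (\<Sum>i<Suc n. 1 * ((?x i - y) \<bullet> (?x (Suc i) - ?x i))) + (\<Sum>i<Suc n. (norm (?x (Suc i) - ?x i))\<^sup>2)"
          by (simp only: sum.distrib sum_distrib_left)
        also have "\<dots> \<le> 2 * ((\<Sum>i<Suc n. 1 * ((?x i - y) \<bullet> (?I (Suc i) - ?I i)))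
            - (\<Sum>i<Suc n. 1 * (LINT s:{grid t n i<..grid t n (Suc i)}|lborel. (X s \<omega> - y) \<bullet> y')) + e n) + (Q n \<omega> + e n)"
          by (intro add_mono mult_left_mono e(3) e(2)[of n, folded Q_def]) auto
        also have "(\<Sum>i<Suc n. 1 * (LINT s:{grid t n i<..grid t n (Suc i)}|lborel. (X s \<omega> - y) \<bullet> y')) = J t"
        proof -
          have "(LINT s:{grid t n i<..grid t n (Suc i)}|lborel. (X s \<omega> - y) \<bullet> y')
              = J (grid t n (Suc i)) - J (grid t n i)" if "i < Suc n" for i
            unfolding J_def using \<open>0 \<le> t\<close> that
            by (intro set_integral_Ioc_eq_diff[OF inti] grid_nonneg grid_mono grid_le) auto
          then have "(\<Sum>i<Suc n. 1 * (LINT s:{grid t n i<..grid t n (Suc i)}|lborel. (X s \<omega> - y) \<bullet> y'))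
              = (\<Sum>i<Suc n. J (grid t n (Suc i)) - J (grid t n i))" by (intro sum.cong) auto
          also have "\<dots> = J t - J 0" by (subst sum_lessThan_telescope) simp
          also have "J 0 = 0"
            unfolding J_def set_lebesgue_integral_def
            by (rule integral_eq_zero_AE) (auto intro!: AE_I'[of "{0}"])
          finally show ?thesis by simp
        qed
        also have "(\<Sum>i<Suc n. 1 * ((?x i - y) \<bullet> (?I (Suc i) - ?I i))) = N n \<omega> / 2 + (a - y) \<bullet> (I t \<omega> - I 0 \<omega>)"
        proof -
          have "(\<Sum>i<Suc n. 1 * ((?x i - y) \<bullet> (?I (Suc i) - ?I i)))
              = (\<Sum>i<Suc n. v (grid t n i) \<omega> \<bullet> (?I (Suc i) - ?I i) / 2 + (a - y) \<bullet> (?I (Suc i) - ?I i))"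
            by (rule sum.cong[OF refl]) (simp add: v_def inner_diff_left diff_divide_distrib)
          also have "\<dots> = N n \<omega> / 2 + (a - y) \<bullet> (\<Sum>i<Suc n. ?I (Suc i) - ?I i)"
            unfolding N_def by (simp only: sum.distrib sum_divide_distrib inner_sum_right)
          also have "(\<Sum>i<Suc n. ?I (Suc i) - ?I i) = I t \<omega> - I 0 \<omega>"
            by (subst sum_lessThan_telescope) simp
          finally show ?thesis .
        qed
        finally show ?thesis by (simp add: algebra_simps)
      qed
      moreover have "(\<lambda>n. 3 * e n) \<longlonglongrightarrow> 0" using tendsto_mult_left[OF e(1), of 3] by simp
      ultimately have "ennreal (2 * J t - (norm (X 0 \<omega> - y))\<^sup>2 - 2 * ((a - y) \<bullet> (I t \<omega> - I 0 \<omega>)) + k) \<le> U \<omega>"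
        by (intro U(3))
      moreover have "(norm (X 0 \<omega> - y))\<^sup>2 + 2 * ((a - y) \<bullet> (I t \<omega> - I 0 \<omega>)) \<le> S \<omega>"
      proof -
        have "norm (X 0 \<omega> - y) \<le> norm (X 0 \<omega> - a) + \<delta>"
          using norm_triangle_ineq[of "X 0 \<omega> - a" "a - y"] y(3) by (simp add: dist_norm)
        then have "(norm (X 0 \<omega> - y))\<^sup>2 \<le> (norm (X 0 \<omega> - a) + \<delta>)\<^sup>2" by (intro power_mono) auto
        also have "\<dots> \<le> 2 * (norm (X 0 \<omega> - a))\<^sup>2 + 2 * \<delta>\<^sup>2"
          using sum_squares_bound[of "norm (X 0 \<omega> - a)" \<delta>] by (simp add: power2_sum)
        finally have 1: "(norm (X 0 \<omega> - y))\<^sup>2 \<le> 2 * (norm (X 0 \<omega> - a))\<^sup>2 + 2 * \<delta>\<^sup>2" .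
        have "(a - y) \<bullet> (I t \<omega> - I 0 \<omega>) \<le> norm (a - y) * norm (I t \<omega> - I 0 \<omega>)" by (rule norm_cauchy_schwarz)
        also have "\<dots> \<le> \<delta> * norm (I t \<omega> - I 0 \<omega>)" using y(3) by (intro mult_right_mono) (auto simp: dist_norm)
        finally show ?thesis using 1 by (simp add: S_def)
      qed
      ultimately show ?case
      proof -
        assume 1: "ennreal (2 * J t - (norm (X 0 \<omega> - y))\<^sup>2 - 2 * ((a - y) \<bullet> (I t \<omega> - I 0 \<omega>)) + k) \<le> U \<omega>"
          and 2: "(norm (X 0 \<omega> - y))\<^sup>2 + 2 * ((a - y) \<bullet> (I t \<omega> - I 0 \<omega>)) \<le> S \<omega>"
        have "ennreal (2 * t * (y' \<bullet> (time_average X t \<omega> - y)) + k)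
            \<le> ennreal ((2 * J t - (norm (X 0 \<omega> - y))\<^sup>2 - 2 * ((a - y) \<bullet> (I t \<omega> - I 0 \<omega>)) + k) + S \<omega>)"
          using 2 by (intro ennreal_leI) (simp add: Jt)
        also have "\<dots> \<le> ennreal (2 * J t - (norm (X 0 \<omega> - y))\<^sup>2 - 2 * ((a - y) \<bullet> (I t \<omega> - I 0 \<omega>)) + k) + ennreal (S \<omega>)"
          by (rule ennreal_add_le[OF S0])
        also have "\<dots> \<le> U \<omega> + ennreal (S \<omega>)" using 1 by (rule add_right_mono)
        finally show ?thesis .
      qed
    qed
  qed (rule \<open>0 < k\<close>)
qed

text \<open>The inequality of \<open>gap_upper_bound\<close> holds almost surely for each single pair \<open>(y, y')\<close>, hence for all
pairs in a countable dense subset of the graph over the ball simultaneously, and by continuity for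
all pairs.\<close>

lemma expected_gap_bound:
  assumes "cball a \<delta> \<subseteq> C" "cball a \<delta> \<subseteq> op_dom A" "0 \<le> \<delta>" "0 < t"
  shows "ereal_expectation M (\<lambda>\<omega>. gap_fun A (cball a \<delta>) (time_average X t \<omega>))
    \<le> ereal ((2 * (\<integral>\<omega>. (norm (X 0 \<omega> - a))\<^sup>2 \<partial>M) + 2 * \<delta>\<^sup>2 + \<delta> * (1 + \<Lambda>) + \<Lambda> + 1) / 2 / t)"
proof -
  have a: "a \<in> cball a \<delta>" using \<open>0 \<le> \<delta>\<close> by simp
  then obtain a' where a': "a \<in> C" "a' \<in> A a" using assms(1,2) unfolding op_dom_def by blast
  define c where "c = 2 * (\<integral>\<omega>. (norm (X 0 \<omega> - a))\<^sup>2 \<partial>M) + 2 * \<delta>\<^sup>2 + \<delta> * (1 + \<Lambda>) + \<Lambda> + 1"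
  have c0: "0 \<le> c"
  proof -
    have "0 \<le> (\<integral>\<omega>. (norm (X 0 \<omega> - a))\<^sup>2 \<partial>M)" "0 \<le> 2 * \<delta>\<^sup>2" by simp_all
    moreover have "0 \<le> \<delta> * (1 + \<Lambda>)" using \<open>0 \<le> \<delta>\<close> \<Lambda>_nonneg by simp
    ultimately show ?thesis unfolding c_def using \<Lambda>_nonneg by linarith
  qed
  obtain R k where R: "R \<in> borel_measurable M" "0 < k" "(\<integral>\<^sup>+\<omega>. R \<omega> \<partial>M) \<le> ennreal (c + k)"
    and le: "\<And>y y'. y \<in> C \<Longrightarrow> y' \<in> A y \<Longrightarrow> dist a y \<le> \<delta> \<Longrightarrow>
      AE \<omega> in M. ennreal (2 * t * (y' \<bullet> (time_average X t \<omega> - y)) + k) \<le> R \<omega>"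
    using gap_upper_bound[OF a' assms(4,3)] unfolding c_def by blast
  define G where "G = {(y, y'). y \<in> cball a \<delta> \<and> y' \<in> A y}"
  obtain D where D: "countable D" "D \<subseteq> G" "G \<subseteq> closure D" using separable[of G] by blast
  have "AE \<omega> in M. \<forall>(y, y')\<in>D. ennreal (2 * t * (y' \<bullet> (time_average X t \<omega> - y)) + k) \<le> R \<omega>"
    using le D(2) assms(1) by (subst AE_ball_countable[OF D(1)]) (auto simp: G_def subset_iff)
  moreover have "AE \<omega> in M. R \<omega> \<noteq> \<infinity>"
    using R(1) le_less_trans[OF R(3) ennreal_less_top] by (intro nn_integral_PInf_AE) auto
  note fin = this
  ultimately have gap: "AE \<omega> in M. gap_fun A (cball a \<delta>) (time_average X t \<omega>) \<le> ereal ((enn2real (R \<omega>) - k) / (2 * t))"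
  proof eventually_elim
    case (elim \<omega>)
    let ?f = "\<lambda>p. ennreal (2 * t * (snd p \<bullet> (time_average X t \<omega> - fst p)) + k)"
    have cont: "continuous_on UNIV ?f" by (intro continuous_on_ennreal continuous_intros)
    have "closed {p. ?f p \<le> R \<omega>}"
      using continuous_closed_vimage[of "{..R \<omega>}" ?f] cont
      by (auto simp: continuous_on_eq_continuous_at vimage_def)
    moreover have "D \<subseteq> {p. ?f p \<le> R \<omega>}" using elim(1) by auto
    ultimately have "closure D \<subseteq> {p. ?f p \<le> R \<omega>}" by (rule closure_minimal[rotated])
    then have *: "?f p \<le> R \<omega>" if "p \<in> G" for p using that D(3) by blast
    have "y' \<bullet> (time_average X t \<omega> - y) \<le> (enn2real (R \<omega>) - k) / (2 * t)"
      if "y \<in> cball a \<delta>" "y' \<in> A y" for y y'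
    proof -
      have "ennreal (2 * t * (y' \<bullet> (time_average X t \<omega> - y)) + k) \<le> R \<omega>"
        using *[of "(y, y')"] that by (simp add: G_def)
      also have "R \<omega> = ennreal (enn2real (R \<omega>))" using elim(2) by (simp add: less_top)
      finally have "2 * t * (y' \<bullet> (time_average X t \<omega> - y)) + k \<le> enn2real (R \<omega>)"
        by (simp add: ennreal_le_iff)
      then show ?thesis using \<open>0 < t\<close> by (simp add: field_simps)
    qed
    then show ?case unfolding gap_fun_def by (intro Sup_least) auto
  qed
  have nR: "(\<integral>\<^sup>+\<omega>. ennreal (enn2real (R \<omega>)) \<partial>M) \<le> ennreal (c + k)"
    using R(3) fin by (subst nn_integral_cong_AE[of _ R]) (auto elim!: eventually_mono simp: less_top)
  have Rm: "(\<lambda>\<omega>. enn2real (R \<omega>)) \<in> borel_measurable M" using R(1) by measurable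
  have Ri: "integrable M (\<lambda>\<omega>. enn2real (R \<omega>))" "(\<integral>\<omega>. enn2real (R \<omega>) \<partial>M) \<le> c + k"
    using integral_le_of_nn_integral_le[OF Rm enn2real_nonneg nR] c0 \<open>0 < k\<close> by auto
  have "ereal_expectation M (\<lambda>\<omega>. gap_fun A (cball a \<delta>) (time_average X t \<omega>))
      \<le> ereal (\<integral>\<omega>. (enn2real (R \<omega>) - k) / (2 * t) \<partial>M)"
    by (rule ereal_expectation_le[OF _ gap]) (use Ri in simp)
  also have "(\<integral>\<omega>. (enn2real (R \<omega>) - k) / (2 * t) \<partial>M) \<le> c / 2 / t"
  proof -
    have "(\<integral>\<omega>. enn2real (R \<omega>) \<partial>M) - k \<le> c" using Ri(2) by simp
    then have "((\<integral>\<omega>. enn2real (R \<omega>) \<partial>M) - k) / (2 * t) \<le> c / (2 * t)"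
      using \<open>0 < t\<close> by (intro divide_right_mono) auto
    moreover have mean: "(\<integral>\<omega>. (enn2real (R \<omega>) - k) / (2 * t) \<partial>M) = ((\<integral>\<omega>. enn2real (R \<omega>) \<partial>M) - k) / (2 * t)"
      using Ri by (simp add: prob_space)
    ultimately show ?thesis unfolding mean by simp
  qed
  finally show ?thesis unfolding c_def by simp
qed

end

section \<open>The theorem\<close>

lemma normal_cone_interior:
  assumes "x \<in> interior C"
  shows "normal_cone C x = {0}"
proof -
  have x: "x \<in> C" using assms interior_subset by blast
  have "p = 0" if p: "\<And>u. u \<in> C \<Longrightarrow> p \<bullet> (u - x) \<le> 0" for p
  proof (rule ccontr)
    assume "p \<noteq> 0"
    obtain e where e: "0 < e" "cball x e \<subseteq> C" using assms unfolding mem_interior_cball by blast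
    have "x + (e / norm p) *\<^sub>R p \<in> C" using e \<open>p \<noteq> 0\<close> by (intro subsetD[OF e(2)]) (simp add: dist_norm)
    from p[OF this] have "(e / norm p) * (p \<bullet> p) \<le> 0" by simp
    moreover have "0 < (e / norm p) * (p \<bullet> p)" using e(1) \<open>p \<noteq> 0\<close> by simp
    ultimately show False by simp
  qed
  then show ?thesis using x by (auto simp: normal_cone_def)
qed

lemma gap_fun_cong:
  assumes "\<And>y. y \<in> B \<Longrightarrow> T y = T' y"
  shows "gap_fun T B = gap_fun T' B"
proof
  fix x
  have "{ereal (v \<bullet> (x - y)) | y v. y \<in> B \<and> v \<in> T y} = {ereal (v \<bullet> (x - y)) | y v. y \<in> B \<and> v \<in> T' y}"
    using assms by blast
  then show "gap_fun T B x = gap_fun T' B x" by (simp add: gap_fun_def)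
qed

text \<open>By continuity in \<open>x\<close>, the supremum of \<open>\<sigma>\<close> over \<open>x\<close> is a supremum over a countable dense set, hence
measurable in time. Its squared integral is then additive over intervals and so the increment of
one function \<open>L\<close>.\<close>

lemma coefficient_energy_bound:
  fixes \<sigma> :: "real \<Rightarrow> 'b::{second_countable_topology, real_normed_vector} \<Rightarrow> 'c::{second_countable_topology, real_normed_vector}"
  assumes \<sigma>: "(\<lambda>(t, x). \<sigma> t x) \<in> borel_measurable (restrict_space borel {0..} \<Otimes>\<^sub>M borel)"
    and lip: "\<And>t x y. 0 \<le> t \<Longrightarrow> norm (\<sigma> t x - \<sigma> t y) \<le> \<l> t * norm (x - y)"
    and fin: "(\<integral>\<^sup>+ t\<in>{0..}. (SUP x. ennreal (norm (\<sigma> t x)))\<^sup>2 \<partial>lborel) < \<infinity>"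
  shows "\<exists>L. bdd_above (range L) \<and> (\<forall>s t. 0 \<le> s \<longrightarrow> s \<le> t \<longrightarrow> L s \<le> L t \<and>
      (\<forall>x. (\<integral>\<^sup>+ r\<in>{s<..t}. ennreal ((norm (\<sigma> r (x r)))\<^sup>2) \<partial>lborel) \<le> ennreal (L t - L s)))"
proof -
  obtain D :: "'b set" where D: "countable D" "\<And>U. open U \<Longrightarrow> U \<noteq> {} \<Longrightarrow> \<exists>d\<in>D. d \<in> U"
    using countable_dense_exists by blast
  define S where "S t = (SUP x\<in>D. ennreal (norm (\<sigma> t x)))" for t
  have S_upper: "ennreal (norm (\<sigma> t x)) \<le> S t" if "0 \<le> t" for t x
  proof (rule ennreal_le_epsilon)
    fix e :: real assume "0 < e"
    define d where "d = e / (\<bar>\<l> t\<bar> + 1)"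
    have "0 < d" using \<open>0 < e\<close> by (simp add: d_def)
    obtain y where y: "y \<in> D" "y \<in> ball x d" using D(2)[of "ball x d"] \<open>0 < d\<close> by auto
    have "norm (\<sigma> t x) \<le> norm (\<sigma> t y) + norm (\<sigma> t x - \<sigma> t y)" by (metis norm_triangle_sub)
    also have "norm (\<sigma> t x - \<sigma> t y) \<le> \<bar>\<l> t\<bar> * norm (x - y)"
      using lip[OF that, of x y] by (smt (verit) mult_right_mono norm_ge_zero)
    also have "\<dots> \<le> (\<bar>\<l> t\<bar> + 1) * d" using y(2) by (intro mult_mono) (auto simp: dist_norm)
    also have "\<dots> = e" by (simp add: d_def)
    finally have "norm (\<sigma> t x) \<le> norm (\<sigma> t y) + e" by simp
    then have "ennreal (norm (\<sigma> t x)) \<le> ennreal (norm (\<sigma> t y)) + ennreal e"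
      using \<open>0 < e\<close> by (simp add: ennreal_plus[symmetric] ennreal_leI del: ennreal_plus)
    also have "ennreal (norm (\<sigma> t y)) \<le> S t" unfolding S_def using y(1) by (rule SUP_upper)
    finally show "ennreal (norm (\<sigma> t x)) \<le> S t + ennreal e" by (simp add: add_right_mono)
  qed
  define f where "f t = S t ^ 2 * indicator {0..} t" for t
  have \<sigma>x: "(\<lambda>t. \<sigma> t x) \<in> borel_measurable (restrict_space borel {0..})" for x
    using measurable_compose[OF measurable_Pair2'[of x borel "restrict_space borel {0..}"] \<sigma>] by simp
  have "(\<lambda>t. S t ^ 2) \<in> borel_measurable (restrict_space borel {0..})"
    unfolding S_def using D(1) \<sigma>x by measurable
  then have fm[measurable]: "f \<in> borel_measurable borel"
    unfolding f_def by (subst (asm) borel_measurable_restrict_space_iff_ennreal) auto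
  have "(\<integral>\<^sup>+t. f t \<partial>lborel) \<le> (\<integral>\<^sup>+ t\<in>{0..}. (SUP x. ennreal (norm (\<sigma> t x)))\<^sup>2 \<partial>lborel)"
    unfolding f_def S_def by (intro nn_integral_mono mult_right_mono power_mono SUP_subset_mono) auto
  then have f_fin: "(\<integral>\<^sup>+t. f t \<partial>lborel) < \<infinity>" using fin by (rule le_less_trans)
  define P where "P t = (\<integral>\<^sup>+r\<in>{0..t}. f r \<partial>lborel)" for t
  have P_fin: "P t \<le> (\<integral>\<^sup>+t. f t \<partial>lborel)" for t
    unfolding P_def by (intro nn_integral_mono) (auto split: split_indicator)
  then have P_fin': "P t < \<infinity>" for t using f_fin by (rule le_less_trans)
  define L where "L t = enn2real (P t)" for t
  have P_L: "P t = ennreal (L t)" for t using P_fin'[of t] by (simp add: L_def)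
  have L0: "0 \<le> L t" for t by (simp add: L_def)
  have P_add: "P t = P s + (\<integral>\<^sup>+r\<in>{s<..t}. f r \<partial>lborel)" if "0 \<le> s" "s \<le> t" for s t
  proof -
    have "P t = (\<integral>\<^sup>+r. f r * indicator {0..s} r + f r * indicator {s<..t} r \<partial>lborel)"
      unfolding P_def using that by (intro nn_integral_cong) (auto split: split_indicator)
    also have "\<dots> = P s + (\<integral>\<^sup>+r\<in>{s<..t}. f r \<partial>lborel)"
      unfolding P_def by (rule nn_integral_add) auto
    finally show ?thesis .
  qed
  have mono: "L s \<le> L t" if "0 \<le> s" "s \<le> t" for s t
  proof -
    have "ennreal (L s) \<le> ennreal (L t)" unfolding P_L[symmetric] P_add[OF that] by simp
    then show ?thesis using L0 by (simp add: ennreal_le_iff)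
  qed
  show ?thesis
  proof (intro exI[of _ L] conjI allI impI mono)
    show "bdd_above (range L)"
    proof (rule bdd_aboveI2)
      fix t
      show "L t \<le> enn2real (\<integral>\<^sup>+t. f t \<partial>lborel)"
        unfolding L_def using P_fin f_fin by (intro enn2real_mono) auto
    qed
  next
    fix s t x assume st: "0 \<le> s" "s \<le> (t::real)"
    have "(\<integral>\<^sup>+ r\<in>{s<..t}. ennreal ((norm (\<sigma> r (x r)))\<^sup>2) \<partial>lborel) \<le> (\<integral>\<^sup>+r\<in>{s<..t}. f r \<partial>lborel)"
    proof (rule nn_integral_mono)
      fix r
      show "ennreal ((norm (\<sigma> r (x r)))\<^sup>2) * indicator {s<..t} r \<le> f r * indicator {s<..t} r"
      proof (cases "r \<in> {s<..t}")
        case True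
        then have r: "0 \<le> r" using st by simp
        then have "ennreal (norm (\<sigma> r (x r))) ^ 2 \<le> S r ^ 2" by (intro power_mono S_upper) auto
        then show ?thesis using r True by (simp add: f_def ennreal_power)
      qed simp
    qed
    also have "\<dots> = ennreal (L t - L s)"
    proof -
      have "ennreal (L s) + (\<integral>\<^sup>+r\<in>{s<..t}. f r \<partial>lborel) = ennreal (L s) + ennreal (L t - L s)"
        using P_add[OF st] mono[OF st] L0 by (simp add: P_L ennreal_plus[symmetric] del: ennreal_plus)
      then show ?thesis by (simp add: ennreal_add_left_cancel)
    qed
    finally show "(\<integral>\<^sup>+ r\<in>{s<..t}. ennreal ((norm (\<sigma> r (x r)))\<^sup>2) \<partial>lborel) \<le> ennreal (L t - L s)" .
  qed
qed

theorem theorem3p5: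
  fixes M :: "'w measure" and F :: "real \<Rightarrow> 'w measure"
    and W :: "real \<Rightarrow> 'w \<Rightarrow> real ^ 'm"
    and A :: "real ^ 'd \<Rightarrow> (real ^ 'd) set" and C :: "(real ^ 'd) set"
    and \<Psi> :: "real ^ 'd \<Rightarrow> real" and grad_\<Psi> :: "real ^ 'd \<Rightarrow> real ^ 'd"
    and \<beta> \<l> :: "real \<Rightarrow> real"
    and \<sigma> :: "real \<Rightarrow> real ^ 'd \<Rightarrow> real ^ 'm ^ 'd"
    and \<xi> :: "'w \<Rightarrow> real ^ 'd"
    and X K :: "real \<Rightarrow> 'w \<Rightarrow> real ^ 'd"
    and a :: "real ^ 'd" and \<delta> :: real
  assumes "filtered_prob_space M F" and "brownian_motion M F W"
    and "maximally_monotone A"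
    and "C \<noteq> {}" and "closed C" and "convex C"
    and "interior (op_dom A) \<inter> interior C \<noteq> {}"
    and "maximally_monotone (op_plus A (normal_cone C))"
    and "{x. 0 \<in> op_plus A (normal_cone C) x} \<noteq> {}"
    and "C \<subseteq> op_dom A" and "usc_on C A"
    and "convex_on UNIV \<Psi>"
    and "\<And>x. GDERIV \<Psi> x :> grad_\<Psi> x" and "continuous_on UNIV grad_\<Psi>"
    and "\<exists>L. L-lipschitz_on UNIV grad_\<Psi>"
    and "C = \<Psi> -` {0}" and "C = {x. \<forall>y. \<Psi> x \<le> \<Psi> y}"
    and "\<And>t. 0 \<le> t \<Longrightarrow> 0 < \<beta> t" and "mono_on {0..} \<beta>"
    and "\<And>T. 0 < T \<Longrightarrow> abs_continuous_on 0 T \<beta>"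
    and "attouch_czarnecki \<beta> \<Psi> C"
    and "(\<lambda>(t, x). \<sigma> t x) \<in> borel_measurable (restrict_space borel {0..} \<Otimes>\<^sub>M borel)"
    and "\<And>t x y. 0 \<le> t \<Longrightarrow> norm (\<sigma> t x - \<sigma> t y) \<le> \<l> t * norm (x - y)"
    and "\<And>t. 0 \<le> t \<Longrightarrow> 0 \<le> \<l> t"
    and "set_borel_measurable lebesgue {0..} \<l>"
    and "set_integrable lebesgue {0..} (\<lambda>t. (\<l> t)\<^sup>2)"
    and "\<xi> \<in> borel_measurable M" and "integrable M (\<lambda>\<omega>. (norm (\<xi> \<omega>))\<^sup>2)"
    and "AE \<omega> in M. \<xi> \<omega> \<in> closure (op_dom A)"
    and "strong_solution M F W A (\<lambda>t x. \<beta> t *\<^sub>R grad_\<Psi> x) \<sigma> \<xi> X K"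
    and "a \<in> interior (op_dom A) \<inter> interior C" and "0 < \<delta>"
    and "cball a \<delta> \<subseteq> interior (op_dom A) \<inter> interior C"
    and "(\<integral>\<^sup>+ t\<in>{0..}. (SUP x. ennreal (norm (\<sigma> t x)))\<^sup>2 \<partial>lborel) < \<infinity>"
  shows "\<exists>c::real. \<forall>t>0.
    ereal_expectation M
      (\<lambda>\<omega>. gap_fun (op_plus A (normal_cone C)) (cball a \<delta>) (time_average X t \<omega>)) \<le> ereal (c / t)"
proof -
  interpret stochastic_basis M F by unfold_locales (rule assms(1))
  note sol = assms(30)[unfolded strong_solution_def]
  obtain I where ito: "ito_integral M F W (\<lambda>t \<omega>. \<sigma> t (X t \<omega>)) I"
    and eq: "AE \<omega> in M. \<forall>t\<ge>0. X t \<omega> = X 0 \<omega> - (LINT s:{0..t}|lborel. \<beta> s *\<^sub>R grad_\<Psi> (X s \<omega>)) + I t \<omega> - (K t \<omega> - K 0 \<omega>)"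
    using sol by blast
  have X: "continuous_adapted M F X" and K: "continuous_adapted M F K" and X0: "AE \<omega> in M. X 0 \<omega> = \<xi> \<omega>"
    and bv: "\<And>T. 0 < T \<Longrightarrow> AE \<omega> in M. bounded_variation_on 0 T (\<lambda>t. K t \<omega>)"
    and mon: "\<And>T \<zeta> \<zeta>'. 0 < T \<Longrightarrow> continuous_adapted M F \<zeta> \<Longrightarrow> continuous_adapted M F \<zeta>' \<Longrightarrow>
        (\<forall>\<omega>\<in>space M. \<forall>t\<in>{0..T}. (\<zeta> t \<omega>, \<zeta>' t \<omega>) \<in> op_graph A) \<Longrightarrow>
        (AE \<omega> in M. \<forall>B\<in>sets borel. B \<subseteq> {0..T} \<longrightarrow>
           0 \<le> pairing_measure T (\<lambda>t. X t \<omega> - \<zeta> t \<omega>) (\<lambda>t. K t \<omega>) (\<lambda>t. \<zeta>' t \<omega>) B)"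
    using sol by blast+
  obtain L where "bdd_above (range L) \<and> (\<forall>s t. 0 \<le> s \<longrightarrow> s \<le> t \<longrightarrow> L s \<le> L t \<and>
      (\<forall>x. (\<integral>\<^sup>+ r\<in>{s<..t}. ennreal ((norm (\<sigma> r (x r)))\<^sup>2) \<partial>lborel) \<le> ennreal (L t - L s)))"
    using coefficient_energy_bound[OF assms(22,23,34)] by (rule exE)
  then have L: "\<And>s t. 0 \<le> s \<Longrightarrow> s \<le> t \<Longrightarrow> L s \<le> L t" "bdd_above (range L)"
    "\<And>s t x. 0 \<le> s \<Longrightarrow> s \<le> t \<Longrightarrow>
      (\<integral>\<^sup>+ r\<in>{s<..t}. ennreal ((norm (\<sigma> r (x r)))\<^sup>2) \<partial>lborel) \<le> ennreal (L t - L s)"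
    by simp_all
  obtain l where l: "\<And>t. L t \<le> l" using L(2) unfolding bdd_above_def by blast
  have mart: "L2_martingale (\<lambda>t. real CARD('m) * L t) I"
    by (rule ito_integral_L2_martingale[OF assms(2) ito L(1) L(3)])
  interpret averaged_solution M F A C "\<lambda>t x. \<beta> t *\<^sub>R grad_\<Psi> x" X K I
    "\<lambda>t. real CARD('m) * L t" "real CARD('m) * (l - L 0)"
  proof unfold_locales
    show "continuous_adapted M F I" using ito by (simp add: ito_integral_def)
    show "set_integrable lborel {0..T} (\<lambda>s. \<beta> s *\<^sub>R grad_\<Psi> (X s \<omega>))" if "0 < T" "\<omega> \<in> space M" for T \<omega>
    proof (rule borel_integrable_atLeastAtMost')
      have Xc: "continuous_on {0..T} (\<lambda>s. X s \<omega>)"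
      proof (rule continuous_on_subset)
        show "continuous_on {0..} (\<lambda>s. X s \<omega>)"
          using X that(2) unfolding continuous_adapted_def by blast
      qed auto
      show "continuous_on {0..T} (\<lambda>s. \<beta> s *\<^sub>R grad_\<Psi> (X s \<omega>))"
        by (rule continuous_on_scaleR[OF abs_continuous_on_imp_continuous_on[OF assms(20)[OF that(1)]]
              continuous_on_compose2[OF assms(14) Xc subset_UNIV]])
    qed
    show "0 \<le> (\<beta> s *\<^sub>R grad_\<Psi> x) \<bullet> (x - y)" if "0 \<le> s" "y \<in> C" for s x y
    proof -
      have "\<Psi> y \<le> \<Psi> x" using that(2) assms(17) by blast
      then have "0 \<le> grad_\<Psi> x \<bullet> (x - y)" by (rule convex_gradient_drift[OF assms(12,13)])
      then show ?thesis using assms(18)[OF that(1)] by simp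
    qed
    show "AE \<omega> in M. \<forall>B\<in>sets borel. B \<subseteq> {0..T} \<longrightarrow>
        0 \<le> pairing_measure T (\<lambda>t. X t \<omega> - y) (\<lambda>t. K t \<omega>) (\<lambda>t. y') B" if "0 < T" "y' \<in> A y" for T y y'
    proof (rule mon[of T "\<lambda>_ _. y" "\<lambda>_ _. y'"])
      show "\<forall>\<omega>\<in>space M. \<forall>t\<in>{0..T}. (y, y') \<in> op_graph A" using that(2) by (simp add: op_graph_def)
    qed (simp_all add: continuous_adapted_def that(1))
    show "real CARD('m) * L t - real CARD('m) * L 0 \<le> real CARD('m) * (l - L 0)" for t
      unfolding right_diff_distrib[symmetric] using l by (intro mult_left_mono) auto
    show "integrable M (\<lambda>\<omega>. (norm (X 0 \<omega>))\<^sup>2)"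
    proof (rule integrable_cong_AE_imp[OF assms(28)])
      show "(\<lambda>\<omega>. (norm (X 0 \<omega>))\<^sup>2) \<in> borel_measurable M"
      proof -
        have "X 0 \<in> borel_measurable (F 0)" using X unfolding continuous_adapted_def by simp
        then have [measurable]: "X 0 \<in> borel_measurable M" by (rule measurable_F_M[OF order_refl])
        show ?thesis by measurable
      qed
      show "AE \<omega> in M. (norm (\<xi> \<omega>))\<^sup>2 = (norm (X 0 \<omega>))\<^sup>2" using X0 by eventually_elim simp
    qed
  qed (fact X K mart bv eq)+
  have sub: "cball a \<delta> \<subseteq> C" "cball a \<delta> \<subseteq> op_dom A" using assms(33) interior_subset by blast+
  have "op_plus A (normal_cone C) y = A y" if "y \<in> cball a \<delta>" for y
    using normal_cone_interior[of y C] assms(33) that by (auto simp: op_plus_def)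
  then have gap: "gap_fun (op_plus A (normal_cone C)) (cball a \<delta>) = gap_fun A (cball a \<delta>)"
    by (rule gap_fun_cong)
  show ?thesis
    unfolding gap by (intro exI allI impI) (rule expected_gap_bound[OF sub less_imp_le[OF assms(32)]])
qed

end
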